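(* Let $d,n\in\mathbb{Z}_{>0}$ and $m\in\mathbb{Z}_{>0}\cup\{\infty\}$. Each of the sets $\mathcal{B}^{\mathrm{AK}}_{d,m,n}$, $\mathcal{B}^{\mathrm{Ind}}_{d,m,n}$, $\mathcal{B}^{\mathrm{Ind}-}_{d,m,n}$, $\widetilde{\mathcal{B}}^{\mathrm{Ind}}_{d,m,n}$ and $\widetilde{\mathcal{B}}^{\mathrm{Ind}-}_{d,m,n}$ generates (linearly over $\mathcal{R}_m$) the algebra $\mathrm{Y}(d,m,n)$.
   Context: Algebra. Let $q,v_1,v_2,\ldots$ be indeterminates; $\mathcal{R}_m:=\mathbb{C}[q^{\pm1},v_1^{\pm1},\ldots,v_m^{\pm1}]$ for $m<\infty$ and $\mathcal{R}_\infty:=\mathbb{C}[q^{\pm1}]$. Set $E_m:=\{0,\ldots,m-1\}$ for $m<\infty$ and $E_\infty:=\mathbb{Z}$. $\mathrm{Y}(d,m,n)$ is the associative $\mathcal{R}_m$-algebra generated by $t_1,\ldots,t_n,g_1,\ldots,g_{n-1},X_1^{\pm1}$ with relations: $g_ig_j=g_jg_i$ if $|i-j|>1$; $g_ig_{i+1}g_i=g_{i+1}g_ig_{i+1}$; $t_it_j=t_jt_i$; $t_jg_i=g_it_{s_i(j)}$ with $s_i=(i,i+1)$; $t_j^d=1$; $g_i^2=1+(q-q^{-1})e_ig_i$ with $e_i:=\frac1d\sum_{s=0}^{d-1}t_i^st_{i+1}^{-s}$; $X_1g_1X_1g_1=g_1X_1g_1X_1$; $X_1g_i=g_iX_1$ for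 $i\ge2$; $X_1t_j=t_jX_1$ for all $j$; and, if $m<\infty$, $(X_1-v_1)\cdots(X_1-v_m)=0$. Each $g_i$ is invertible with $g_i^{-1}=g_i-(q-q^{-1})e_i$. Define $X_{i+1}:=g_iX_ig_i$ for $i=1,\ldots,n-1$. The subalgebra of $\mathrm{Y}(d,m,n)$ generated by $t_1,\ldots,t_n,g_1,\ldots,g_{n-1}$ is identified with the Yokonuma--Hecke algebra $\mathrm{Y}_m(d,n)$ (presented over $\mathcal{R}_m$ by the relations above not involving $X_1$), which is known to be a free $\mathcal{R}_m$-module of rank $d^nn!$. Let $\mathcal{B}_{d,n}$ be an $\mathcal{R}_m$-basis of $\mathrm{Y}_m(d,n)$. Sets. $\mathcal{B}^{\mathrm{AK}}_{d,m,n}$ is the set of elements $X_1^{a_1}\cdots X_n^{a_n}\,\omega$ with $(a_1,\ldots,a_n)\in E_m^n$, $\omega\in\mathcal{B}_{d,n}$. For $k=1,\ldots,n$, $J\in\{0,\ldots,k-1\}$, $a,b\in\mathbb{Z}$ put $W^{(k)}_{J,a,b}:=g_J^{-1}\cdots g_1^{-1}X_1^at_1^bg_1g_2\cdots g_{k-1}$, $W^{(k)-}_{J,a,b}:=g_J\cdots g_1X_1^at_1^bg_1^{-1}g_2^{-1}\cdots g_{k-1}^{-1}$, $\widetilde W^{(k)}_{J,a,b}:=g_J\cdots g_1X_1^at_1^bg_1g_2\cdots g_{k-1}$, $\widetilde W^{(k)-}_{J,a,b}:=g_J^{-1}\cdots g_1^{-1}X_1^at_1^bg_1^{-1}g_2^{-1}\cdots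 g_{k-1}^{-1}$ (empty products equal $1$). Then $\mathcal{B}^{\mathrm{Ind}}_{d,m,n}$ is the set of elements $W^{(n)}_{J_n,a_n,b_n}\cdots W^{(2)}_{J_2,a_2,b_2}W^{(1)}_{J_1,a_1,b_1}$ with $J_k\in\{0,\ldots,k-1\}$, $a_k\in E_m$, $b_k\in\{0,\ldots,d-1\}$; and $\mathcal{B}^{\mathrm{Ind}-}_{d,m,n}$, $\widetilde{\mathcal{B}}^{\mathrm{Ind}}_{d,m,n}$, $\widetilde{\mathcal{B}}^{\mathrm{Ind}-}_{d,m,n}$ are defined in the same way with $W^{(k)}$ replaced by $W^{(k)-}$, $\widetilde W^{(k)}$, $\widetilde W^{(k)-}$ respectively. *)

theory Defs
  imports
    "HOL-Algebra.Algebra"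
    "HOL-Library.Poly_Mapping"
    "HOL-Library.Extended_Nat"
    "HOL-Combinatorics.Transposition"
begin

section \<open>The coefficient ring \<open>\<R>\<^sub>m\<close>\<close>

datatype indet = Ind_q | Ind_v nat

text \<open>Laurent polynomials in all the indeterminates form the group algebra, with complex
  coefficients, of the group of finitely supported integer exponent vectors; \<open>\<R>\<^sub>m\<close> is the
  subring of those involving only the admissible indeterminates.\<close>

type_synonym laurent = "(indet \<Rightarrow>\<^sub>0 int) \<Rightarrow>\<^sub>0 complex"

definition indet_pow :: "indet \<Rightarrow> int \<Rightarrow> laurent" where
  "indet_pow x a = Poly_Mapping.single (Poly_Mapping.single x a) 1"

definition indets :: "enat \<Rightarrow> indet set" where
  "indets m = (case m of enat k \<Rightarrow> insert Ind_q (Ind_v ` {1..k}) | \<infinity> \<Rightarrow> {Ind_q})"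

definition coeff_ring :: "enat \<Rightarrow> laurent ring" where
  "coeff_ring m =
    \<lparr>carrier = {f. \<forall>\<alpha>\<in>Poly_Mapping.keys f. Poly_Mapping.keys \<alpha> \<subseteq> indets m},
     monoid.mult = (*), monoid.one = 1, ring.zero = 0, ring.add = (+)\<rparr>"

lemma coeff_ring_simps [simp]:
  "monoid.mult (coeff_ring m) = (*)" "\<one>\<^bsub>coeff_ring m\<^esub> = 1"
  "\<zero>\<^bsub>coeff_ring m\<^esub> = 0" "ring.add (coeff_ring m) = (+)"
  by (simp_all add: coeff_ring_def)

lemma coeff_ring_carrierI:
  "(\<And>\<alpha>. \<alpha> \<in> Poly_Mapping.keys f \<Longrightarrow> Poly_Mapping.keys \<alpha> \<subseteq> indets m) \<Longrightarrow> f \<in> carrier (coeff_ring m)"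
  by (simp add: coeff_ring_def)

lemma coeff_ring_carrierD:
  "f \<in> carrier (coeff_ring m) \<Longrightarrow> \<alpha> \<in> Poly_Mapping.keys f \<Longrightarrow> Poly_Mapping.keys \<alpha> \<subseteq> indets m"
  by (simp add: coeff_ring_def)

lemma coeff_ring_closed [simp, intro]:
  "0 \<in> carrier (coeff_ring m)" "1 \<in> carrier (coeff_ring m)"
  "f \<in> carrier (coeff_ring m) \<Longrightarrow> - f \<in> carrier (coeff_ring m)"
  "f \<in> carrier (coeff_ring m) \<Longrightarrow> g \<in> carrier (coeff_ring m) \<Longrightarrow> f + g \<in> carrier (coeff_ring m)"
  "f \<in> carrier (coeff_ring m) \<Longrightarrow> g \<in> carrier (coeff_ring m) \<Longrightarrow> f * g \<in> carrier (coeff_ring m)"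
proof -
  show "0 \<in> carrier (coeff_ring m)" "1 \<in> carrier (coeff_ring m)"
    by (auto intro!: coeff_ring_carrierI)
  show "f \<in> carrier (coeff_ring m) \<Longrightarrow> - f \<in> carrier (coeff_ring m)"
    by (auto simp: coeff_ring_def)
  show "f \<in> carrier (coeff_ring m) \<Longrightarrow> g \<in> carrier (coeff_ring m) \<Longrightarrow> f + g \<in> carrier (coeff_ring m)"
    using Poly_Mapping.keys_add[of f g] by (fastforce simp: coeff_ring_def)
  assume f: "f \<in> carrier (coeff_ring m)" and g: "g \<in> carrier (coeff_ring m)"
  show "f * g \<in> carrier (coeff_ring m)"
  proof (rule coeff_ring_carrierI)
    fix \<alpha> assume "\<alpha> \<in> Poly_Mapping.keys (f * g)"
    then obtain a b where ab: "\<alpha> = a + b" "a \<in> Poly_Mapping.keys f" "b \<in> Poly_Mapping.keys g"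
      using keys_mult[of f g] by blast
    then show "Poly_Mapping.keys \<alpha> \<subseteq> indets m"
      using coeff_ring_carrierD[OF f ab(2)] coeff_ring_carrierD[OF g ab(3)]
        Poly_Mapping.keys_add[of a b] by blast
  qed
qed

lemma coeff_ring_sum_closed:
  "(\<And>x. x \<in> S \<Longrightarrow> f x \<in> carrier (coeff_ring m)) \<Longrightarrow> sum f S \<in> carrier (coeff_ring m)"
  by (induction S rule: infinite_finite_induct) auto

lemma coeff_ring_cring: "cring (coeff_ring m)"
proof (rule cringI)
  show "abelian_group (coeff_ring m)"
    by (rule abelian_groupI)
      (auto simp: add.assoc add.commute intro!: bexI[of _ "- _"])
  show "Group.comm_monoid (coeff_ring m)"
    by (rule comm_monoidI) (auto simp: mult.assoc mult.commute)
qed (auto simp: distrib_right)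


section \<open>Free associative algebras\<close>

datatype 'g free_word = Word (letters: "'g list")

instantiation free_word :: (type) monoid_add
begin

definition zero_free_word :: "'a free_word" where
  "0 = Word []"

definition plus_free_word :: "'a free_word \<Rightarrow> 'a free_word \<Rightarrow> 'a free_word" where
  "u + v = Word (letters u @ letters v)"

instance
  by standard (simp_all add: zero_free_word_def plus_free_word_def)

end

text \<open>Words are written additively so that the convolution product of finitely supported
  functions is the (noncommutative) product of the free algebra.\<close>

type_synonym 'g free_alg = "'g free_word \<Rightarrow>\<^sub>0 laurent"

definition scal :: "laurent \<Rightarrow> 'g free_alg" where
  "scal c = Poly_Mapping.single 0 c"

definition letter :: "'g \<Rightarrow> 'g free_alg" where
  "letter x = Poly_Mapping.single (Word [x]) 1"

definition free_algebra :: "enat \<Rightarrow> 'g set \<Rightarrow> 'g free_alg ring" where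
  "free_algebra m \<Gamma> =
    \<lparr>carrier = {f. \<forall>w\<in>Poly_Mapping.keys f.
        set (letters w) \<subseteq> \<Gamma> \<and> Poly_Mapping.lookup f w \<in> carrier (coeff_ring m)},
     monoid.mult = (*), monoid.one = 1, ring.zero = 0, ring.add = (+)\<rparr>"

lemma free_algebra_simps [simp]:
  "monoid.mult (free_algebra m \<Gamma>) = (*)" "\<one>\<^bsub>free_algebra m \<Gamma>\<^esub> = 1"
  "\<zero>\<^bsub>free_algebra m \<Gamma>\<^esub> = 0" "ring.add (free_algebra m \<Gamma>) = (+)"
  by (simp_all add: free_algebra_def)

lemma free_algebra_carrier_iff:
  "f \<in> carrier (free_algebra m \<Gamma>) \<longleftrightarrow>
    (\<forall>w. Poly_Mapping.lookup f w \<in> carrier (coeff_ring m)) \<and>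
    (\<forall>w\<in>Poly_Mapping.keys f. set (letters w) \<subseteq> \<Gamma>)"
proof -
  have "Poly_Mapping.lookup f w \<in> carrier (coeff_ring m)" if "w \<notin> Poly_Mapping.keys f" for w
    using that by (simp add: in_keys_iff)
  then show ?thesis by (auto simp: free_algebra_def)
qed

lemma free_algebra_mult_closed:
  assumes f: "f \<in> carrier (free_algebra m \<Gamma>)" and g: "g \<in> carrier (free_algebra m \<Gamma>)"
  shows "f * g \<in> carrier (free_algebra m \<Gamma>)"
  unfolding free_algebra_carrier_iff
proof (intro conjI allI ballI)
  fix w
  show "Poly_Mapping.lookup (f * g) w \<in> carrier (coeff_ring m)"
    unfolding lookup_mult Sum_any.expand_set when_def using f g
    by (auto intro!: coeff_ring_sum_closed coeff_ring_closed simp: free_algebra_carrier_iff)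
next
  fix w assume "w \<in> Poly_Mapping.keys (f * g)"
  then obtain a b where "w = a + b" "a \<in> Poly_Mapping.keys f" "b \<in> Poly_Mapping.keys g"
    using keys_mult[of f g] by blast
  then show "set (letters w) \<subseteq> \<Gamma>"
    using f g by (auto simp: free_algebra_carrier_iff plus_free_word_def)
qed

lemma free_algebra_closed [simp, intro]:
  "0 \<in> carrier (free_algebra m \<Gamma>)" "1 \<in> carrier (free_algebra m \<Gamma>)"
  "f \<in> carrier (free_algebra m \<Gamma>) \<Longrightarrow> - f \<in> carrier (free_algebra m \<Gamma>)"
  "f \<in> carrier (free_algebra m \<Gamma>) \<Longrightarrow> g \<in> carrier (free_algebra m \<Gamma>) \<Longrightarrow> f + g \<in> carrier (free_algebra m \<Gamma>)"
  "f \<in> carrier (free_algebra m \<Gamma>) \<Longrightarrow> g \<in> carrier (free_algebra m \<Gamma>) \<Longrightarrow> f - g \<in> carrier (free_algebra m \<Gamma>)"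
  "f \<in> carrier (free_algebra m \<Gamma>) \<Longrightarrow> g \<in> carrier (free_algebra m \<Gamma>) \<Longrightarrow> f * g \<in> carrier (free_algebra m \<Gamma>)"
  "f \<in> carrier (free_algebra m \<Gamma>) \<Longrightarrow> f ^ k \<in> carrier (free_algebra m \<Gamma>)"
  "c \<in> carrier (coeff_ring m) \<Longrightarrow> scal c \<in> carrier (free_algebra m \<Gamma>)"
  "x \<in> \<Gamma> \<Longrightarrow> letter x \<in> carrier (free_algebra m \<Gamma>)"
proof -
  show "0 \<in> carrier (free_algebra m \<Gamma>)"
    by (simp add: free_algebra_carrier_iff)
  show one: "1 \<in> carrier (free_algebra m \<Gamma>)"
    by (simp add: free_algebra_carrier_iff lookup_one when_def zero_free_word_def)
  show neg: "f \<in> carrier (free_algebra m \<Gamma>) \<Longrightarrow> - f \<in> carrier (free_algebra m \<Gamma>)" for f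
    by (auto simp: free_algebra_carrier_iff)
  show add: "f \<in> carrier (free_algebra m \<Gamma>) \<Longrightarrow> g \<in> carrier (free_algebra m \<Gamma>) \<Longrightarrow>
      f + g \<in> carrier (free_algebra m \<Gamma>)" for f g
    using Poly_Mapping.keys_add[of f g]
    by (auto simp: free_algebra_carrier_iff lookup_add simp del: free_algebra_simps) blast
  show "f \<in> carrier (free_algebra m \<Gamma>) \<Longrightarrow> g \<in> carrier (free_algebra m \<Gamma>) \<Longrightarrow>
      f - g \<in> carrier (free_algebra m \<Gamma>)"
    using add[OF _ neg, of f g] by simp
  show "f \<in> carrier (free_algebra m \<Gamma>) \<Longrightarrow> g \<in> carrier (free_algebra m \<Gamma>) \<Longrightarrow>
      f * g \<in> carrier (free_algebra m \<Gamma>)"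
    by (rule free_algebra_mult_closed)
  show "f \<in> carrier (free_algebra m \<Gamma>) \<Longrightarrow> f ^ k \<in> carrier (free_algebra m \<Gamma>)"
    by (induction k) (auto simp: one free_algebra_mult_closed)
  show "c \<in> carrier (coeff_ring m) \<Longrightarrow> scal c \<in> carrier (free_algebra m \<Gamma>)"
    by (auto simp: free_algebra_carrier_iff scal_def lookup_single when_def zero_free_word_def)
  show "x \<in> \<Gamma> \<Longrightarrow> letter x \<in> carrier (free_algebra m \<Gamma>)"
    by (auto simp: free_algebra_carrier_iff letter_def lookup_single when_def)
qed

lemma free_algebra_ring: "Ring.ring (free_algebra m \<Gamma>)"
proof (rule ringI)
  show "abelian_group (free_algebra m \<Gamma>)"
    by (rule abelian_groupI)
      (auto simp: add.assoc add.commute intro!: bexI[of _ "- _"])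
  show "Group.monoid (free_algebra m \<Gamma>)"
    by (rule monoidI) (auto simp: mult.assoc)
qed (auto simp: distrib_right distrib_left)

lemma scal_simps: "scal (a + b) = scal a + scal b" "scal (a * b) = scal a * scal b"
  "scal 1 = 1" "scal 0 = 0"
  by (simp_all add: scal_def single_add mult_single)


section \<open>The algebra \<open>Y(d, m, n)\<close>\<close>

text \<open>\<open>Gen_X\<close> and \<open>Gen_X_inv\<close> stand for \<open>X\<^sub>1\<close> and its inverse.\<close>

datatype gen = Gen_t nat | Gen_g nat | Gen_X | Gen_X_inv

definition gens :: "nat \<Rightarrow> gen set" where
  "gens n = Gen_t ` {1..n} \<union> Gen_g ` {1..<n} \<union> {Gen_X, Gen_X_inv}"

text \<open>Since \<open>t\<^sub>j\<^sup>d = 1\<close> is among the relations, \<open>t\<^sub>j\<^sup>-\<^sup>s\<close> is written \<open>t\<^sub>j\<^sup>d\<^sup>-\<^sup>s\<close> for \<open>s \<le> d\<close>.\<close>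

definition e_elt :: "nat \<Rightarrow> nat \<Rightarrow> gen free_alg" where
  "e_elt d i = scal (Poly_Mapping.single 0 (1 / of_nat d)) *
     (\<Sum>s = 0..d - 1. letter (Gen_t i) ^ s * letter (Gen_t (i + 1)) ^ (d - s))"

text \<open>A relation \<open>l = r\<close> is represented by \<open>l - r\<close>.\<close>

inductive_set relators :: "nat \<Rightarrow> enat \<Rightarrow> nat \<Rightarrow> gen free_alg set"
  for d :: nat and m :: enat and n :: nat where
  X_inv_right: "letter Gen_X * letter Gen_X_inv - 1 \<in> relators d m n"
| X_inv_left: "letter Gen_X_inv * letter Gen_X - 1 \<in> relators d m n"
| g_commute: "\<lbrakk>i \<in> {1..<n}; j \<in> {1..<n}; \<bar>int i - int j\<bar> > 1\<rbrakk> \<Longrightarrow>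
    letter (Gen_g i) * letter (Gen_g j) - letter (Gen_g j) * letter (Gen_g i) \<in> relators d m n"
| g_braid: "\<lbrakk>i \<in> {1..<n}; i + 1 \<in> {1..<n}\<rbrakk> \<Longrightarrow>
    letter (Gen_g i) * letter (Gen_g (i + 1)) * letter (Gen_g i)
      - letter (Gen_g (i + 1)) * letter (Gen_g i) * letter (Gen_g (i + 1)) \<in> relators d m n"
| t_commute: "\<lbrakk>i \<in> {1..n}; j \<in> {1..n}\<rbrakk> \<Longrightarrow>
    letter (Gen_t i) * letter (Gen_t j) - letter (Gen_t j) * letter (Gen_t i) \<in> relators d m n"
| t_g: "\<lbrakk>j \<in> {1..n}; i \<in> {1..<n}\<rbrakk> \<Longrightarrow>
    letter (Gen_t j) * letter (Gen_g i)
      - letter (Gen_g i) * letter (Gen_t (Transposition.transpose i (i + 1) j)) \<in> relators d m n"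
| t_order: "j \<in> {1..n} \<Longrightarrow> letter (Gen_t j) ^ d - 1 \<in> relators d m n"
| g_quadratic: "i \<in> {1..<n} \<Longrightarrow>
    letter (Gen_g i) ^ 2
      - (1 + scal (indet_pow Ind_q 1 - indet_pow Ind_q (-1)) * e_elt d i * letter (Gen_g i))
      \<in> relators d m n"
| X_g1: "1 \<in> {1..<n} \<Longrightarrow>
    letter Gen_X * letter (Gen_g 1) * letter Gen_X * letter (Gen_g 1)
      - letter (Gen_g 1) * letter Gen_X * letter (Gen_g 1) * letter Gen_X \<in> relators d m n"
| X_g: "\<lbrakk>i \<in> {1..<n}; i \<ge> 2\<rbrakk> \<Longrightarrow>
    letter Gen_X * letter (Gen_g i) - letter (Gen_g i) * letter Gen_X \<in> relators d m n"
| X_t: "j \<in> {1..n} \<Longrightarrow>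
    letter Gen_X * letter (Gen_t j) - letter (Gen_t j) * letter Gen_X \<in> relators d m n"
| X_cyclotomic: "m = enat k \<Longrightarrow>
    prod_list (map (\<lambda>i. letter Gen_X - scal (indet_pow (Ind_v i) 1)) [1..<k + 1]) \<in> relators d m n"

definition rel_ideal :: "nat \<Rightarrow> enat \<Rightarrow> nat \<Rightarrow> gen free_alg set" where
  "rel_ideal d m n = Idl\<^bsub>free_algebra m (gens n)\<^esub> (relators d m n)"

lemma coeff_ring_single_const [simp, intro]:
  "Poly_Mapping.single 0 z \<in> carrier (coeff_ring m)"
  by (rule coeff_ring_carrierI) (simp split: if_splits)

lemma indet_pow_closed: "x \<in> indets m \<Longrightarrow> indet_pow x a \<in> carrier (coeff_ring m)"
  by (rule coeff_ring_carrierI) (auto simp: indet_pow_def split: if_splits)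

lemma e_elt_closed:
  assumes "i \<in> {1..<n}" shows "e_elt d i \<in> carrier (free_algebra m (gens n))"
proof -
  have sum: "(\<And>x. x \<in> S \<Longrightarrow> f x \<in> carrier (free_algebra m (gens n))) \<Longrightarrow>
      sum f S \<in> carrier (free_algebra m (gens n))" for f :: "nat \<Rightarrow> _" and S
    by (induction S rule: infinite_finite_induct) auto
  show ?thesis
    unfolding e_elt_def using assms
    by (intro free_algebra_closed sum coeff_ring_single_const) (auto simp: gens_def)
qed

lemma relators_closed: "relators d m n \<subseteq> carrier (free_algebra m (gens n))"
proof
  fix x assume "x \<in> relators d m n"
  then show "x \<in> carrier (free_algebra m (gens n))"
  proof cases
    case (t_g j i)
    then have "Transposition.transpose i (i + 1) j \<in> {1..n}"
      by (auto simp: Transposition.transpose_def)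
    then show ?thesis using t_g by (auto simp: gens_def)
  next
    case (g_quadratic i)
    have "Ind_q \<in> indets m" by (simp add: indets_def split: enat.split)
    then have "indet_pow Ind_q 1 - indet_pow Ind_q (-1) \<in> carrier (coeff_ring m)"
      using coeff_ring_closed(3,4) indet_pow_closed by (metis diff_conv_add_uminus)
    then show ?thesis using g_quadratic e_elt_closed by (auto simp: gens_def)
  next
    case (X_cyclotomic k)
    have "set is \<subseteq> {1..k} \<Longrightarrow>
        prod_list (map (\<lambda>i. letter Gen_X - scal (indet_pow (Ind_v i) 1)) is)
          \<in> carrier (free_algebra m (gens n))" for "is"
    proof (induction "is")
      case (Cons i "is")
      then have "indet_pow (Ind_v i) 1 \<in> carrier (coeff_ring m)"
        using X_cyclotomic by (intro indet_pow_closed) (auto simp: indets_def)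
      then show ?case using Cons by (auto simp: gens_def)
    qed auto
    from this[of "[1..<k + 1]"] show ?thesis
      unfolding X_cyclotomic(1) by (simp add: subset_eq del: upt_Suc)
  qed (auto simp: gens_def)
qed

lemma rel_ideal_ideal: "ideal (rel_ideal d m n) (free_algebra m (gens n))"
  unfolding rel_ideal_def by (rule ring.genideal_ideal[OF free_algebra_ring relators_closed])

definition cls :: "nat \<Rightarrow> enat \<Rightarrow> nat \<Rightarrow> gen free_alg \<Rightarrow> gen free_alg set" where
  "cls d m n f = rel_ideal d m n +>\<^bsub>free_algebra m (gens n)\<^esub> f"

definition Yalg :: "nat \<Rightarrow> enat \<Rightarrow> nat \<Rightarrow> (laurent, gen free_alg set) module" where
  "Yalg d m n =
    (let A = free_algebra m (gens n) Quot rel_ideal d m n in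
     \<lparr>carrier = carrier A, monoid.mult = monoid.mult A, monoid.one = monoid.one A,
      ring.zero = ring.zero A, ring.add = ring.add A,
      smult = (\<lambda>c x. cls d m n (scal c) \<otimes>\<^bsub>A\<^esub> x)\<rparr>)"

lemma Yalg_ring: "Ring.ring (Yalg d m n)"
proof -
  let ?A = "free_algebra m (gens n) Quot rel_ideal d m n"
  interpret A: Ring.ring ?A by (rule ideal.quotient_is_ring[OF rel_ideal_ideal])
  show ?thesis
  proof (rule ringI)
    show "abelian_group (Yalg d m n)"
    proof (rule abelian_groupI)
      fix x assume "x \<in> carrier (Yalg d m n)"
      then show "\<exists>y\<in>carrier (Yalg d m n). y \<oplus>\<^bsub>Yalg d m n\<^esub> x = \<zero>\<^bsub>Yalg d m n\<^esub>"
        by (auto simp: Yalg_def Let_def intro!: bexI[of _ "\<ominus>\<^bsub>?A\<^esub> x"] A.l_neg)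
    qed (simp_all add: Yalg_def Let_def A.a_ac)
    show "Group.monoid (Yalg d m n)"
      by (rule monoidI) (auto simp: Yalg_def Let_def A.m_assoc)
  qed (auto simp: Yalg_def Let_def A.l_distr A.r_distr)
qed

lemma Yalg_module: "module (coeff_ring m) (Yalg d m n)"
proof -
  let ?F = "free_algebra m (gens n)"
  let ?A = "?F Quot rel_ideal d m n"
  interpret I: ideal "rel_ideal d m n" ?F by (rule rel_ideal_ideal)
  interpret A: Ring.ring ?A by (rule I.quotient_is_ring)
  interpret Y: Ring.ring "Yalg d m n" by (rule Yalg_ring)
  interpret h: ring_hom_ring ?F ?A "(+>\<^bsub>?F\<^esub>) (rel_ideal d m n)"
    by (rule I.rcos_ring_hom_ring)
  show ?thesis
  proof (intro module.intro module_axioms.intro)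
    show "cring (coeff_ring m)" by (rule coeff_ring_cring)
    show "abelian_group (Yalg d m n)" by (rule Y.abelian_group_axioms)
  qed (use h.hom_closed[OF free_algebra_closed(8)] h.hom_add[OF free_algebra_closed(8,8)]
        h.hom_mult[OF free_algebra_closed(8,8)] h.hom_one in
      \<open>auto simp: Yalg_def Let_def cls_def scal_simps A.l_distr A.r_distr A.m_assoc\<close>)
qed

definition t_el :: "nat \<Rightarrow> enat \<Rightarrow> nat \<Rightarrow> nat \<Rightarrow> gen free_alg set" where
  "t_el d m n j = cls d m n (letter (Gen_t j))"

definition g_el :: "nat \<Rightarrow> enat \<Rightarrow> nat \<Rightarrow> nat \<Rightarrow> gen free_alg set" where
  "g_el d m n i = cls d m n (letter (Gen_g i))"

definition g_inv :: "nat \<Rightarrow> enat \<Rightarrow> nat \<Rightarrow> nat \<Rightarrow> gen free_alg set" where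
  "g_inv d m n i = inv\<^bsub>Yalg d m n\<^esub> g_el d m n i"

text \<open>The value at index \<open>0\<close> is a placeholder.\<close>

fun X_el :: "nat \<Rightarrow> enat \<Rightarrow> nat \<Rightarrow> nat \<Rightarrow> gen free_alg set" where
  "X_el d m n 0 = \<one>\<^bsub>Yalg d m n\<^esub>"
| "X_el d m n (Suc 0) = cls d m n (letter Gen_X)"
| "X_el d m n (Suc (Suc i)) =
     g_el d m n (Suc i) \<otimes>\<^bsub>Yalg d m n\<^esub> X_el d m n (Suc i) \<otimes>\<^bsub>Yalg d m n\<^esub> g_el d m n (Suc i)"

text \<open>The Yokonuma--Hecke algebra, as the \<open>\<R>\<^sub>m\<close>-subalgebra generated by the \<open>t\<^sub>j\<close> and \<open>g\<^sub>i\<close>: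
  a subring containing the scalar multiples of the identity is closed under scalars.\<close>

definition YH :: "nat \<Rightarrow> enat \<Rightarrow> nat \<Rightarrow> gen free_alg set set" where
  "YH d m n = generate_ring (Yalg d m n)
     ((\<lambda>c. c \<odot>\<^bsub>Yalg d m n\<^esub> \<one>\<^bsub>Yalg d m n\<^esub>) ` carrier (coeff_ring m)
      \<union> t_el d m n ` {1..n} \<union> g_el d m n ` {1..<n})"


section \<open>Linear generation and bases\<close>

definition lin_span :: "('a, 'r) ring_scheme \<Rightarrow> ('a, 'b, 's) module_scheme \<Rightarrow> 'b set \<Rightarrow> 'b set" where
  "lin_span R M S =
    {\<Oplus>\<^bsub>M\<^esub>x\<in>A. c x \<odot>\<^bsub>M\<^esub> x | A c. finite A \<and> A \<subseteq> S \<and> c \<in> A \<rightarrow> carrier R}"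

definition lin_generates ::
  "('a, 'r) ring_scheme \<Rightarrow> ('a, 'b, 's) module_scheme \<Rightarrow> 'b set \<Rightarrow> 'b set \<Rightarrow> bool" where
  "lin_generates R M S N \<longleftrightarrow> S \<subseteq> N \<and> lin_span R M S = N"

definition lin_indep :: "('a, 'r) ring_scheme \<Rightarrow> ('a, 'b, 's) module_scheme \<Rightarrow> 'b set \<Rightarrow> bool" where
  "lin_indep R M S \<longleftrightarrow>
    (\<forall>A c. finite A \<and> A \<subseteq> S \<and> c \<in> A \<rightarrow> carrier R \<and> (\<Oplus>\<^bsub>M\<^esub>x\<in>A. c x \<odot>\<^bsub>M\<^esub> x) = \<zero>\<^bsub>M\<^esub>
      \<longrightarrow> (\<forall>x\<in>A. c x = \<zero>\<^bsub>R\<^esub>))"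

definition basis_of ::
  "('a, 'r) ring_scheme \<Rightarrow> ('a, 'b, 's) module_scheme \<Rightarrow> 'b set \<Rightarrow> 'b set \<Rightarrow> bool" where
  "basis_of R M S N \<longleftrightarrow> lin_generates R M S N \<and> lin_indep R M S"


section \<open>The generating sets\<close>

definition mprod :: "('a, 'r) monoid_scheme \<Rightarrow> 'a list \<Rightarrow> 'a" where
  "mprod M xs = foldr (\<otimes>\<^bsub>M\<^esub>) xs \<one>\<^bsub>M\<^esub>"

definition E_set :: "enat \<Rightarrow> int set" where
  "E_set m = (case m of enat k \<Rightarrow> {0..<int k} | \<infinity> \<Rightarrow> UNIV)"

definition B_AK :: "nat \<Rightarrow> enat \<Rightarrow> nat \<Rightarrow> gen free_alg set set \<Rightarrow> gen free_alg set set" where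
  "B_AK d m n B =
    {mprod (Yalg d m n) (map (\<lambda>i. X_el d m n i [^]\<^bsub>Yalg d m n\<^esub> a i) [1..<n + 1])
        \<otimes>\<^bsub>Yalg d m n\<^esub> \<omega> |
      (a :: nat \<Rightarrow> int) \<omega>. (\<forall>i\<in>{1..n}. a i \<in> E_set m) \<and> \<omega> \<in> B}"

text \<open>\<open>W_word d m n l r k J a b\<close> is \<open>l\<^sub>J \<dots> l\<^sub>1 X\<^sub>1\<^sup>a t\<^sub>1\<^sup>b r\<^sub>1 \<dots> r\<^sub>k\<^sub>-\<^sub>1\<close>.\<close>

definition W_word ::
  "nat \<Rightarrow> enat \<Rightarrow> nat \<Rightarrow> (nat \<Rightarrow> gen free_alg set) \<Rightarrow> (nat \<Rightarrow> gen free_alg set)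
    \<Rightarrow> nat \<Rightarrow> nat \<Rightarrow> int \<Rightarrow> int \<Rightarrow> gen free_alg set" where
  "W_word d m n l r k J a b =
     mprod (Yalg d m n) (map l (rev [1..<J + 1]))
     \<otimes>\<^bsub>Yalg d m n\<^esub> X_el d m n 1 [^]\<^bsub>Yalg d m n\<^esub> a
     \<otimes>\<^bsub>Yalg d m n\<^esub> t_el d m n 1 [^]\<^bsub>Yalg d m n\<^esub> b
     \<otimes>\<^bsub>Yalg d m n\<^esub> mprod (Yalg d m n) (map r [1..<k])"

definition W_el :: "nat \<Rightarrow> enat \<Rightarrow> nat \<Rightarrow> nat \<Rightarrow> nat \<Rightarrow> int \<Rightarrow> int \<Rightarrow> gen free_alg set" where
  "W_el d m n = W_word d m n (g_inv d m n) (g_el d m n)"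

definition W_el_minus :: "nat \<Rightarrow> enat \<Rightarrow> nat \<Rightarrow> nat \<Rightarrow> nat \<Rightarrow> int \<Rightarrow> int \<Rightarrow> gen free_alg set" where
  "W_el_minus d m n = W_word d m n (g_el d m n) (g_inv d m n)"

definition Wt_el :: "nat \<Rightarrow> enat \<Rightarrow> nat \<Rightarrow> nat \<Rightarrow> nat \<Rightarrow> int \<Rightarrow> int \<Rightarrow> gen free_alg set" where
  "Wt_el d m n = W_word d m n (g_el d m n) (g_el d m n)"

definition Wt_el_minus :: "nat \<Rightarrow> enat \<Rightarrow> nat \<Rightarrow> nat \<Rightarrow> nat \<Rightarrow> int \<Rightarrow> int \<Rightarrow> gen free_alg set" where
  "Wt_el_minus d m n = W_word d m n (g_inv d m n) (g_inv d m n)"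

definition ind_products ::
  "nat \<Rightarrow> enat \<Rightarrow> nat \<Rightarrow> (nat \<Rightarrow> nat \<Rightarrow> int \<Rightarrow> int \<Rightarrow> gen free_alg set)
    \<Rightarrow> gen free_alg set set" where
  "ind_products d m n w =
    {mprod (Yalg d m n) (map (\<lambda>k. w k (J k) (a k) (b k)) (rev [1..<n + 1])) |
      (J :: nat \<Rightarrow> nat) (a :: nat \<Rightarrow> int) (b :: nat \<Rightarrow> int).
      \<forall>k\<in>{1..n}. J k \<in> {0..k - 1} \<and> a k \<in> E_set m \<and> b k \<in> {0..int d - 1}}"

definition B_Ind :: "nat \<Rightarrow> enat \<Rightarrow> nat \<Rightarrow> gen free_alg set set" where
  "B_Ind d m n = ind_products d m n (W_el d m n)"

definition B_Ind_minus :: "nat \<Rightarrow> enat \<Rightarrow> nat \<Rightarrow> gen free_alg set set" where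
  "B_Ind_minus d m n = ind_products d m n (W_el_minus d m n)"

definition Bt_Ind :: "nat \<Rightarrow> enat \<Rightarrow> nat \<Rightarrow> gen free_alg set set" where
  "Bt_Ind d m n = ind_products d m n (Wt_el d m n)"

definition Bt_Ind_minus :: "nat \<Rightarrow> enat \<Rightarrow> nat \<Rightarrow> gen free_alg set set" where
  "Bt_Ind_minus d m n = ind_products d m n (Wt_el_minus d m n)"

end

theory Submission
  imports Defs
begin

text \<open>
  A span containing \<open>1\<close> and stable under left multiplication by the generators is the whole algebra.

  For the Ariki--Koike type set, the elements \<open>X\<^sub>i\<close> and \<open>X\<^sub>i\<^sub>+\<^sub>1\<close> commute, \<open>g\<^sub>i\<close> commutes with all the
  other \<open>X\<^sub>j\<close>, and the Bernstein relations move \<open>g\<^sub>i\<close> through a monomial \<open>X\<^sub>i\<^sup>k X\<^sub>i\<^sub>+\<^sub>1\<^sup>l\<close> at the cost of terms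
  \<open>X\<^sub>i\<^sup>k' X\<^sub>i\<^sub>+\<^sub>1\<^sup>l' e\<^sub>i\<close> whose exponents lie between \<open>k\<close> and \<open>l\<close>; hence exponents never leave the interval
  \<open>E\<^sub>m\<close>, except the one of \<open>X\<^sub>1\<close>, which the cyclotomic relation reduces.

  For the four inductive sets, let \<open>V\<close> be the span of the products \<open>W\<^sup>(\<^sup>k\<^sup>) s\<close> with \<open>s\<close> in the span obtained for
  \<open>k - 1\<close>. The braid relations give stability of \<open>V\<close> under the \<open>t\<^sub>j\<close> and \<open>g\<^sub>i\<close>, uniformly in the signs.
  Stability under \<open>X = X\<^sub>1\<close> rests on \<open>X g X\<^sup>a g\<^sup>-\<^sup>1 = g\<^sup>-\<^sup>1 X\<^sup>a g X\<close> for \<open>g = g\<^sub>1\<close>, which says that \<open>g X g\<close> commutes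
  with \<open>X\<^sup>a\<close>; changing \<open>g\<^sub>i\<close> into its inverse costs a multiple of \<open>e\<^sub>i\<close>, under which \<open>V\<close> is stable.
\<close>

section \<open>Invertible elements of a monoid\<close>

text \<open>The abstract setting sees the parameter \<open>m\<close> only through \<open>E\<close>,
  a convex set of integers that contains 0 and to which every power of \<open>x\<close> can be
  reduced. Finite and infinite \<open>m\<close> are thus treated at once, and the cyclotomic
  relation enters only through \<open>x_reduce\<close>.

  Each argument needs a place that absorbs what a generator leaves behind. In a product of a
  monomial in the X_i with \<open>w\<close>, that place is \<open>w\<close>: the span of
  \<open>B\<close> is stable under all t_j and g_i, hence under e_i. In a product \<open>W s\<close>
  it is \<open>s\<close> on the right, together with the whole span \<open>V\<close> on the left.
  The obstacle there is X_1 meeting g_1. The commutation of X_1 with X_2 carries it across g_1 X_1^a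
  g_1^-1 only if the signs match; a wrong sign produces an error with factor e_1. Since e_1 commutes
  with X_1 and g_1, it can be drawn to the front, where stability of \<open>V\<close> absorbs it.
  This dictates the order in which stability is established: the t_j, the g_i, and only afterwards
  X_1.\<close>

lemma (in monoid) Units_int_pow:
  fixes a :: int
  assumes x: "x \<in> Units G"
  shows "x [^] a \<in> Units G" "x [^] a \<otimes> x [^] b = x [^] (a + b)" "x [^] (1::int) = x"
    "x [^] (- 1 :: int) = inv x"
proof -
  \<comment> \<open>Integer powers obey the group laws in \<open>units_of G\<close>, whose products,
    inverses and powers agree with those of \<open>G\<close>.\<close>
  interpret U: group "units_of G" by (rule units_group)
  have nat: "x [^]\<^bsub>units_of G\<^esub> k = x [^] k" for k :: nat
    by (simp add: nat_pow_def units_of_def)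
  have xU: "x \<in> carrier (units_of G)" using x by (simp add: units_of_carrier)
  have natU: "x [^] k \<in> Units G" for k :: nat
    using U.nat_pow_closed[OF xU] by (simp add: nat units_of_carrier)
  have int: "x [^]\<^bsub>units_of G\<^esub> k = x [^] k" for k :: int
    unfolding int_pow_def2 using natU by (simp add: nat units_of_inv del: pow_nat)
  show "x [^] a \<in> Units G"
    using U.int_pow_closed[OF xU] by (simp add: int units_of_carrier)
  show "x [^] a \<otimes> x [^] b = x [^] (a + b)"
    using U.int_pow_mult[OF xU] by (simp add: int units_of_mult)
  show "x [^] (1::int) = x" "x [^] (- 1 :: int) = inv x"
    using x by (simp_all add: int_pow_def2 Units_closed)
qed

lemma (in monoid) Units_int_pow_Suc:
  fixes a :: int
  assumes x: "x \<in> Units G"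
  shows "x [^] (a + 1) = x \<otimes> x [^] a" "x [^] (a - 1) = inv x \<otimes> x [^] a"
  using Units_int_pow(2)[OF x, of 1 a] Units_int_pow(2)[OF x, of "- 1" a] Units_int_pow(3,4)[OF x]
  by (simp_all add: add.commute)

lemma (in monoid) commute_left:
  assumes "a \<otimes> b = b \<otimes> a" "a \<in> carrier G" "b \<in> carrier G" "z \<in> carrier G"
  shows "a \<otimes> (b \<otimes> z) = b \<otimes> (a \<otimes> z)"
  using assms by (simp add: m_assoc[symmetric])

lemma (in monoid) Units_cancel_left:
  assumes "x \<in> Units G" "z \<in> carrier G"
  shows "inv x \<otimes> (x \<otimes> z) = z" "x \<otimes> (inv x \<otimes> z) = z"
  using assms by (simp_all add: m_assoc[symmetric] Units_closed)

lemma (in monoid) commute_mult: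
  assumes "a \<otimes> b = b \<otimes> a" "a \<otimes> c = c \<otimes> a" "a \<in> carrier G" "b \<in> carrier G" "c \<in> carrier G"
  shows "a \<otimes> (b \<otimes> c) = (b \<otimes> c) \<otimes> a"
  using assms by (metis m_assoc)

lemma (in monoid) commute_inv:
  assumes "x \<in> Units G" "y \<in> carrier G" "y \<otimes> x = x \<otimes> y"
  shows "y \<otimes> inv x = inv x \<otimes> y"
proof -
  have "x \<otimes> (y \<otimes> inv x) = x \<otimes> (inv x \<otimes> y)"
    using assms by (metis Units_closed Units_inv_closed Units_r_inv l_one m_assoc r_one)
  then show ?thesis using assms by (subst (asm) Units_l_cancel) (auto simp: Units_closed)
qed

lemma (in monoid) commute_nat_pow:
  fixes k :: nat
  assumes "x \<in> carrier G" "y \<in> carrier G" "y \<otimes> x = x \<otimes> y"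
  shows "y \<otimes> x [^] k = x [^] k \<otimes> y"
  by (induction k) (use assms in \<open>auto simp: commute_mult\<close>)

lemma (in monoid) commute_int_pow:
  fixes a :: int
  assumes "x \<in> Units G" "y \<in> carrier G" "y \<otimes> x = x \<otimes> y"
  shows "y \<otimes> x [^] a = x [^] a \<otimes> y"
proof (induction a rule: int_induct[where k = 0])
  case base then show ?case using assms by simp
next
  case (step1 i) then show ?case
    using assms Units_int_pow(1)[of x i] by (simp add: Units_int_pow_Suc commute_mult Units_closed)
next
  case (step2 i) then show ?case
    using assms Units_int_pow(1)[of x i]
    by (simp add: Units_int_pow_Suc commute_mult commute_inv Units_closed)
qed

lemma mprod_simps [simp]:
  "mprod G [] = \<one>\<^bsub>G\<^esub>" "mprod G (x # xs) = x \<otimes>\<^bsub>G\<^esub> mprod G xs"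
  by (simp_all add: mprod_def)

lemma (in monoid) mprod_closed [simp, intro]:
  "set xs \<subseteq> carrier G \<Longrightarrow> mprod G xs \<in> carrier G"
  by (induction xs) auto

lemma (in monoid) mprod_append:
  "set xs \<subseteq> carrier G \<Longrightarrow> set ys \<subseteq> carrier G \<Longrightarrow> mprod G (xs @ ys) = mprod G xs \<otimes> mprod G ys"
  by (induction xs) (auto simp: m_assoc)

lemma (in monoid) commute_mprod:
  assumes "y \<in> carrier G" "\<And>x. x \<in> set xs \<Longrightarrow> x \<in> carrier G \<and> y \<otimes> x = x \<otimes> y"
  shows "y \<otimes> mprod G xs = mprod G xs \<otimes> y"
  using assms(2)
proof (induction xs)
  case (Cons x xs)
  then have "mprod G xs \<in> carrier G" by (intro mprod_closed) auto
  then show ?case using Cons assms(1) by (simp add: commute_mult)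
qed (use assms(1) in simp)

lemma (in monoid) inv_mult_Units:
  assumes "x \<in> Units G" "y \<in> Units G"
  shows "inv (x \<otimes> y) = inv y \<otimes> inv x"
proof -
  interpret U: group "units_of G" by (rule units_group)
  show ?thesis
    using U.inv_mult_group[of x y] assms
    by (simp add: units_of_carrier units_of_mult units_of_inv)
qed

text \<open>Converts a relation that lets \<open>u\<close> carry \<open>a\<close> into
  \<open>b\<close> to one for the inverse of \<open>u\<close>. With \<open>u\<close> a product of
  two generators it yields the braid relations with inverted factors.\<close>

lemma (in monoid) intertwine_inv:
  assumes "u \<in> Units G" "a \<in> carrier G" "b \<in> carrier G" "u \<otimes> a = b \<otimes> u"
  shows "a \<otimes> inv u = inv u \<otimes> b"
proof -
  have "u \<otimes> (a \<otimes> inv u) = u \<otimes> (inv u \<otimes> b)"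
    using assms by (simp add: m_assoc[symmetric] Units_closed) (simp add: m_assoc Units_closed)
  then show ?thesis using assms by (subst (asm) Units_l_cancel) (auto simp: Units_closed)
qed

lemma (in monoid) intertwine_nat_pow:
  fixes k :: nat
  assumes "u \<in> carrier G" "a \<in> carrier G" "b \<in> carrier G" "u \<otimes> a = b \<otimes> u"
  shows "u \<otimes> a [^] k = b [^] k \<otimes> u"
proof (induction k)
  case (Suc k)
  have "u \<otimes> a [^] Suc k = u \<otimes> a [^] k \<otimes> a" using assms by (simp add: m_assoc)
  also have "\<dots> = b [^] k \<otimes> (u \<otimes> a)" using Suc assms by (simp add: m_assoc)
  also have "\<dots> = b [^] Suc k \<otimes> u" using assms by (simp add: m_assoc)
  finally show ?case .
qed (use assms in simp)

section \<open>Linear spans in an associative algebra\<close>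

locale assoc_algebra = A?: ring A + R: cring R + module R A
  for A :: "('r, 'b, 'm) module_scheme" (structure) and R :: "('r, 'k) ring_scheme" (structure) +
  assumes smult_mult_left: "\<lbrakk>r \<in> carrier R; u \<in> carrier A; v \<in> carrier A\<rbrakk> \<Longrightarrow>
      (r \<odot> u) \<otimes> v = r \<odot> (u \<otimes> v)"
    and smult_mult_right: "\<lbrakk>r \<in> carrier R; u \<in> carrier A; v \<in> carrier A\<rbrakk> \<Longrightarrow>
      u \<otimes> (r \<odot> v) = r \<odot> (u \<otimes> v)"
begin

abbreviation sp :: "'b set \<Rightarrow> 'b set" where
  "sp S \<equiv> lin_span R A S"

lemma lin_span_closed: "S \<subseteq> carrier A \<Longrightarrow> sp S \<subseteq> carrier A"
  unfolding lin_span_def by (auto intro!: finsum_closed smult_closed)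

lemma lin_span_base:
  assumes "s \<in> S" "S \<subseteq> carrier A" shows "s \<in> sp S"
  unfolding lin_span_def
  by (rule CollectI, rule exI[of _ "{s}"], rule exI[of _ "\<lambda>_. \<one>\<^bsub>R\<^esub>"]) (use assms in auto)

text \<open>Padding with zero coefficients brings two combinations over different finite sets onto
  their union, where they can be added.\<close>

lemma finsum_smult_zero_outside:
  assumes "finite B" "A' \<subseteq> B" "B \<subseteq> carrier A" "c \<in> A' \<rightarrow> carrier R"
  shows "(\<Oplus>x\<in>B. (if x \<in> A' then c x else \<zero>\<^bsub>R\<^esub>) \<odot> x) = (\<Oplus>x\<in>A'. c x \<odot> x)"
proof -
  have "x \<in> carrier A" if "x \<in> B" for x using that assms by blast
  moreover have "c x \<in> carrier R" if "x \<in> A'" for x using that assms by blast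
  ultimately show ?thesis
    using assms(1,2) by (intro add.finprod_mono_neutral_cong_left[symmetric]) auto
qed

lemma lin_span_add:
  assumes S: "S \<subseteq> carrier A" and u: "u \<in> sp S" and v: "v \<in> sp S"
  shows "u \<oplus> v \<in> sp S"
proof -
  obtain C c where C: "u = (\<Oplus>x\<in>C. c x \<odot> x)" "finite C" "C \<subseteq> S" "c \<in> C \<rightarrow> carrier R"
    using u unfolding lin_span_def by blast
  obtain D b where D: "v = (\<Oplus>x\<in>D. b x \<odot> x)" "finite D" "D \<subseteq> S" "b \<in> D \<rightarrow> carrier R"
    using v unfolding lin_span_def by blast
  have x: "x \<in> carrier A" if "x \<in> C \<union> D" for x using that C(3) D(3) S by blast
  let ?c = "\<lambda>x. if x \<in> C then c x else \<zero>\<^bsub>R\<^esub>" and ?b = "\<lambda>x. if x \<in> D then b x else \<zero>\<^bsub>R\<^esub>"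
  have cl: "?c x \<in> carrier R" "?b x \<in> carrier R" for x using C(4) D(4) by auto
  have fin: "finite (C \<union> D)" using C D by simp
  have "u \<oplus> v = (\<Oplus>x\<in>C\<union>D. ?c x \<odot> x) \<oplus> (\<Oplus>x\<in>C\<union>D. ?b x \<odot> x)"
    using C D S by (subst (1 2) finsum_smult_zero_outside) auto
  also have "\<dots> = (\<Oplus>x\<in>C\<union>D. ?c x \<odot> x \<oplus> ?b x \<odot> x)"
    by (intro finsum_addf[symmetric] Pi_I smult_closed cl x)
  also have "\<dots> = (\<Oplus>x\<in>C\<union>D. (?c x \<oplus>\<^bsub>R\<^esub> ?b x) \<odot> x)"
    by (intro finsum_cong' Pi_I smult_closed R.a_closed cl x refl smult_l_distr[symmetric])
  finally show ?thesis
    unfolding lin_span_def using C(3) D(3) fin cl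
    by (intro CollectI exI[of _ "C \<union> D"] exI[of _ "\<lambda>x. ?c x \<oplus>\<^bsub>R\<^esub> ?b x"]
        conjI Pi_I R.a_closed) auto
qed

lemma lin_span_smult:
  assumes S: "S \<subseteq> carrier A" and u: "u \<in> sp S" and r: "r \<in> carrier R"
  shows "r \<odot> u \<in> sp S"
proof -
  obtain C c where C: "u = (\<Oplus>x\<in>C. c x \<odot> x)" "finite C" "C \<subseteq> S" "c \<in> C \<rightarrow> carrier R"
    using u unfolding lin_span_def by blast
  have x: "x \<in> carrier A" "c x \<in> carrier R" if "x \<in> C" for x using that C(3,4) S by blast+
  have "r \<odot> u = (\<Oplus>x\<in>C. r \<odot> (c x \<odot> x))"
    unfolding C(1) using C(2) r x by (intro finsum_smult_ldistr) auto
  also have "\<dots> = (\<Oplus>x\<in>C. (r \<otimes>\<^bsub>R\<^esub> c x) \<odot> x)"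
    using r x by (intro finsum_cong') (auto simp: smult_assoc1)
  finally show ?thesis
    unfolding lin_span_def using C r
    by (intro CollectI exI[of _ C] exI[of _ "\<lambda>x. r \<otimes>\<^bsub>R\<^esub> c x"]) auto
qed

definition submod :: "'b set \<Rightarrow> bool" where
  "submod V \<longleftrightarrow> submodule V R A"

lemma submodI:
  assumes "V \<subseteq> carrier A" "\<zero> \<in> V" "\<And>u v. u \<in> V \<Longrightarrow> v \<in> V \<Longrightarrow> u \<oplus> v \<in> V"
    "\<And>r v. r \<in> carrier R \<Longrightarrow> v \<in> V \<Longrightarrow> r \<odot> v \<in> V"
  shows "submod V"
  unfolding submod_def
proof (rule submoduleI)
  fix v assume v: "v \<in> V"
  have "(\<ominus>\<^bsub>R\<^esub> \<one>\<^bsub>R\<^esub>) \<odot> v \<in> V" using assms(4) v by simp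
  then show "\<ominus> v \<in> V" using assms(1) v smult_l_minus[of "\<one>\<^bsub>R\<^esub>" v] by auto
qed (use assms in auto)

lemma submodD:
  assumes "submod V"
  shows "v \<in> V \<Longrightarrow> v \<in> carrier A" "\<zero> \<in> V" "u \<in> V \<Longrightarrow> v \<in> V \<Longrightarrow> u \<oplus> v \<in> V"
    "u \<in> V \<Longrightarrow> v \<in> V \<Longrightarrow> u \<ominus> v \<in> V" "r \<in> carrier R \<Longrightarrow> v \<in> V \<Longrightarrow> r \<odot> v \<in> V" "v \<in> V \<Longrightarrow> \<ominus> v \<in> V"
proof -
  note s = assms[unfolded submod_def]
  show neg: "v \<in> V \<Longrightarrow> \<ominus> v \<in> V" for v using submoduleE(3)[OF s] by blast
  show add: "u \<in> V \<Longrightarrow> v \<in> V \<Longrightarrow> u \<oplus> v \<in> V" for u v using submoduleE(5)[OF s] by blast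
  show "u \<in> V \<Longrightarrow> v \<in> V \<Longrightarrow> u \<ominus> v \<in> V" unfolding a_minus_def using neg add by blast
  show sm: "r \<in> carrier R \<Longrightarrow> v \<in> V \<Longrightarrow> r \<odot> v \<in> V" for r v using submoduleE(4)[OF s] by blast
  show cl: "v \<in> V \<Longrightarrow> v \<in> carrier A" for v using submoduleE(1)[OF s] by blast
  obtain v where v: "v \<in> V" using submoduleE(2)[OF s] by blast
  show "\<zero> \<in> V" using sm[OF R.zero_closed v] cl[OF v] by simp
qed

lemma submod_finsum:
  assumes "submod V" "\<And>x. x \<in> I \<Longrightarrow> f x \<in> V"
  shows "finsum A f I \<in> V"
  using assms(2)
proof (induction I rule: infinite_finite_induct)
  case (insert x F)
  then have "f x \<in> carrier A" "f \<in> F \<rightarrow> carrier A" using submodD(1)[OF assms(1)] by auto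
  then show ?case using insert submodD(3)[OF assms(1)] by simp
qed (use submodD(2)[OF assms(1)] in \<open>auto simp: finsum_infinite\<close>)

lemma submod_lin_span: "S \<subseteq> carrier A \<Longrightarrow> submod (sp S)"
proof (rule submodI)
  assume "S \<subseteq> carrier A"
  show "\<zero> \<in> sp S"
    unfolding lin_span_def by (rule CollectI, rule exI[of _ "{}"]) auto
qed (use lin_span_closed lin_span_add lin_span_smult in auto)

lemma lin_span_minimal:
  assumes V: "submod V" and S: "S \<subseteq> V"
  shows "sp S \<subseteq> V"
proof
  fix u assume "u \<in> sp S"
  then obtain C c where C: "u = (\<Oplus>x\<in>C. c x \<odot> x)" "finite C" "C \<subseteq> S" "c \<in> C \<rightarrow> carrier R"
    unfolding lin_span_def by blast
  show "u \<in> V"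
    unfolding C(1) using C(3,4) S by (intro submod_finsum[OF V] submodD(5)[OF V]) blast+
qed

lemma lin_span_mono: "S \<subseteq> sp T \<Longrightarrow> T \<subseteq> carrier A \<Longrightarrow> sp S \<subseteq> sp T"
  by (intro lin_span_minimal submod_lin_span)

text \<open>Multiplication by fixed elements on both sides is linear. Hence membership of
  \<open>p v q\<close>, for \<open>v\<close> in a span, has to be checked on the spanning elements
  only.\<close>

lemma submod_mult_preimage:
  assumes V: "submod V" and p: "p \<in> carrier A" and q: "q \<in> carrier A"
  shows "submod {v \<in> carrier A. p \<otimes> v \<otimes> q \<in> V}"
  by (rule submodI)
    (use p q in \<open>auto simp: r_distr l_distr smult_mult_left smult_mult_right
      submodD(2)[OF V] intro: submodD(3,5)[OF V]\<close>)

lemma lin_span_mult: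
  assumes V: "submod V" and p: "p \<in> carrier A" and q: "q \<in> carrier A" and S: "S \<subseteq> carrier A"
    and "\<And>s. s \<in> S \<Longrightarrow> p \<otimes> s \<otimes> q \<in> V" and v: "v \<in> sp S"
  shows "p \<otimes> v \<otimes> q \<in> V"
  using lin_span_minimal[OF submod_mult_preimage[OF V p q], of S] assms by auto

lemma lin_span_mult_left:
  assumes V: "submod V" and p: "p \<in> carrier A" and S: "S \<subseteq> carrier A"
    and pS: "\<And>s. s \<in> S \<Longrightarrow> p \<otimes> s \<in> V" and v: "v \<in> sp S"
  shows "p \<otimes> v \<in> V"
proof -
  have "p \<otimes> s \<otimes> \<one> \<in> V" if "s \<in> S" for s
    using pS[OF that] S that p by (subst r_one) auto
  then have "p \<otimes> v \<otimes> \<one> \<in> V" using v by (rule lin_span_mult[OF V p one_closed S])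
  then show ?thesis using lin_span_closed[OF S] v p by (subst (asm) r_one) auto
qed

lemma lin_span_mult_right:
  assumes V: "submod V" and p: "p \<in> carrier A" and S: "S \<subseteq> carrier A"
    and pS: "\<And>s. s \<in> S \<Longrightarrow> s \<otimes> p \<in> V" and v: "v \<in> sp S"
  shows "v \<otimes> p \<in> V"
proof -
  have "\<one> \<otimes> s \<otimes> p \<in> V" if "s \<in> S" for s
    using pS[OF that] S that by (subst l_one) auto
  then have "\<one> \<otimes> v \<otimes> p \<in> V" using v by (rule lin_span_mult[OF V one_closed p S])
  then show ?thesis using lin_span_closed[OF S] v by (subst (asm) l_one) auto
qed

text \<open>For a submodule \<open>V\<close> this is a unital subalgebra, so stability under
  generators passes to polynomial expressions in them, such as the elements \<open>c i\<close>
  below.\<close>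

definition stab :: "'b set \<Rightarrow> 'b set" where
  "stab V = {y \<in> carrier A. \<forall>v\<in>V. y \<otimes> v \<in> V}"

lemma stabD: "y \<in> stab V \<Longrightarrow> v \<in> V \<Longrightarrow> y \<otimes> v \<in> V"
  by (simp add: stab_def)

lemma stab_closed: "y \<in> stab V \<Longrightarrow> y \<in> carrier A"
  by (simp add: stab_def)

lemma submod_stab:
  assumes V: "submod V" shows "submod (stab V)"
  by (rule submodI)
    (auto simp: stab_def l_distr smult_mult_left submodD(2)[OF V] submodD(1)[OF V]
      intro: submodD(3,5)[OF V])

lemma stab_one: "submod V \<Longrightarrow> \<one> \<in> stab V"
  by (auto simp: stab_def submodD(1))

lemma stab_mult: "submod V \<Longrightarrow> y \<in> stab V \<Longrightarrow> z \<in> stab V \<Longrightarrow> y \<otimes> z \<in> stab V"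
  by (auto simp: stab_def m_assoc submodD(1))

lemma stab_nat_pow: "submod V \<Longrightarrow> y \<in> stab V \<Longrightarrow> y [^] (k::nat) \<in> stab V"
  by (induction k) (auto intro: stab_mult stab_one)

lemma stab_int_pow:
  fixes a :: int
  assumes V: "submod V" and y: "y \<in> Units A" "y \<in> stab V" "inv y \<in> stab V"
  shows "y [^] a \<in> stab V"
proof (induction a rule: int_induct[where k = 0])
  case (step1 i) then show ?case using y V by (simp add: Units_int_pow_Suc stab_mult)
next
  case (step2 i) then show ?case using y V by (simp add: Units_int_pow_Suc stab_mult)
qed (use stab_one[OF V] in simp)

lemma stab_lin_spanI:
  assumes "S \<subseteq> carrier A" "y \<in> carrier A" "\<And>s. s \<in> S \<Longrightarrow> y \<otimes> s \<in> sp S"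
  shows "y \<in> stab (sp S)"
  using lin_span_mult_left[OF submod_lin_span[OF assms(1)] assms(2,1,3)] assms(2)
  by (auto simp: stab_def)

end

section \<open>The relations in an abstract algebra\<close>

text \<open>The generators \<open>t\<^sub>j\<close>, \<open>g\<^sub>i\<close> are set to \<open>1\<close> for indices out of range, so that closure and invertibility
  hold for all indices. The scalar \<open>z\<close> stands for \<open>(q - q\<^sup>-\<^sup>1) / d\<close>, and \<open>E\<close> for \<open>E\<^sub>m\<close>.\<close>

locale affine_yokonuma = assoc_algebra A R
  for A :: "('r, 'b, 'm) module_scheme" (structure) and R :: "('r, 'k) ring_scheme" (structure) +
  fixes d n :: nat and t g :: "nat \<Rightarrow> 'b" and x :: 'b and z :: 'r and E :: "int set"
  assumes d_pos: "0 < d" and n_pos: "0 < n"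
    and t_closed [simp, intro]: "t j \<in> carrier A"
    and g_closed [simp, intro]: "g i \<in> carrier A"
    and x_Units [simp, intro]: "x \<in> Units A"
    and z_closed [simp, intro]: "z \<in> carrier R"
    and t_outside: "j \<notin> {1..n} \<Longrightarrow> t j = \<one>"
    and g_outside: "i \<notin> {1..<n} \<Longrightarrow> g i = \<one>"
    and g_far: "Suc i < j \<Longrightarrow> g i \<otimes> g j = g j \<otimes> g i"
    and g_braid: "1 \<le> i \<Longrightarrow> Suc i < n \<Longrightarrow> g i \<otimes> g (Suc i) \<otimes> g i = g (Suc i) \<otimes> g i \<otimes> g (Suc i)"
    and t_commute: "t i \<otimes> t j = t j \<otimes> t i"
    and t_g: "i \<in> {1..<n} \<Longrightarrow> t j \<otimes> g i = g i \<otimes> t (Transposition.transpose i (Suc i) j)"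
    and t_order: "t j [^] d = \<one>"
    and g_quadratic: "i \<in> {1..<n} \<Longrightarrow> g i \<otimes> g i =
      \<one> \<oplus> (z \<odot> (\<Oplus>s\<in>{0..<d}. t i [^] s \<otimes> t (Suc i) [^] (d - s))) \<otimes> g i"
    and x_g1: "1 < n \<Longrightarrow> x \<otimes> g 1 \<otimes> x \<otimes> g 1 = g 1 \<otimes> x \<otimes> g 1 \<otimes> x"
    and x_g: "2 \<le> i \<Longrightarrow> x \<otimes> g i = g i \<otimes> x"
    and x_t: "x \<otimes> t j = t j \<otimes> x"
    and E_zero: "0 \<in> E"
    and E_convex: "a \<in> E \<Longrightarrow> b \<in> E \<Longrightarrow> a \<le> k \<Longrightarrow> k \<le> b \<Longrightarrow> k \<in> E"
    and x_reduce: "x [^] (a :: int) \<in> lin_span R A ((\<lambda>e. x [^] e) ` E)"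
    and generated: "\<lbrakk>submod V; \<one> \<in> V; \<And>j. t j \<in> stab V; \<And>i. g i \<in> stab V;
      x \<in> stab V; inv x \<in> stab V\<rbrakk> \<Longrightarrow> carrier A \<subseteq> V"
begin

text \<open>\<open>c i\<close> is \<open>(q - q\<^sup>-\<^sup>1) e\<^sub>i\<close>.\<close>

definition c :: "nat \<Rightarrow> 'b" where
  "c i = z \<odot> (\<Oplus>s\<in>{0..<d}. t i [^] s \<otimes> t (Suc i) [^] (d - s))"

lemma x_closed [simp, intro]: "x \<in> carrier A" by (rule Units_closed) simp

lemma x_pow_Units [simp, intro]: "x [^] (a::int) \<in> Units A" by (simp add: Units_int_pow)

lemma x_pow_closed [simp, intro]: "x [^] (a::int) \<in> carrier A" by (rule Units_closed) simp

lemma c_closed [simp, intro]: "c i \<in> carrier A"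
  unfolding c_def by (intro smult_closed finsum_closed) auto

lemma t_Units [simp, intro]: "t j \<in> Units A"
proof -
  have "t j \<otimes> t j [^] (d - 1) = \<one>" "t j [^] (d - 1) \<otimes> t j = \<one>"
    using nat_pow_Suc2[of "t j" "d - 1"] nat_pow_Suc[of "t j" "d - 1"] t_order[of j] d_pos by simp_all
  then show ?thesis unfolding Units_def using t_closed nat_pow_closed by blast
qed

lemma commute_c:
  assumes y: "y \<in> carrier A" and "y \<otimes> t i = t i \<otimes> y" "y \<otimes> t (Suc i) = t (Suc i) \<otimes> y"
  shows "y \<otimes> c i = c i \<otimes> y"
proof -
  have "y \<otimes> (\<Oplus>s\<in>{0..<d}. t i [^] s \<otimes> t (Suc i) [^] (d - s)) =
      (\<Oplus>s\<in>{0..<d}. y \<otimes> (t i [^] s \<otimes> t (Suc i) [^] (d - s)))"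
    using y by (intro finsum_rdistr) auto
  also have "\<dots> = (\<Oplus>s\<in>{0..<d}. t i [^] s \<otimes> t (Suc i) [^] (d - s) \<otimes> y)"
    using assms by (intro finsum_cong' commute_mult commute_nat_pow) auto
  also have "\<dots> = (\<Oplus>s\<in>{0..<d}. t i [^] s \<otimes> t (Suc i) [^] (d - s)) \<otimes> y"
    using y by (intro finsum_ldistr[symmetric]) auto
  finally show ?thesis
    unfolding c_def using y by (simp add: smult_mult_left smult_mult_right finsum_closed)
qed

text \<open>Passing \<open>g\<^sub>i\<close> through the sum exchanges \<open>t\<^sub>i\<close> and \<open>t\<^sub>i\<^sub>+\<^sub>1\<close>; the sum is then reindexed by \<open>s \<mapsto> d - s\<close>,
  the term \<open>s = 0\<close> being fixed because \<open>t\<^sup>d = 1\<close>.\<close>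

lemma g_c_same:
  assumes i: "i \<in> {1..<n}"
  shows "g i \<otimes> c i = c i \<otimes> g i"
proof -
  let ?f = "\<lambda>s. t i [^] s \<otimes> t (Suc i) [^] (d - s)"
  have gt: "g i \<otimes> t i = t (Suc i) \<otimes> g i" "g i \<otimes> t (Suc i) = t i \<otimes> g i"
    using t_g[OF i, of "Suc i"] t_g[OF i, of i] by simp_all
  have pc: "t i [^] k \<otimes> t j [^] l = t j [^] l \<otimes> t i [^] k" for i j k l :: nat
    by (intro commute_nat_pow commute_nat_pow[symmetric]) (auto simp: t_commute)
  have gf: "g i \<otimes> ?f s = t i [^] (d - s) \<otimes> t (Suc i) [^] s \<otimes> g i" for s
  proof -
    have "g i \<otimes> ?f s = (g i \<otimes> t i [^] s) \<otimes> t (Suc i) [^] (d - s)" by (simp add: m_assoc)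
    also have "\<dots> = t (Suc i) [^] s \<otimes> (g i \<otimes> t (Suc i) [^] (d - s))"
      using intertwine_nat_pow[OF _ _ _ gt(1)] by (simp add: m_assoc)
    also have "\<dots> = t (Suc i) [^] s \<otimes> t i [^] (d - s) \<otimes> g i"
      using intertwine_nat_pow[OF _ _ _ gt(2)] by (simp add: m_assoc)
    finally show ?thesis by (simp add: pc)
  qed
  let ?h = "\<lambda>s. if s = 0 then 0 else d - s"
  have h: "inj_on ?h {0..<d}" "?h ` {0..<d} = {0..<d}"
  proof -
    show inj: "inj_on ?h {0..<d}" by (auto simp: inj_on_def)
    show "?h ` {0..<d} = {0..<d}"
      by (rule endo_inj_surj[OF _ _ inj]) auto
  qed
  have "g i \<otimes> (\<Oplus>s\<in>{0..<d}. ?f s) = (\<Oplus>s\<in>{0..<d}. g i \<otimes> ?f s)"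
    by (intro finsum_rdistr) auto
  also have "\<dots> = (\<Oplus>s\<in>{0..<d}. (t i [^] (d - s) \<otimes> t (Suc i) [^] s) \<otimes> g i)"
    by (simp only: gf)
  also have "\<dots> = (\<Oplus>s\<in>{0..<d}. t i [^] (d - s) \<otimes> t (Suc i) [^] s) \<otimes> g i"
    by (intro finsum_ldistr[symmetric]) auto
  also have "(\<Oplus>s\<in>{0..<d}. t i [^] (d - s) \<otimes> t (Suc i) [^] s) = (\<Oplus>s\<in>{0..<d}. ?f (?h s))"
    by (intro finsum_cong') (auto simp: t_order)
  also have "\<dots> = (\<Oplus>s\<in>?h ` {0..<d}. ?f s)"
    by (rule finsum_reindex[symmetric]) (use h in auto)
  finally show ?thesis
    unfolding c_def h(2) by (simp add: smult_mult_left smult_mult_right finsum_closed)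
qed

section \<open>The quadratic relation, inverses and signs\<close>

lemma g_square: "i \<in> {1..<n} \<Longrightarrow> g i \<otimes> g i = \<one> \<oplus> c i \<otimes> g i"
  using g_quadratic by (simp add: c_def)

lemma c_stab:
  assumes V: "submod V" and "t i \<in> stab V" "t (Suc i) \<in> stab V"
  shows "c i \<in> stab V"
  unfolding c_def using assms
  by (intro submodD(5)[OF submod_stab[OF V]] submod_finsum[OF submod_stab[OF V]]
      stab_mult stab_nat_pow) auto

text \<open>This is \<open>g_square\<close> solved for the unit; the inverse is two-sided because
  \<open>c i\<close> commutes with \<open>g i\<close>.\<close>

lemma g_Units_aux:
  assumes i: "i \<in> {1..<n}"
  shows "g i \<otimes> (g i \<ominus> c i) = \<one>" "(g i \<ominus> c i) \<otimes> g i = \<one>"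
proof -
  show "(g i \<ominus> c i) \<otimes> g i = \<one>"
    using g_square[OF i] by (simp add: a_minus_def l_distr l_minus a_assoc r_neg)
  have "g i \<otimes> (g i \<ominus> c i) = g i \<otimes> g i \<oplus> \<ominus> (c i \<otimes> g i)"
    using g_c_same[OF i] by (simp add: a_minus_def r_distr r_minus)
  then show "g i \<otimes> (g i \<ominus> c i) = \<one>"
    using g_square[OF i] by (simp add: a_assoc r_neg)
qed

lemma g_Units [simp, intro]: "g i \<in> Units A"
proof (cases "i \<in> {1..<n}")
  case True
  then show ?thesis
    unfolding Units_def using g_Units_aux[OF True] g_closed minus_closed[OF g_closed c_closed] by blast
qed (simp add: g_outside)

lemma inv_g: "i \<in> {1..<n} \<Longrightarrow> inv (g i) = g i \<ominus> c i"
  by (rule inv_unique[OF Units_l_inv g_Units_aux(1)]) auto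

text \<open>\<open>True\<close> stands for the generator and \<open>False\<close> for its inverse.
  Negating the argument inverts the element, so one proof serves all choices of signs.\<close>

definition gs :: "bool \<Rightarrow> nat \<Rightarrow> 'b" where
  "gs e i = (if e then g i else inv (g i))"

lemma gs_Units [simp, intro]: "gs e i \<in> Units A" by (simp add: gs_def)

lemma gs_closed [simp, intro]: "gs e i \<in> carrier A" by (rule Units_closed) simp

lemma inv_gs [simp]: "inv (gs e i) = gs (\<not> e) i" by (simp add: gs_def)

lemma gs_cancel [simp]:
  "gs e i \<otimes> gs (\<not> e) i = \<one>" "gs (\<not> e) i \<otimes> gs e i = \<one>"
  "v \<in> carrier A \<Longrightarrow> gs e i \<otimes> (gs (\<not> e) i \<otimes> v) = v"
  "v \<in> carrier A \<Longrightarrow> gs (\<not> e) i \<otimes> (gs e i \<otimes> v) = v"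
  using Units_cancel_left[of "gs e i" v] Units_l_inv[of "gs e i"] Units_r_inv[of "gs e i"] by simp_all

lemma commute_gs: "y \<in> carrier A \<Longrightarrow> y \<otimes> g i = g i \<otimes> y \<Longrightarrow> y \<otimes> gs e i = gs e i \<otimes> y"
  by (simp add: gs_def commute_inv)

lemma g_far': "Suc i < j \<or> Suc j < i \<Longrightarrow> g i \<otimes> g j = g j \<otimes> g i"
  using g_far[of i j] g_far[of j i] by auto

lemma x_gs: "2 \<le> i \<Longrightarrow> x \<otimes> gs e i = gs e i \<otimes> x"
  by (intro commute_gs x_g) auto

lemma t_gs:
  assumes i: "i \<in> {1..<n}"
  shows "t j \<otimes> gs e i = gs e i \<otimes> t (Transposition.transpose i (Suc i) j)"
proof (cases e)
  case False
  \<comment> \<open>The relation \<open>t_g\<close> is taken at the transposed index, the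
    transposition being an involution.\<close>
  have "t j \<otimes> inv (g i) = inv (g i) \<otimes> t (Transposition.transpose i (Suc i) j)"
    using t_g[OF i, of "Transposition.transpose i (Suc i) j"] by (intro intertwine_inv) auto
  then show ?thesis using False by (simp add: gs_def)
qed (use t_g[OF i] in \<open>simp add: gs_def\<close>)

text \<open>The braid relation says that \<open>g i\<close> times \<open>g (Suc i)\<close>
  intertwines \<open>g i\<close> with \<open>g (Suc i)\<close>; \<open>intertwine_inv\<close> gives
  the version with both factors inverted. Equal signs suffice, since the factors of a word
  \<open>Lw\<close> or \<open>Rw\<close> share their sign.\<close>

lemma braid_gs:
  assumes "1 \<le> i" "Suc i < n"
  shows "g i \<otimes> (gs e (Suc i) \<otimes> gs e i) = gs e (Suc i) \<otimes> gs e i \<otimes> g (Suc i)"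
    "g (Suc i) \<otimes> (gs e i \<otimes> gs e (Suc i)) = gs e i \<otimes> gs e (Suc i) \<otimes> g i"
proof -
  note b = g_braid[OF assms]
  have "g i \<otimes> (inv (g (Suc i)) \<otimes> inv (g i)) = inv (g (Suc i)) \<otimes> inv (g i) \<otimes> g (Suc i)"
    using b intertwine_inv[of "g i \<otimes> g (Suc i)" "g i" "g (Suc i)"]
    by (simp add: inv_mult_Units m_assoc)
  then show "g i \<otimes> (gs e (Suc i) \<otimes> gs e i) = gs e (Suc i) \<otimes> gs e i \<otimes> g (Suc i)"
    using b by (simp add: gs_def m_assoc)
  have "g (Suc i) \<otimes> (inv (g i) \<otimes> inv (g (Suc i))) = inv (g i) \<otimes> inv (g (Suc i)) \<otimes> g i"
    using b intertwine_inv[of "g (Suc i) \<otimes> g i" "g (Suc i)" "g i"]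
    by (simp add: inv_mult_Units m_assoc)
  then show "g (Suc i) \<otimes> (gs e i \<otimes> gs e (Suc i)) = gs e i \<otimes> gs e (Suc i) \<otimes> g i"
    using b by (simp add: gs_def m_assoc)
qed

text \<open>The possible differences between two of the elements \<open>g\<^sub>i\<close>, \<open>g\<^sub>i\<^sup>-\<^sup>1\<close>.\<close>

definition cs :: "nat \<Rightarrow> 'b set" where
  "cs i = {\<zero>, c i, \<ominus> c i}"

text \<open>The zero element of \<open>cs i\<close> covers equal signs, so that later computations
  do not have to split on the signs.\<close>

lemma gs_change_sign:
  assumes i: "i \<in> {1..<n}"
  obtains \<delta> where "\<delta> \<in> cs i" "gs e i = gs e' i \<oplus> \<delta>"
proof (cases "e = e'")
  case True then show ?thesis using that[of \<zero>] by (simp add: cs_def)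
next
  case False
  have "g i = (g i \<ominus> c i) \<oplus> c i" by (simp add: a_minus_def a_assoc l_neg)
  then show ?thesis
    using False that[of "if e then c i else \<ominus> c i"] inv_g[OF i]
    by (cases e; cases e') (auto simp: cs_def gs_def a_minus_def)
qed

lemma cs_closed: "\<delta> \<in> cs i \<Longrightarrow> \<delta> \<in> carrier A"
  by (auto simp: cs_def)

lemma cs_stab:
  assumes V: "submod V" and "t i \<in> stab V" "t (Suc i) \<in> stab V" and "\<delta> \<in> cs i"
  shows "\<delta> \<in> stab V"
  using assms c_stab[OF assms(1,2,3)] submodD(2,6)[OF submod_stab[OF V]] by (auto simp: cs_def)

lemma commute_cs:
  assumes "y \<in> carrier A" "y \<otimes> c i = c i \<otimes> y" "\<delta> \<in> cs i"
  shows "y \<otimes> \<delta> = \<delta> \<otimes> y"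
  using assms by (auto simp: cs_def r_minus l_minus)

section \<open>The elements \<open>X\<^sub>i\<close> and the Ariki--Koike type set\<close>

text \<open>The index 0 is a placeholder, as in \<open>X_el\<close>. Beyond \<open>n\<close> the
  sequence is constant, because \<open>g\<close> is the unit there; this spares side
  conditions.\<close>

fun JM :: "nat \<Rightarrow> 'b" where
  "JM 0 = \<one>"
| "JM (Suc 0) = x"
| "JM (Suc (Suc i)) = g (Suc i) \<otimes> JM (Suc i) \<otimes> g (Suc i)"

lemma JM_Suc: "1 \<le> i \<Longrightarrow> JM (Suc i) = g i \<otimes> JM i \<otimes> g i"
  by (cases i) auto

lemma JM_Units [simp, intro]: "JM i \<in> Units A"
  by (induction i rule: JM.induct) auto

lemma JM_closed [simp, intro]: "JM i \<in> carrier A" by (rule Units_closed) simp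

lemma JM_pow_Units [simp, intro]: "JM i [^] (a::int) \<in> Units A" by (simp add: Units_int_pow)

lemma JM_pow_closed [simp, intro]: "JM i [^] (a::int) \<in> carrier A" by (rule Units_closed) simp

lemma g_JM_above: "i < j \<Longrightarrow> g j \<otimes> JM i = JM i \<otimes> g j"
proof (induction i rule: JM.induct)
  case 2 then show ?case using x_g[of j] by simp
next
  case (3 i)
  then have "g j \<otimes> g (Suc i) = g (Suc i) \<otimes> g j" by (intro g_far') auto
  then show ?case using 3 by (simp add: commute_mult)
qed simp

text \<open>The two outer factors \<open>g\<close> transpose the index twice and so restore it.
  Between them the transposed index occurs, which is why the induction is over all
  \<open>j\<close>.\<close>

lemma t_JM: "t j \<otimes> JM i = JM i \<otimes> t j"
proof (induction i arbitrary: j rule: JM.induct)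
  case (3 i)
  show ?case
  proof (cases "Suc i \<in> {1..<n}")
    case True
    let ?j = "Transposition.transpose (Suc i) (Suc (Suc i)) j"
    have "t j \<otimes> JM (Suc (Suc i)) = (t j \<otimes> g (Suc i)) \<otimes> JM (Suc i) \<otimes> g (Suc i)"
      by (simp add: m_assoc)
    also have "\<dots> = g (Suc i) \<otimes> (t ?j \<otimes> JM (Suc i)) \<otimes> g (Suc i)"
      using t_g[OF True] by (simp add: m_assoc)
    also have "\<dots> = g (Suc i) \<otimes> JM (Suc i) \<otimes> (t ?j \<otimes> g (Suc i))"
      using 3[of ?j] by (simp add: m_assoc)
    also have "\<dots> = JM (Suc (Suc i)) \<otimes> t j"
      using t_g[OF True, of ?j] by (simp add: m_assoc)
    finally show ?thesis .
  next
    case False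
    then show ?thesis using 3 by (simp add: g_outside)
  qed
qed (use x_t in auto)

text \<open>The base case is the defining relation between \<open>x\<close> and \<open>g 1\<close>.
  In the step the consecutive elements are \<open>a\<close>, \<open>g a g\<close> and
  \<open>h g a g h\<close>; since \<open>a\<close> commutes with \<open>h\<close>, braid moves
  reduce the commutation of the last two to that of the first two, which is
  \<open>ag\<close>.\<close>

lemma JM_commute_Suc: "1 \<le> i \<Longrightarrow> i < n \<Longrightarrow> JM i \<otimes> JM (Suc i) = JM (Suc i) \<otimes> JM i"
proof (induction i rule: nat_induct_at_least)
  case base
  then show ?case using x_g1 by (simp add: JM_Suc[of 1, simplified] m_assoc)
next
  case (Suc i)
  let ?a = "JM i" and ?g = "g i" and ?h = "g (Suc i)"
  have ha: "?a \<otimes> ?h = ?h \<otimes> ?a" using g_JM_above[of i "Suc i"] by simp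
  have b: "?g \<otimes> ?h \<otimes> ?g = ?h \<otimes> ?g \<otimes> ?h" using Suc by (intro g_braid) auto
  have ag: "?a \<otimes> (?g \<otimes> ?a \<otimes> ?g) = (?g \<otimes> ?a \<otimes> ?g) \<otimes> ?a" using Suc by (simp add: JM_Suc)
  have "(?g \<otimes> ?a \<otimes> ?g) \<otimes> (?h \<otimes> (?g \<otimes> ?a \<otimes> ?g) \<otimes> ?h) = ?g \<otimes> ?a \<otimes> (?g \<otimes> ?h \<otimes> ?g) \<otimes> ?a \<otimes> ?g \<otimes> ?h"
    by (simp add: m_assoc)
  also have "\<dots> = ?g \<otimes> (?a \<otimes> ?h) \<otimes> ?g \<otimes> (?h \<otimes> ?a) \<otimes> ?g \<otimes> ?h"
    unfolding b by (simp add: m_assoc)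
  also have "\<dots> = ?g \<otimes> (?h \<otimes> ?a) \<otimes> ?g \<otimes> (?a \<otimes> ?h) \<otimes> ?g \<otimes> ?h"
    by (simp only: ha)
  also have "\<dots> = ?g \<otimes> ?h \<otimes> ?a \<otimes> ?g \<otimes> ?a \<otimes> (?h \<otimes> ?g \<otimes> ?h)"
    by (simp add: m_assoc)
  also have "\<dots> = ?g \<otimes> ?h \<otimes> (?a \<otimes> (?g \<otimes> ?a \<otimes> ?g)) \<otimes> ?h \<otimes> ?g"
    unfolding b[symmetric] by (simp add: m_assoc)
  also have "\<dots> = (?g \<otimes> ?h \<otimes> ?g) \<otimes> ?a \<otimes> ?g \<otimes> (?a \<otimes> ?h) \<otimes> ?g"
    unfolding ag by (simp add: m_assoc)
  also have "\<dots> = ?h \<otimes> ?g \<otimes> (?h \<otimes> ?a) \<otimes> ?g \<otimes> ?h \<otimes> ?a \<otimes> ?g"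
    unfolding b ha by (simp add: m_assoc)
  also have "\<dots> = ?h \<otimes> ?g \<otimes> ?a \<otimes> (?h \<otimes> ?g \<otimes> ?h) \<otimes> ?a \<otimes> ?g"
    unfolding ha[symmetric] by (simp add: m_assoc)
  also have "\<dots> = (?h \<otimes> (?g \<otimes> ?a \<otimes> ?g) \<otimes> ?h) \<otimes> (?g \<otimes> ?a \<otimes> ?g)"
    unfolding b[symmetric] by (simp add: m_assoc)
  finally show ?case using Suc by (simp add: JM_Suc)
qed

text \<open>For \<open>i = j + 2\<close> the element is \<open>h g a g h\<close>: the braid relation
  turns \<open>g\<close> into \<open>h\<close> across the left pair, \<open>h\<close> passes
  \<open>a\<close>, and the right pair turns it back into \<open>g\<close>. For larger
  \<open>i\<close> the new outer factors are far from \<open>g j\<close>.\<close>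

lemma g_JM_below:
  assumes "1 \<le> j" "Suc j < i" "i \<le> n"
  shows "g j \<otimes> JM i = JM i \<otimes> g j"
proof -
  have "Suc (Suc j) \<le> i" using assms by simp
  then show ?thesis using \<open>i \<le> n\<close>
  proof (induction i rule: nat_induct_at_least)
    case base
    let ?g = "g j" and ?h = "g (Suc j)" and ?a = "JM j"
    have b: "?g \<otimes> ?h \<otimes> ?g = ?h \<otimes> ?g \<otimes> ?h" using assms base by (intro g_braid) auto
    have ha: "?h \<otimes> ?a = ?a \<otimes> ?h" using g_JM_above[of j "Suc j"] by simp
    have X2: "JM (Suc (Suc j)) = ?h \<otimes> (?g \<otimes> ?a \<otimes> ?g) \<otimes> ?h"
      using assms by (simp add: JM_Suc)
    have "?g \<otimes> JM (Suc (Suc j)) = (?g \<otimes> ?h \<otimes> ?g) \<otimes> ?a \<otimes> ?g \<otimes> ?h"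
      unfolding X2 by (simp add: m_assoc)
    also have "\<dots> = ?h \<otimes> ?g \<otimes> (?h \<otimes> ?a) \<otimes> ?g \<otimes> ?h" unfolding b by (simp add: m_assoc)
    also have "\<dots> = ?h \<otimes> ?g \<otimes> ?a \<otimes> (?h \<otimes> ?g \<otimes> ?h)" unfolding ha by (simp add: m_assoc)
    also have "\<dots> = JM (Suc (Suc j)) \<otimes> ?g" unfolding X2 b[symmetric] by (simp add: m_assoc)
    finally show ?case .
  next
    case (Suc i)
    have "g j \<otimes> g i = g i \<otimes> g j" using Suc by (intro g_far') auto
    then show ?case using Suc assms(1) by (simp add: JM_Suc commute_mult)
  qed
qed

section \<open>Passing \<open>g i\<close> through powers of \<open>JM i\<close> and
  \<open>JM (Suc i)\<close>\<close>

lemma c_JM: "c j \<otimes> JM i = JM i \<otimes> c j"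
  by (rule commute_c[symmetric]) (auto simp: t_JM)

lemma c_JM_pow: "c j \<otimes> JM i [^] (a::int) = JM i [^] a \<otimes> c j"
  by (intro commute_int_pow c_JM) auto

text \<open>The Bernstein relations in degree one. The first expands the inverse in
  \<open>g i * JM i = JM (Suc i) * inv (g i)\<close>; the second applies the quadratic relation to
  the square of \<open>g i\<close> at the front of \<open>g i * JM (Suc i)\<close>.\<close>

lemma g_JM:
  assumes i: "i \<in> {1..<n}"
  shows "g i \<otimes> JM i = JM (Suc i) \<otimes> g i \<ominus> JM (Suc i) \<otimes> c i"
    "g i \<otimes> JM (Suc i) = JM i \<otimes> g i \<oplus> JM (Suc i) \<otimes> c i"
proof -
  have JM: "JM (Suc i) = g i \<otimes> JM i \<otimes> g i" using i by (simp add: JM_Suc)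
  have "g i \<otimes> JM i = JM (Suc i) \<otimes> inv (g i)"
    unfolding JM by (simp add: m_assoc)
  then show "g i \<otimes> JM i = JM (Suc i) \<otimes> g i \<ominus> JM (Suc i) \<otimes> c i"
    using inv_g[OF i] by (simp add: a_minus_def r_distr r_minus)
  have "g i \<otimes> JM (Suc i) = (g i \<otimes> g i) \<otimes> JM i \<otimes> g i"
    unfolding JM by (simp add: m_assoc)
  also have "\<dots> = JM i \<otimes> g i \<oplus> c i \<otimes> JM (Suc i)"
    unfolding g_square[OF i] JM by (simp add: m_assoc l_distr)
  finally show "g i \<otimes> JM (Suc i) = JM i \<otimes> g i \<oplus> JM (Suc i) \<otimes> c i"
    by (simp add: c_JM)
qed

text \<open>The error terms of the Bernstein relations. The bounds record the interval that neither
  exponent leaves; \<open>c i\<close> stands last so that it can be handed on to the factors to the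
  right.\<close>

definition box :: "nat \<Rightarrow> int \<Rightarrow> int \<Rightarrow> 'b set" where
  "box i p q = {JM i [^] k \<otimes> JM (Suc i) [^] l \<otimes> c i | k l. k \<in> {p..q} \<and> l \<in> {p..q}}"

lemma box_closed: "box i p q \<subseteq> carrier A"
  by (auto simp: box_def)

lemma JM_pow_commute_Suc:
  assumes "i \<in> {1..<n}"
  shows "JM i [^] (k::int) \<otimes> JM (Suc i) [^] (l::int) = JM (Suc i) [^] l \<otimes> JM i [^] k"
  using JM_commute_Suc[of i] assms by (intro commute_int_pow commute_int_pow[symmetric]) auto

text \<open>Right multiplication by a monomial only translates the exponents, because
  \<open>c i\<close> and the two elements \<open>JM\<close> commute with one another.\<close>

lemma box_shift:
  assumes i: "i \<in> {1..<n}" and u: "u \<in> sp (box i p q)"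
    and "p' \<le> p + k" "q + k \<le> q'" "p' \<le> p + l" "q + l \<le> q'"
  shows "u \<otimes> (JM i [^] k \<otimes> JM (Suc i) [^] l) \<in> sp (box i p' q')"
proof (rule lin_span_mult_right[OF submod_lin_span[OF box_closed] _ box_closed _ u])
  fix s assume "s \<in> box i p q"
  then obtain k' l' where s: "s = JM i [^] k' \<otimes> JM (Suc i) [^] l' \<otimes> c i"
    "k' \<in> {p..q}" "l' \<in> {p..q}" by (auto simp: box_def)
  have "c i \<otimes> (JM i [^] k \<otimes> JM (Suc i) [^] l) = (JM i [^] k \<otimes> JM (Suc i) [^] l) \<otimes> c i"
    by (intro commute_mult c_JM_pow) auto
  then have "s \<otimes> (JM i [^] k \<otimes> JM (Suc i) [^] l) =
      JM i [^] k' \<otimes> (JM (Suc i) [^] l' \<otimes> JM i [^] k) \<otimes> JM (Suc i) [^] l \<otimes> c i"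
    unfolding s(1) by (simp add: m_assoc)
  also have "\<dots> = (JM i [^] k' \<otimes> JM i [^] k) \<otimes> (JM (Suc i) [^] l' \<otimes> JM (Suc i) [^] l) \<otimes> c i"
    unfolding JM_pow_commute_Suc[OF i, of k l', symmetric] by (simp add: m_assoc)
  also have "\<dots> = JM i [^] (k' + k) \<otimes> JM (Suc i) [^] (l' + l) \<otimes> c i"
    by (simp add: Units_int_pow)
  also have "\<dots> \<in> box i p' q'" unfolding box_def using s assms by force
  finally show "s \<otimes> (JM i [^] k \<otimes> JM (Suc i) [^] l) \<in> sp (box i p' q')"
    using lin_span_base[OF _ box_closed] by blast
qed auto

text \<open>With \<open>a = JM i\<close> the product of the two elements is \<open>a g a g\<close>,
  which equals \<open>g a g a\<close>. Hence \<open>g (a g a g) = (g a g a) g\<close>, so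
  \<open>g i\<close> commutes with this product, with its inverse and with all its powers.\<close>

lemma g_JM_pow_diagonal:
  assumes i: "i \<in> {1..<n}"
  shows "g i \<otimes> (JM i [^] (l::int) \<otimes> JM (Suc i) [^] l) = (JM i [^] l \<otimes> JM (Suc i) [^] l) \<otimes> g i"
proof -
  let ?a = "JM i" and ?b = "JM (Suc i)"
  have ab: "?a \<otimes> ?b = ?b \<otimes> ?a" using JM_commute_Suc i by simp
  have JM: "?b = g i \<otimes> JM i \<otimes> g i" using i by (simp add: JM_Suc)
  have "g i \<otimes> (?b \<otimes> ?a) = ?b \<otimes> ?a \<otimes> g i"
    unfolding ab[symmetric] by (simp add: JM m_assoc ab[unfolded JM m_assoc]) 
      (metis JM JM_closed ab g_closed m_assoc m_closed)
  then have gab: "g i \<otimes> (?a \<otimes> ?b) = (?a \<otimes> ?b) \<otimes> g i" by (simp add: ab)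
  then have gab': "g i \<otimes> (inv ?a \<otimes> inv ?b) = (inv ?a \<otimes> inv ?b) \<otimes> g i"
    using commute_inv[of "?b \<otimes> ?a" "g i"] by (simp add: inv_mult_Units ab)
  show ?thesis
  proof (induction l rule: int_induct[where k = 0])
    case (step1 l)
    have "?a [^] (l + 1) \<otimes> ?b [^] (l + 1) = ?a \<otimes> (?a [^] l \<otimes> ?b) \<otimes> ?b [^] l"
      by (simp add: Units_int_pow_Suc m_assoc)
    also have "?a [^] l \<otimes> ?b = ?b \<otimes> ?a [^] l"
      using JM_pow_commute_Suc[OF i, of l 1] by (simp add: Units_int_pow(3))
    finally have *: "?a [^] (l + 1) \<otimes> ?b [^] (l + 1) = (?a \<otimes> ?b) \<otimes> (?a [^] l \<otimes> ?b [^] l)"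
      by (simp add: m_assoc)
    show ?case unfolding * by (rule commute_mult) (use gab step1 in auto)
  next
    case (step2 l)
    have "?a [^] (l - 1) \<otimes> ?b [^] (l - 1) = inv ?a \<otimes> (?a [^] l \<otimes> inv ?b) \<otimes> ?b [^] l"
      by (simp add: Units_int_pow_Suc m_assoc)
    also have "?a [^] l \<otimes> inv ?b = inv ?b \<otimes> ?a [^] l"
      using JM_pow_commute_Suc[OF i, of l "- 1"] by (simp add: Units_int_pow(4))
    finally have *: "?a [^] (l - 1) \<otimes> ?b [^] (l - 1) = (inv ?a \<otimes> inv ?b) \<otimes> (?a [^] l \<otimes> ?b [^] l)"
      by (simp add: m_assoc)
    show ?case unfolding * by (rule commute_mult) (use gab' step2 in auto)
  qed simp
qed

text \<open>Each step moves \<open>g i\<close> past one more factor by \<open>g_JM\<close> and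
  multiplies the earlier error by that factor, which enlarges its exponents by at most one. Only
  nonnegative powers are treated here; \<open>bernstein\<close> reaches the others through the
  diagonal.\<close>

lemma g_JM_pow:
  fixes p :: nat
  assumes i: "i \<in> {1..<n}"
  shows "\<exists>u\<in>sp (box i 0 (int p)). g i \<otimes> JM i [^] int p = JM (Suc i) [^] int p \<otimes> g i \<oplus> u"
    "\<exists>u\<in>sp (box i 0 (int p)). g i \<otimes> JM (Suc i) [^] int p = JM i [^] int p \<otimes> g i \<oplus> u"
proof -
  let ?a = "JM i" and ?b = "JM (Suc i)"
  note sub = submodD[OF submod_lin_span[OF box_closed]]
  have ab: "?a [^] k \<otimes> ?b = ?b \<otimes> ?a [^] k" for k :: int
    using JM_pow_commute_Suc[OF i, of k 1] by (simp add: Units_int_pow(3))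
  have pow_Suc: "JM j [^] (1 + int p) = JM j [^] int p \<otimes> JM j" for j p
    using Units_int_pow(2)[of "JM j" "int p" 1] by (simp add: Units_int_pow(3) add.commute)
  show "\<exists>u\<in>sp (box i 0 (int p)). g i \<otimes> ?a [^] int p = ?b [^] int p \<otimes> g i \<oplus> u"
  proof (induction p)
    case 0 then show ?case using sub(2) by (intro bexI[of _ \<zero>]) auto
  next
    case (Suc p)
    then obtain u where u: "u \<in> sp (box i 0 (int p))"
      "g i \<otimes> ?a [^] int p = ?b [^] int p \<otimes> g i \<oplus> u" by blast
    have ucl: "u \<in> carrier A" using sub(1) u(1) .
    have "u \<otimes> (?a [^] (1::int) \<otimes> ?b [^] (0::int)) \<in> sp (box i 0 (int (Suc p)))"
      by (rule box_shift[OF i u(1)]) auto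
    then have ua: "u \<otimes> ?a \<in> sp (box i 0 (int (Suc p)))" by (simp add: Units_int_pow)
    have "?b [^] int (Suc p) \<otimes> c i \<in> box i 0 (int (Suc p))"
      unfolding box_def by (rule CollectI, rule exI[of _ 0], rule exI[of _ "int (Suc p)"]) simp
    then have bc: "?b [^] int (Suc p) \<otimes> c i \<in> sp (box i 0 (int (Suc p)))"
      by (rule lin_span_base[OF _ box_closed])
    have "g i \<otimes> ?a [^] int (Suc p) = (g i \<otimes> ?a [^] int p) \<otimes> ?a"
      by (simp add: pow_Suc m_assoc)
    also have "\<dots> = ?b [^] int p \<otimes> (g i \<otimes> ?a) \<oplus> u \<otimes> ?a"
      using ucl by (simp add: u(2) l_distr m_assoc)
    also have "\<dots> = ?b [^] int (Suc p) \<otimes> g i \<oplus> (\<ominus> (?b [^] int (Suc p) \<otimes> c i) \<oplus> u \<otimes> ?a)"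
      using ucl by (simp add: g_JM[OF i] a_minus_def r_distr r_minus pow_Suc m_assoc a_assoc)
    finally show ?case using sub(3)[OF sub(6)[OF bc] ua] by blast
  qed
  show "\<exists>u\<in>sp (box i 0 (int p)). g i \<otimes> ?b [^] int p = ?a [^] int p \<otimes> g i \<oplus> u"
  proof (induction p)
    case 0 then show ?case using sub(2) by (intro bexI[of _ \<zero>]) auto
  next
    case (Suc p)
    then obtain u where u: "u \<in> sp (box i 0 (int p))"
      "g i \<otimes> ?b [^] int p = ?a [^] int p \<otimes> g i \<oplus> u" by blast
    have ucl: "u \<in> carrier A" using sub(1) u(1) .
    have "u \<otimes> (?a [^] (0::int) \<otimes> ?b [^] (1::int)) \<in> sp (box i 0 (int (Suc p)))"
      by (rule box_shift[OF i u(1)]) auto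
    then have ub: "u \<otimes> ?b \<in> sp (box i 0 (int (Suc p)))" by (simp add: Units_int_pow)
    have "?a [^] int p \<otimes> ?b [^] (1::int) \<otimes> c i \<in> box i 0 (int (Suc p))"
      unfolding box_def by (rule CollectI, rule exI[of _ "int p"], rule exI[of _ "1"]) simp
    then have bc: "?a [^] int p \<otimes> ?b \<otimes> c i \<in> sp (box i 0 (int (Suc p)))"
      using lin_span_base[OF _ box_closed] by (simp add: Units_int_pow)
    have "g i \<otimes> ?b [^] int (Suc p) = (g i \<otimes> ?b [^] int p) \<otimes> ?b"
      by (simp add: pow_Suc m_assoc)
    also have "\<dots> = ?a [^] int p \<otimes> (g i \<otimes> ?b) \<oplus> u \<otimes> ?b"
      using ucl by (simp add: u(2) l_distr m_assoc)
    also have "\<dots> = ?a [^] int (Suc p) \<otimes> g i \<oplus> (?a [^] int p \<otimes> ?b \<otimes> c i \<oplus> u \<otimes> ?b)"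
      using ucl by (simp add: g_JM[OF i] r_distr pow_Suc m_assoc a_assoc)
    finally show ?case using sub(3)[OF bc ub] by blast
  qed
qed

text \<open>The diagonal monomial with exponent \<open>min k l\<close> commutes with
  \<open>g i\<close>. Splitting it off leaves a single power with exponent the absolute value of
  \<open>k - l\<close>; putting it back translates the error box from \<open>0\<close> and that
  value to the interval between \<open>k\<close> and \<open>l\<close>.\<close>

lemma bernstein:
  fixes k l :: int
  assumes i: "i \<in> {1..<n}"
  shows "\<exists>u\<in>sp (box i (min k l) (max k l)).
    g i \<otimes> (JM i [^] k \<otimes> JM (Suc i) [^] l) = JM i [^] l \<otimes> JM (Suc i) [^] k \<otimes> g i \<oplus> u"
proof (cases "l \<le> k")
  case True
  define p where "p = nat (k - l)"
  have k: "k = int p + l" using True by (simp add: p_def)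
  obtain u where u: "u \<in> sp (box i 0 (int p))"
    "g i \<otimes> JM i [^] int p = JM (Suc i) [^] int p \<otimes> g i \<oplus> u" using g_JM_pow[OF i] by blast
  have ucl: "u \<in> carrier A" using submodD(1)[OF submod_lin_span[OF box_closed] u(1)] .
  let ?w = "JM i [^] l \<otimes> JM (Suc i) [^] l"
  have "g i \<otimes> (JM i [^] k \<otimes> JM (Suc i) [^] l) = (g i \<otimes> JM i [^] int p) \<otimes> ?w"
    unfolding k by (simp add: Units_int_pow(2)[symmetric] m_assoc)
  also have "\<dots> = JM (Suc i) [^] int p \<otimes> (g i \<otimes> ?w) \<oplus> u \<otimes> ?w"
    using ucl by (simp add: u(2) l_distr m_assoc)
  also have "JM (Suc i) [^] int p \<otimes> (g i \<otimes> ?w) = JM (Suc i) [^] int p \<otimes> JM i [^] l \<otimes> JM (Suc i) [^] l \<otimes> g i"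
    unfolding g_JM_pow_diagonal[OF i] by (simp add: m_assoc)
  also have "\<dots> = JM i [^] l \<otimes> JM (Suc i) [^] k \<otimes> g i"
    unfolding JM_pow_commute_Suc[OF i, symmetric] k
    by (simp add: Units_int_pow(2)[symmetric] m_assoc)
  finally show ?thesis
    using box_shift[OF i u(1), of "min k l" l "max k l" l] k by (intro bexI[of _ "u \<otimes> ?w"]) auto
next
  case False
  define p where "p = nat (l - k)"
  have l: "l = int p + k" using False by (simp add: p_def)
  obtain u where u: "u \<in> sp (box i 0 (int p))"
    "g i \<otimes> JM (Suc i) [^] int p = JM i [^] int p \<otimes> g i \<oplus> u" using g_JM_pow[OF i] by blast
  have ucl: "u \<in> carrier A" using submodD(1)[OF submod_lin_span[OF box_closed] u(1)] .
  let ?w = "JM i [^] k \<otimes> JM (Suc i) [^] k"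
  have "g i \<otimes> (JM i [^] k \<otimes> JM (Suc i) [^] l) = g i \<otimes> (JM i [^] k \<otimes> JM (Suc i) [^] int p \<otimes> JM (Suc i) [^] k)"
    unfolding l by (simp add: Units_int_pow(2)[symmetric] m_assoc)
  also have "\<dots> = (g i \<otimes> JM (Suc i) [^] int p) \<otimes> ?w"
    unfolding JM_pow_commute_Suc[OF i, of k "int p"] by (simp add: m_assoc)
  also have "\<dots> = JM i [^] int p \<otimes> (g i \<otimes> ?w) \<oplus> u \<otimes> ?w"
    using ucl by (simp add: u(2) l_distr m_assoc)
  also have "JM i [^] int p \<otimes> (g i \<otimes> ?w) = JM i [^] l \<otimes> JM (Suc i) [^] k \<otimes> g i"
    unfolding g_JM_pow_diagonal[OF i] l by (simp add: Units_int_pow(2)[symmetric] m_assoc)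
  finally show ?thesis
    using box_shift[OF i u(1), of "min k l" k "max k l" k] l by (intro bexI[of _ "u \<otimes> ?w"]) auto
qed

section \<open>Monomials in the \<open>JM i\<close> and the span of the Ariki-Koike type set\<close>

definition monoJM :: "(nat \<Rightarrow> int) \<Rightarrow> 'b" where
  "monoJM a = mprod A (map (\<lambda>i. JM i [^] a i) [1..<n + 1])"

lemma monoJM_closed [simp, intro]: "monoJM a \<in> carrier A"
  unfolding monoJM_def by (intro mprod_closed) auto

definition AK :: "'b set \<Rightarrow> 'b set" where
  "AK B = {monoJM a \<otimes> w | a w. (\<forall>i\<in>{1..n}. a i \<in> E) \<and> w \<in> B}"

lemma t_monoJM: "t j \<otimes> monoJM a = monoJM a \<otimes> t j"
  unfolding monoJM_def by (rule commute_mprod) (auto intro!: commute_int_pow t_JM)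

lemma monoJM_split_first:
  obtains r where "r \<in> carrier A" "\<And>b. monoJM (a(1 := b)) = x [^] b \<otimes> r"
proof -
  have l: "[1..<n + 1] = 1 # [2..<n + 1]" using n_pos by (simp add: upt_conv_Cons numeral_2_eq_2 del: upt_Suc)
  show ?thesis
  proof (rule that[of "mprod A (map (\<lambda>i. JM i [^] a i) [2..<n + 1])"])
    show "mprod A (map (\<lambda>i. JM i [^] a i) [2..<n + 1]) \<in> carrier A"
      by (intro mprod_closed) auto
    show "monoJM (a(1 := b)) = x [^] b \<otimes> mprod A (map (\<lambda>i. JM i [^] a i) [2..<n + 1])" for b
    proof -
      have "map (\<lambda>i. JM i [^] (a(1 := b)) i) [2..<n + 1] = map (\<lambda>i. JM i [^] a i) [2..<n + 1]"
        by (rule map_cong) auto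
      then show ?thesis unfolding monoJM_def l by (simp only: list.map mprod_simps fun_upd_same JM.simps One_nat_def)
    qed
  qed
qed

text \<open>The outer factors \<open>p\<close> and \<open>r\<close> are independent of the two
  exponents at \<open>i\<close> and \<open>Suc i\<close>, so one factorisation serves the original,
  the exchanged and all intermediate exponents. The last clause is meant for \<open>g i\<close> and
  \<open>c i\<close>.\<close>

lemma monoJM_split:
  assumes i: "i \<in> {1..<n}"
  obtains p r where "p \<in> carrier A" "r \<in> carrier A"
    "\<And>k l. monoJM (a(i := k, Suc i := l)) = p \<otimes> (JM i [^] k \<otimes> JM (Suc i) [^] l) \<otimes> r"
    "\<And>y. y \<in> carrier A \<Longrightarrow> (\<And>j. j \<in> {1..n} \<Longrightarrow> j < i \<or> Suc i < j \<Longrightarrow> y \<otimes> JM j = JM j \<otimes> y) \<Longrightarrow>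
      y \<otimes> p = p \<otimes> y \<and> y \<otimes> r = r \<otimes> y"
proof -
  let ?m = "\<lambda>f is. mprod A (map (\<lambda>i. JM i [^] (f i :: int)) is)"
  have l: "[1..<n + 1] = [1..<i] @ [i, Suc i] @ [Suc (Suc i)..<n + 1]"
  proof -
    have "[1..<n + 1] = [1..<i] @ [i..<n + 1]"
      using i upt_add_eq_append[of 1 i "n + 1 - i"] by (simp del: upt_Suc)
    also have "[i..<n + 1] = i # Suc i # [Suc (Suc i)..<n + 1]"
      using i by (simp add: upt_conv_Cons del: upt_Suc)
    finally show ?thesis by simp
  qed
  show ?thesis
  proof (rule that[of "?m a [1..<i]" "?m a [Suc (Suc i)..<n + 1]"])
    show "?m a [1..<i] \<in> carrier A" "?m a [Suc (Suc i)..<n + 1] \<in> carrier A"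
      by (intro mprod_closed; auto)+
    show "monoJM (a(i := k, Suc i := l)) =
        ?m a [1..<i] \<otimes> (JM i [^] k \<otimes> JM (Suc i) [^] l) \<otimes> ?m a [Suc (Suc i)..<n + 1]" for k l
    proof -
      let ?b = "a(i := k, Suc i := l)"
      have eq: "map (\<lambda>i. JM i [^] ?b i) [1..<i] = map (\<lambda>i. JM i [^] a i) [1..<i]"
        "map (\<lambda>i. JM i [^] ?b i) [Suc (Suc i)..<n + 1] = map (\<lambda>i. JM i [^] a i) [Suc (Suc i)..<n + 1]"
        by (rule map_cong; auto)+
      have cl: "set (map (\<lambda>i. JM i [^] (f i :: int)) is) \<subseteq> carrier A" for f "is" by auto
      show ?thesis
        unfolding monoJM_def l map_append eq
        using cl[of a "[1..<i]"] cl[of a "[Suc (Suc i)..<n + 1]"]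
        by (simp add: mprod_append m_assoc del: upt_Suc)
    qed
    show "y \<otimes> ?m a [1..<i] = ?m a [1..<i] \<otimes> y \<and>
        y \<otimes> ?m a [Suc (Suc i)..<n + 1] = ?m a [Suc (Suc i)..<n + 1] \<otimes> y"
      if "y \<in> carrier A" "\<And>j. j \<in> {1..n} \<Longrightarrow> j < i \<or> Suc i < j \<Longrightarrow> y \<otimes> JM j = JM j \<otimes> y" for y
      using that i by (intro conjI commute_mprod) (auto intro!: commute_int_pow)
  qed
qed

lemma lin_span_AK:
  assumes B: "B \<subseteq> carrier A" and one: "\<one> \<in> sp B"
    and tB: "\<And>j. t j \<in> stab (sp B)" and gB: "\<And>i. g i \<in> stab (sp B)"
  shows "sp (AK B) = carrier A"
proof
  let ?V = "sp (AK B)"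
  have AK: "AK B \<subseteq> carrier A" using B by (auto simp: AK_def)
  note V = submod_lin_span[OF AK] and VB = submod_lin_span[OF B]
  show "?V \<subseteq> carrier A" by (rule lin_span_closed[OF AK])
  \<comment> \<open>Allowing \<open>w\<close> in the whole span of \<open>B\<close> means that a
    generator reaching \<open>w\<close> needs no further expansion.\<close>
  have mem: "monoJM a \<otimes> w \<in> ?V" if "\<And>i. i \<in> {1..n} \<Longrightarrow> a i \<in> E" "w \<in> sp B" for a w
  proof (rule lin_span_mult_left[OF V _ B _ that(2)])
    fix s assume "s \<in> B"
    then have "monoJM a \<otimes> s \<in> AK B" unfolding AK_def using that(1) by blast
    then show "monoJM a \<otimes> s \<in> ?V" by (rule lin_span_base[OF _ AK])
  qed simp
  have cB: "c i \<in> stab (sp B)" for i by (rule c_stab[OF VB tB tB])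
  \<comment> \<open>Only the exponent at 1 varies; the remaining factors are frozen in
    \<open>r\<close> while \<open>x_reduce\<close> is applied.\<close>
  have xpow: "x [^] k \<otimes> (monoJM a \<otimes> w) \<in> ?V"
    if a: "\<And>i. i \<in> {1..n} \<Longrightarrow> a i \<in> E" and w: "w \<in> sp B" for a w and k :: int
  proof -
    obtain r where r: "r \<in> carrier A" "\<And>b. monoJM (a(1 := b)) = x [^] b \<otimes> r"
      using monoJM_split_first by blast
    have wcl: "w \<in> carrier A" using submodD(1)[OF VB w] .
    have "x [^] k \<otimes> (monoJM a \<otimes> w) = x [^] (k + a 1) \<otimes> (r \<otimes> w)"
      using r(2)[of "a 1"] r(1) wcl by (simp add: m_assoc Units_int_pow(2)[symmetric])
    also have "\<dots> \<in> ?V"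
    proof (rule lin_span_mult_right[OF V _ _ _ x_reduce])
      fix s assume "s \<in> ([^]) x ` E"
      then obtain e where e: "s = x [^] e" "e \<in> E" by blast
      have "monoJM (a(1 := e)) \<otimes> w \<in> ?V" by (rule mem) (use a e w in auto)
      then show "s \<otimes> (r \<otimes> w) \<in> ?V" using r wcl e by (simp add: m_assoc)
    qed (use r wcl in auto)
    finally show ?thesis .
  qed
  have stabI: "y \<in> stab ?V" if "y \<in> carrier A"
    "\<And>a w. (\<And>i. i \<in> {1..n} \<Longrightarrow> a i \<in> E) \<Longrightarrow> w \<in> sp B \<Longrightarrow> y \<otimes> (monoJM a \<otimes> w) \<in> ?V" for y
  proof (rule stab_lin_spanI[OF AK that(1)])
    fix s assume "s \<in> AK B"
    then obtain a w where "s = monoJM a \<otimes> w" "\<forall>i\<in>{1..n}. a i \<in> E" "w \<in> B"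
      unfolding AK_def by blast
    then show "y \<otimes> s \<in> ?V" using that(2)[of a w] lin_span_base[OF _ B] by simp
  qed
  have wcl: "w \<in> carrier A" if "w \<in> sp B" for w using submodD(1)[OF VB that] .
  show "carrier A \<subseteq> ?V"
  proof (rule generated[OF V])
    have "monoJM (\<lambda>_. 0) \<otimes> \<one> \<in> ?V" by (rule mem) (use E_zero one in auto)
    moreover have "monoJM (\<lambda>_. 0) = \<one>"
    proof -
      have "mprod A (map (\<lambda>_. \<one>) is) = \<one>" for "is" :: "nat list" by (induction "is") auto
      then show ?thesis by (simp add: monoJM_def)
    qed
    ultimately show "\<one> \<in> ?V" by simp
    show "t j \<in> stab ?V" for j
    proof (rule stabI)
      fix a w assume a: "\<And>i. i \<in> {1..n} \<Longrightarrow> a i \<in> E" "w \<in> sp B"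
      have "t j \<otimes> (monoJM a \<otimes> w) = monoJM a \<otimes> (t j \<otimes> w)"
        using t_monoJM wcl[OF a(2)] by (intro commute_left) auto
      then show "t j \<otimes> (monoJM a \<otimes> w) \<in> ?V" using mem[OF a(1)] stabD[OF tB a(2)] by simp
    qed simp
    show "x \<in> stab ?V"
      using xpow[of _ _ 1] by (intro stabI) (auto simp: Units_int_pow)
    show "inv x \<in> stab ?V"
      using xpow[of _ _ "- 1"] by (intro stabI) (auto simp: Units_int_pow)
    show "g i \<in> stab ?V" for i
    proof (cases "i \<in> {1..<n}")
      case False
      then show ?thesis using stab_one[OF V] by (simp add: g_outside)
    next
      case i: True
      show ?thesis
      proof (rule stabI)
        fix a w assume a: "\<And>i. i \<in> {1..n} \<Longrightarrow> a i \<in> E" and w: "w \<in> sp B"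
        obtain p r where pr: "p \<in> carrier A" "r \<in> carrier A"
          "\<And>k l. monoJM (a(i := k, Suc i := l)) = p \<otimes> (JM i [^] k \<otimes> JM (Suc i) [^] l) \<otimes> r"
          "\<And>y. y \<in> carrier A \<Longrightarrow> (\<And>j. j \<in> {1..n} \<Longrightarrow> j < i \<or> Suc i < j \<Longrightarrow> y \<otimes> JM j = JM j \<otimes> y) \<Longrightarrow>
            y \<otimes> p = p \<otimes> y \<and> y \<otimes> r = r \<otimes> y"
          using monoJM_split[OF i, of a] by blast
        have gpr: "g i \<otimes> p = p \<otimes> g i" "g i \<otimes> r = r \<otimes> g i"
          using pr(4)[of "g i"] g_JM_above g_JM_below i by auto
        have cpr: "c i \<otimes> r = r \<otimes> c i" using pr(4)[of "c i"] c_JM by auto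
        have mem': "p \<otimes> (JM i [^] k \<otimes> JM (Suc i) [^] l) \<otimes> r \<otimes> v \<in> ?V"
          if "k \<in> E" "l \<in> E" "v \<in> sp B" for k l v
          using mem[of "a(i := k, Suc i := l)" v] a that by (simp add: pr(3))
        let ?k = "a i" and ?l = "a (Suc i)"
        have kl: "?k \<in> E" "?l \<in> E" using a i by auto
        obtain u where u: "u \<in> sp (box i (min ?k ?l) (max ?k ?l))"
          "g i \<otimes> (JM i [^] ?k \<otimes> JM (Suc i) [^] ?l) = JM i [^] ?l \<otimes> JM (Suc i) [^] ?k \<otimes> g i \<oplus> u"
          using bernstein[OF i] by blast
        have ucl: "u \<in> carrier A" using submodD(1)[OF submod_lin_span[OF box_closed] u(1)] .
        have "g i \<otimes> (monoJM a \<otimes> w) = (g i \<otimes> p) \<otimes> (JM i [^] ?k \<otimes> JM (Suc i) [^] ?l) \<otimes> r \<otimes> w"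
          using pr(3)[of ?k ?l] pr(1,2) wcl[OF w] by (simp add: m_assoc)
        also have "\<dots> = p \<otimes> (g i \<otimes> (JM i [^] ?k \<otimes> JM (Suc i) [^] ?l)) \<otimes> r \<otimes> w"
          unfolding gpr using pr(1,2) wcl[OF w] by (simp add: m_assoc)
        also have "\<dots> = p \<otimes> (JM i [^] ?l \<otimes> JM (Suc i) [^] ?k) \<otimes> (g i \<otimes> r) \<otimes> w \<oplus> p \<otimes> u \<otimes> (r \<otimes> w)"
          unfolding u(2) using pr(1,2) wcl[OF w] ucl by (simp add: m_assoc r_distr l_distr)
        also have "p \<otimes> (JM i [^] ?l \<otimes> JM (Suc i) [^] ?k) \<otimes> (g i \<otimes> r) \<otimes> w =
            p \<otimes> (JM i [^] ?l \<otimes> JM (Suc i) [^] ?k) \<otimes> r \<otimes> (g i \<otimes> w)"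
          unfolding gpr using pr(1,2) wcl[OF w] by (simp add: m_assoc)
        finally have eq: "g i \<otimes> (monoJM a \<otimes> w) =
            p \<otimes> (JM i [^] ?l \<otimes> JM (Suc i) [^] ?k) \<otimes> r \<otimes> (g i \<otimes> w) \<oplus> p \<otimes> u \<otimes> (r \<otimes> w)" .
        \<comment> \<open>The error terms: \<open>c i\<close> commutes with \<open>r\<close>, so it
          can be moved next to \<open>w\<close>, where it acts within the span of
          \<open>B\<close>.\<close>
        have "p \<otimes> u \<otimes> (r \<otimes> w) \<in> ?V"
        proof (rule lin_span_mult[OF V _ _ box_closed _ u(1)])
          fix s assume "s \<in> box i (min ?k ?l) (max ?k ?l)"
          then obtain k l where s: "s = JM i [^] k \<otimes> JM (Suc i) [^] l \<otimes> c i"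
            and b: "k \<in> {min ?k ?l..max ?k ?l}" "l \<in> {min ?k ?l..max ?k ?l}"
            by (auto simp: box_def)
          have mm: "min ?k ?l \<in> E" "max ?k ?l \<in> E" using kl by (auto simp: min_def max_def)
          have "k \<in> E" "l \<in> E" using b by (auto intro!: E_convex[OF mm])
          then have "p \<otimes> (JM i [^] k \<otimes> JM (Suc i) [^] l) \<otimes> r \<otimes> (c i \<otimes> w) \<in> ?V"
            by (intro mem' stabD[OF cB w])
          also have "p \<otimes> (JM i [^] k \<otimes> JM (Suc i) [^] l) \<otimes> r \<otimes> (c i \<otimes> w) =
              p \<otimes> (JM i [^] k \<otimes> JM (Suc i) [^] l) \<otimes> (r \<otimes> c i) \<otimes> w"
            using pr(1,2) wcl[OF w] by (simp add: m_assoc)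
          also have "\<dots> = p \<otimes> s \<otimes> (r \<otimes> w)"
            unfolding s cpr[symmetric] using pr(1,2) wcl[OF w] by (simp add: m_assoc)
          finally show "p \<otimes> s \<otimes> (r \<otimes> w) \<in> ?V" .
        qed (use pr(1,2) wcl[OF w] in auto)
        then show "g i \<otimes> (monoJM a \<otimes> w) \<in> ?V"
          unfolding eq using kl w by (intro submodD(3)[OF V] mem' stabD[OF gB])
      qed simp
    qed
  qed
qed

section \<open>The inductive sets\<close>

text \<open>The Boolean arguments select the signs: \<open>W e e' k J a b\<close> has left factors \<open>gs e i\<close> and right factors
  \<open>gs e' i\<close>, which covers the four families of the paper.\<close>

definition Lw :: "bool \<Rightarrow> nat \<Rightarrow> 'b" where
  "Lw e J = mprod A (map (gs e) (rev [1..<J + 1]))"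

definition Rw :: "bool \<Rightarrow> nat \<Rightarrow> 'b" where
  "Rw e k = mprod A (map (gs e) [1..<k])"

definition W :: "bool \<Rightarrow> bool \<Rightarrow> nat \<Rightarrow> nat \<Rightarrow> int \<Rightarrow> int \<Rightarrow> 'b" where
  "W e e' k J a b = Lw e J \<otimes> x [^] a \<otimes> t 1 [^] b \<otimes> Rw e' k"

lemma Lw_closed [simp, intro]: "Lw e J \<in> carrier A"
  unfolding Lw_def by (intro mprod_closed) auto

lemma Rw_closed [simp, intro]: "Rw e k \<in> carrier A"
  unfolding Rw_def by (intro mprod_closed) auto

lemma t_pow_closed [simp, intro]: "t j [^] (b::int) \<in> carrier A"
  by (intro Units_closed Units_int_pow) simp

lemma W_closed [simp, intro]: "W e e' k J a b \<in> carrier A"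
  unfolding W_def by simp

lemma Lw_0 [simp]: "Lw e 0 = \<one>" by (simp add: Lw_def)

lemma Lw_Suc: "Lw e (Suc J) = gs e (Suc J) \<otimes> Lw e J" by (simp add: Lw_def)

lemma Rw_1 [simp]: "Rw e (Suc 0) = \<one>" by (simp add: Rw_def)

lemma Rw_Suc: "1 \<le> k \<Longrightarrow> Rw e (Suc k) = Rw e k \<otimes> gs e k"
proof -
  assume "1 \<le> k"
  then have "map (gs e) [1..<Suc k] = map (gs e) [1..<k] @ [gs e k]" by simp
  moreover have "set (map (gs e) [1..<k]) \<subseteq> carrier A" by auto
  ultimately show ?thesis unfolding Rw_def by (simp only:) (simp add: mprod_append)
qed

lemma commute_Rw:
  assumes "y \<in> carrier A" "\<And>i. i \<in> {1..<k} \<Longrightarrow> y \<otimes> g i = g i \<otimes> y"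
  shows "y \<otimes> Rw e k = Rw e k \<otimes> y"
  unfolding Rw_def using assms by (intro commute_mprod) (auto intro!: commute_gs)

lemma commute_Lw:
  assumes "y \<in> carrier A" "\<And>i. i \<in> {1..J} \<Longrightarrow> y \<otimes> g i = g i \<otimes> y"
  shows "y \<otimes> Lw e J = Lw e J \<otimes> y"
  unfolding Lw_def using assms by (intro commute_mprod) (auto intro!: commute_gs)

lemma g_Lw_above: "Suc J < i \<Longrightarrow> g i \<otimes> Lw e J = Lw e J \<otimes> g i"
  by (intro commute_Lw g_far') auto

text \<open>The braid relation raises the index of \<open>g i\<close> across the adjacent factors
  with indices \<open>Suc i\<close> and \<open>i\<close>. The factors before them are far from
  \<open>i\<close>, those after them far from \<open>Suc i\<close>.\<close>

lemma g_Lw_below: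
  assumes "1 \<le> i" "i < J" "J < n"
  shows "g i \<otimes> Lw e J = Lw e J \<otimes> g (Suc i)"
proof -
  have "Suc i \<le> J" using assms by simp
  then show ?thesis using assms(3)
  proof (induction J rule: nat_induct_at_least)
    case base
    obtain m where m: "i = Suc m" using assms(1) by (cases i) auto
    have "g i \<otimes> Lw e (Suc i) = g i \<otimes> (gs e (Suc i) \<otimes> gs e i) \<otimes> Lw e m"
      by (simp add: m Lw_Suc m_assoc)
    also have "\<dots> = gs e (Suc i) \<otimes> gs e i \<otimes> (g (Suc i) \<otimes> Lw e m)"
      using braid_gs(1)[of i e] assms by (simp add: m_assoc)
    also have "\<dots> = Lw e (Suc i) \<otimes> g (Suc i)"
      using g_Lw_above[of m "Suc i" e] by (simp add: m Lw_Suc m_assoc)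
    finally show ?case .
  next
    case (Suc J)
    have "g i \<otimes> Lw e (Suc J) = (g i \<otimes> gs e (Suc J)) \<otimes> Lw e J" by (simp add: Lw_Suc m_assoc)
    also have "g i \<otimes> gs e (Suc J) = gs e (Suc J) \<otimes> g i"
      using Suc by (intro commute_gs g_far') auto
    finally show ?case using Suc by (simp add: Lw_Suc m_assoc)
  qed
qed

text \<open>The counterpart of \<open>g_Lw_below\<close>: the index is lowered by one, so that the
  generator arrives at the right factor with an index for which that factor is known to be
  stable.\<close>

lemma g_Rw:
  assumes "1 \<le> i" "Suc i < k" "k \<le> n"
  shows "g (Suc i) \<otimes> Rw e k = Rw e k \<otimes> g i"
proof -
  have "Suc (Suc i) \<le> k" using assms by simp
  then show ?thesis using assms(3)
  proof (induction k rule: nat_induct_at_least)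
    case base
    have "g (Suc i) \<otimes> Rw e i = Rw e i \<otimes> g (Suc i)"
      by (intro commute_Rw g_far') auto
    then have "g (Suc i) \<otimes> Rw e (Suc (Suc i)) =
        Rw e i \<otimes> (g (Suc i) \<otimes> (gs e i \<otimes> gs e (Suc i)))"
      using assms(1) by (simp add: Rw_Suc m_assoc[symmetric])
    then show ?case
      using braid_gs(2)[of i e] assms base by (simp add: Rw_Suc m_assoc)
  next
    case (Suc k)
    have "g i \<otimes> gs e k = gs e k \<otimes> g i" using Suc by (intro commute_gs g_far') auto
    then show ?case using Suc by (simp add: Rw_Suc m_assoc[symmetric]) (simp add: m_assoc)
  qed
qed

text \<open>Whatever its sign, \<open>Lw e J\<close> moves the indices by a product of
  transpositions, namely the cycle that sends \<open>Suc J\<close> to 1 and raises the indices up to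
  \<open>J\<close>.\<close>

lemma t_Lw:
  assumes "J < n" "1 \<le> j"
  shows "t j \<otimes> Lw e J = Lw e J \<otimes> t (if j = Suc J then 1 else if j \<le> J then Suc j else j)"
  using assms
proof (induction J arbitrary: j)
  case (Suc J)
  let ?j = "Transposition.transpose (Suc J) (Suc (Suc J)) j"
  have j: "1 \<le> ?j" using Suc.prems by (auto simp: Transposition.transpose_def)
  have "t j \<otimes> Lw e (Suc J) = gs e (Suc J) \<otimes> (t ?j \<otimes> Lw e J)"
    using t_gs[of "Suc J" j e] Suc.prems by (simp add: Lw_Suc m_assoc[symmetric])
  also have "\<dots> = Lw e (Suc J) \<otimes> t (if ?j = Suc J then 1 else if ?j \<le> J then Suc ?j else ?j)"
    using Suc.IH[OF _ j] Suc.prems by (simp add: Lw_Suc m_assoc)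
  also have "(if ?j = Suc J then 1 else if ?j \<le> J then Suc ?j else ?j) =
      (if j = Suc (Suc J) then 1 else if j \<le> Suc J then Suc j else j)"
    by (auto simp: Transposition.transpose_def)
  finally show ?case .
qed auto

lemma t_Rw:
  assumes "1 \<le> j" "j < k" "k \<le> n"
  shows "t (Suc j) \<otimes> Rw e k = Rw e k \<otimes> t j"
proof -
  have "Suc j \<le> k" using assms by simp
  then show ?thesis using assms(3)
  proof (induction k rule: nat_induct_at_least)
    case base
    have "t (Suc j) \<otimes> Rw e j = Rw e j \<otimes> t (Suc j)"
      using t_g[of _ "Suc j"] assms by (intro commute_Rw) auto
    moreover have "t (Suc j) \<otimes> gs e j = gs e j \<otimes> t j"
      using t_gs[of j "Suc j" e] assms by simp
    ultimately show ?case using assms(1) by (simp add: Rw_Suc m_assoc[symmetric]) (simp add: m_assoc)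
  next
    case (Suc k)
    have "t j \<otimes> gs e k = gs e k \<otimes> t j" using t_gs[of k j e] Suc assms(1) by simp
    then show ?case using Suc by (simp add: Rw_Suc m_assoc[symmetric]) (simp add: m_assoc)
  qed
qed

lemma x_pow_t: "x [^] (a::int) \<otimes> t j [^] (b::int) = t j [^] b \<otimes> x [^] a"
  by (intro commute_int_pow commute_int_pow[symmetric] x_t) auto

text \<open>This only says that \<open>g y g\<close>, with \<open>g = gs f 1\<close>, commutes with \<open>x\<^sup>a\<close>: for \<open>f\<close> true it is \<open>X\<^sub>2\<close>, and
  otherwise \<open>X\<^sub>2\<^sup>-\<^sup>1\<close>.\<close>

lemma commute_JM2_variant:
  assumes "1 < n" and y: "y = (if f then x else inv x)"
  shows "y \<otimes> gs f 1 \<otimes> x [^] (a::int) \<otimes> gs (\<not> f) 1 = gs (\<not> f) 1 \<otimes> x [^] a \<otimes> gs f 1 \<otimes> y"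
proof -
  have ycl [simp]: "y \<in> carrier A" by (simp add: y)
  have J: "JM 2 = g 1 \<otimes> x \<otimes> g 1" by (simp add: numeral_2_eq_2)
  have "x \<otimes> JM 2 = JM 2 \<otimes> x" using JM_commute_Suc[of 1] assms(1) by (simp add: numeral_2_eq_2)
  moreover have "inv (JM 2) = inv (g 1) \<otimes> inv x \<otimes> inv (g 1)"
    unfolding J by (simp add: inv_mult_Units m_assoc)
  ultimately have "x \<otimes> (gs f 1 \<otimes> y \<otimes> gs f 1) = (gs f 1 \<otimes> y \<otimes> gs f 1) \<otimes> x"
    using commute_inv[of "JM 2" x] J by (cases f) (auto simp: y gs_def)
  then have *: "(gs f 1 \<otimes> y \<otimes> gs f 1) \<otimes> x [^] a = x [^] a \<otimes> (gs f 1 \<otimes> y \<otimes> gs f 1)"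
    by (intro commute_int_pow) auto
  have "y \<otimes> gs f 1 \<otimes> x [^] a \<otimes> gs (\<not> f) 1 =
      gs (\<not> f) 1 \<otimes> ((gs f 1 \<otimes> y \<otimes> gs f 1) \<otimes> x [^] a) \<otimes> gs (\<not> f) 1"
    by (simp add: m_assoc)
  also have "\<dots> = gs (\<not> f) 1 \<otimes> x [^] a \<otimes> gs f 1 \<otimes> y"
    unfolding * by (simp add: m_assoc)
  finally show ?thesis .
qed

end

section \<open>One step of the induction for the inductive sets\<close>

locale induction_step = affine_yokonuma +
  fixes e e' :: bool and k :: nat and P
  assumes k: "1 \<le> k" "k \<le> n" and P: "submod P"
    and tP: "\<lbrakk>1 \<le> j; j < k\<rbrakk> \<Longrightarrow> t j \<in> stab P"
    and gP: "\<lbrakk>1 \<le> i; Suc i < k\<rbrakk> \<Longrightarrow> g i \<in> stab P"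
    and xP: "2 \<le> k \<Longrightarrow> x \<in> stab P" "2 \<le> k \<Longrightarrow> inv x \<in> stab P"
begin

text \<open>The factor \<open>s\<close> runs through the whole submodule \<open>P\<close> and not
  through a spanning set, so a generator arriving at \<open>s\<close> is absorbed at once.\<close>

definition G where
  "G = {W e e' k J a b \<otimes> s | J a b s. J < k \<and> a \<in> E \<and> b \<in> {0..int d - 1} \<and> s \<in> P}"

abbreviation V where "V \<equiv> sp G"

lemma P_closed: "s \<in> P \<Longrightarrow> s \<in> carrier A" by (rule submodD(1)[OF P])

lemma G_closed: "G \<subseteq> carrier A" by (auto simp: G_def P_closed)

lemmas V = submod_lin_span[OF G_closed]

lemma W_mem:
  assumes "J < k" "b \<in> {0..int d - 1}" "s \<in> P"
  shows "W e e' k J a b \<otimes> s \<in> V"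
proof -
  have s: "s \<in> carrier A" by (rule P_closed[OF assms(3)])
  have "Lw e J \<otimes> x [^] a \<otimes> (t 1 [^] b \<otimes> Rw e' k \<otimes> s) \<in> V"
  proof (rule lin_span_mult[OF V _ _ _ _ x_reduce])
    fix u assume "u \<in> ([^]) x ` E"
    then obtain a' where u: "u = x [^] a'" "a' \<in> E" by blast
    have "W e e' k J a' b \<otimes> s \<in> G" unfolding G_def using assms u(2) by blast
    then have "W e e' k J a' b \<otimes> s \<in> V" by (rule lin_span_base[OF _ G_closed])
    then show "Lw e J \<otimes> u \<otimes> (t 1 [^] b \<otimes> Rw e' k \<otimes> s) \<in> V"
      using s by (simp add: u(1) W_def m_assoc)
  qed (use s in auto)
  then show ?thesis using s by (simp add: W_def m_assoc)
qed

lemma G_cases: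
  assumes "v \<in> G"
  obtains J a b s where "v = W e e' k J a b \<otimes> s" "J < k" "a \<in> E" "b \<in> {0..int d - 1}" "s \<in> P"
  using assms by (auto simp: G_def)

text \<open>Across \<open>Lw e J\<close> the index \<open>j\<close> becomes \<open>j'\<close>. If
  \<open>j'\<close> is 1, the power of \<open>t 1\<close> absorbs the generator; otherwise
  \<open>Rw e' k\<close> lowers the index by one, to a value below \<open>k\<close>, and the
  generator acts on \<open>s\<close>.\<close>

lemma t_stab:
  assumes j: "1 \<le> j" "j \<le> k"
  shows "t j \<in> stab V"
proof (rule stab_lin_spanI[OF G_closed])
  fix v assume "v \<in> G"
  then obtain J a b s where v: "v = W e e' k J a b \<otimes> s" "J < k" "a \<in> E" "b \<in> {0..int d - 1}" "s \<in> P"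
    by (rule G_cases)
  have s: "s \<in> carrier A" by (rule P_closed[OF v(5)])
  define j' where "j' = (if j = Suc J then 1 else if j \<le> J then Suc j else j)"
  have "t j \<otimes> Lw e J = Lw e J \<otimes> t j'"
    unfolding j'_def using v(2) k j by (intro t_Lw) auto
  then have "t j \<otimes> v = Lw e J \<otimes> (t j' \<otimes> x [^] a) \<otimes> t 1 [^] b \<otimes> Rw e' k \<otimes> s"
    unfolding v(1) W_def using s by (simp add: m_assoc[symmetric])
  also have "t j' \<otimes> x [^] a = x [^] a \<otimes> t j'" by (intro commute_int_pow) (auto simp: x_t)
  finally have eq: "t j \<otimes> v = Lw e J \<otimes> x [^] a \<otimes> (t j' \<otimes> t 1 [^] b) \<otimes> Rw e' k \<otimes> s"
    using s by (simp add: m_assoc)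
  show "t j \<otimes> v \<in> V"
  proof (cases "j' = 1")
    case True
    \<comment> \<open>The exponent wraps around at \<open>d - 1\<close>, because the
      \<open>d\<close>-th power of \<open>t 1\<close> is the unit.\<close>
    define b' where "b' = (if b = int d - 1 then 0 else b + 1)"
    have "t 1 \<otimes> t 1 [^] b = t 1 [^] b'"
    proof (cases "b = int d - 1")
      case True
      have "t 1 \<otimes> t 1 [^] b = t 1 [^] int d"
        using Units_int_pow_Suc(1)[of "t 1" b] True by simp
      then show ?thesis using True t_order[of 1] by (simp add: b'_def int_pow_int)
    qed (simp add: b'_def Units_int_pow_Suc)
    then have "t j \<otimes> v = W e e' k J a b' \<otimes> s" unfolding eq True W_def by simp
    moreover have "b' \<in> {0..int d - 1}" using v(4) by (auto simp: b'_def)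
    ultimately show ?thesis using W_mem v by simp
  next
    case False
    then obtain m where m: "j' = Suc m" "1 \<le> m" "m < k"
      using j v(2) by (cases j') (auto simp: j'_def split: if_splits)
    have "t j' \<otimes> t 1 [^] b = t 1 [^] b \<otimes> t j'" by (intro commute_int_pow) (auto simp: t_commute)
    moreover have "t j' \<otimes> Rw e' k = Rw e' k \<otimes> t m" unfolding m(1) using m k by (intro t_Rw) auto
    ultimately have "t j \<otimes> v = W e e' k J a b \<otimes> (t m \<otimes> s)"
      unfolding eq W_def using s by (simp add: m_assoc)
    then show ?thesis using W_mem v m stabD[OF tP v(5)] by simp
  qed
qed simp

lemma cs_stab_V: "1 \<le> i \<Longrightarrow> i < k \<Longrightarrow> \<delta> \<in> cs i \<Longrightarrow> \<delta> \<in> stab V"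
  by (rule cs_stab[OF V t_stab t_stab]) auto

text \<open>For \<open>i < J\<close> the index is raised by \<open>Lw\<close> and lowered again by
  \<open>Rw\<close>; for \<open>i > Suc J\<close> it is only lowered by \<open>Rw\<close>. In both
  cases a generator acts on \<open>s\<close>. For \<open>i = J\<close> and \<open>i = Suc J\<close>
  the left word is shortened or prolonged by one letter, up to an element of
  \<open>cs i\<close>.\<close>

lemma g_stab:
  assumes i: "1 \<le> i" "i < k"
  shows "g i \<in> stab V"
proof (rule stab_lin_spanI[OF G_closed])
  have i': "i \<in> {1..<n}" using i k by auto
  fix v assume "v \<in> G"
  then obtain J a b s where v: "v = W e e' k J a b \<otimes> s" "J < k" "a \<in> E" "b \<in> {0..int d - 1}" "s \<in> P"
    by (rule G_cases)
  have s: "s \<in> carrier A" by (rule P_closed[OF v(5)])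
  \<comment> \<open>Only the length of the left word varies; everything to its right is
    fixed.\<close>
  define M where "M J = Lw e J \<otimes> (x [^] a \<otimes> t 1 [^] b \<otimes> Rw e' k \<otimes> s)" for J
  have M: "M J' = W e e' k J' a b \<otimes> s" for J' unfolding M_def W_def using s by (simp add: m_assoc)
  have MV: "J' < k \<Longrightarrow> M J' \<in> V" for J' unfolding M using W_mem v by blast
  have shift: "g i \<otimes> v \<in> V" if "g i \<otimes> Lw e J = Lw e J \<otimes> g (Suc m)" "1 \<le> m" "Suc m < k" for m
  proof -
    have 1: "g (Suc m) \<otimes> Rw e' k = Rw e' k \<otimes> g m" using that k by (intro g_Rw) auto
    have 2: "g (Suc m) \<otimes> (x [^] a \<otimes> t 1 [^] b) = x [^] a \<otimes> t 1 [^] b \<otimes> g (Suc m)"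
    proof (intro commute_mult commute_int_pow)
      show "g (Suc m) \<otimes> x = x \<otimes> g (Suc m)" using x_g[of "Suc m"] that by simp
      show "g (Suc m) \<otimes> t 1 = t 1 \<otimes> g (Suc m)" using t_g[of "Suc m" 1] that k by simp
    qed auto
    have "g i \<otimes> v = (g i \<otimes> Lw e J) \<otimes> (x [^] a \<otimes> t 1 [^] b) \<otimes> Rw e' k \<otimes> s"
      unfolding v(1) W_def using s by (simp add: m_assoc)
    also have "\<dots> = Lw e J \<otimes> (g (Suc m) \<otimes> (x [^] a \<otimes> t 1 [^] b)) \<otimes> Rw e' k \<otimes> s"
      unfolding that(1) using s by (simp add: m_assoc)
    also have "\<dots> = Lw e J \<otimes> (x [^] a \<otimes> t 1 [^] b) \<otimes> (g (Suc m) \<otimes> Rw e' k) \<otimes> s"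
      unfolding 2 using s by (simp add: m_assoc)
    also have "\<dots> = W e e' k J a b \<otimes> (g m \<otimes> s)"
      unfolding 1 W_def using s by (simp add: m_assoc)
    also have "\<dots> \<in> V" using v stabD[OF gP v(5)] that by (intro W_mem) auto
    finally show ?thesis .
  qed
  have vM: "v = M J" unfolding v(1) M ..
  have step: "g i \<otimes> M (Suc J') \<in> V" "g i \<otimes> M J' \<in> V" if J': "i = Suc J'" "Suc J' < k" for J'
  proof -
    have LM: "M (Suc J') = gs e i \<otimes> M J'" unfolding M_def using s by (simp add: J' Lw_Suc m_assoc)
    have McL: "M J \<in> carrier A" for J unfolding M_def using s by simp
    \<comment> \<open>The sign opposite to \<open>e\<close> makes the leading factor of
      \<open>M (Suc J')\<close> cancel; below, the sign \<open>e\<close> makes it appear.\<close>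
    obtain \<delta> where \<delta>: "\<delta> \<in> cs i" "gs True i = gs (\<not> e) i \<oplus> \<delta>" using gs_change_sign[OF i'] .
    have "g i \<otimes> M (Suc J') = M J' \<oplus> \<delta> \<otimes> M (Suc J')"
      using \<delta>(2) LM McL cs_closed[OF \<delta>(1)] by (simp add: gs_def[of True] l_distr)
    also have "\<dots> \<in> V" using stabD[OF cs_stab_V[OF i \<delta>(1)]] MV J' by (intro submodD(3)[OF V]) auto
    finally show "g i \<otimes> M (Suc J') \<in> V" .
    obtain \<delta> where \<delta>: "\<delta> \<in> cs i" "gs True i = gs e i \<oplus> \<delta>" using gs_change_sign[OF i'] .
    have "g i \<otimes> M J' = M (Suc J') \<oplus> \<delta> \<otimes> M J'"
      using \<delta>(2) LM McL cs_closed[OF \<delta>(1)] by (simp add: gs_def[of True] l_distr)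
    also have "\<dots> \<in> V" using stabD[OF cs_stab_V[OF i \<delta>(1)]] MV J' by (intro submodD(3)[OF V]) auto
    finally show "g i \<otimes> M J' \<in> V" .
  qed
  consider "i < J" | "i = J" | "i = Suc J" | "Suc J < i" by linarith
  then show "g i \<otimes> v \<in> V"
  proof cases
    case 1
    then show ?thesis using g_Lw_below[of i J e] i v(2) k by (intro shift[of i]) auto
  next
    case 2
    then show ?thesis using step(1)[of "J - 1"] i vM v(2) by simp
  next
    case 3
    then show ?thesis using step(2)[of J] i vM by simp
  next
    case 4
    then show ?thesis using g_Lw_above[of J i e] i by (intro shift[of "i - 1"]) auto
  qed
qed simp

lemma gs_stab:
  assumes i: "1 \<le> i" "i < k"
  shows "gs f i \<in> stab V"
proof -
  have "i \<in> {1..<n}" using i k by auto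
  then obtain \<delta> where "\<delta> \<in> cs i" "gs f i = gs True i \<oplus> \<delta>" by (rule gs_change_sign)
  then show ?thesis
    using g_stab[OF i] cs_stab_V[OF i] submodD(3)[OF submod_stab[OF V]] by (simp add: gs_def[of True])
qed

lemma gs_cancel_mem:
  assumes "1 \<le> i" "i < k" "v \<in> carrier A" "gs f i \<otimes> v \<in> V"
  shows "v \<in> V"
  using stabD[OF gs_stab[OF assms(1,2), of "\<not> f"] assms(4)] assms(3) by simp

text \<open>With \<open>J\<close>, \<open>a\<close> and \<open>b\<close> zero the word is
  \<open>Rw e' k\<close>. Its factors are stripped off from the left one by one, since
  \<open>V\<close> is also stable under their inverses.\<close>

lemma one_mem:
  assumes "\<one> \<in> P"
  shows "\<one> \<in> V"
proof -
  have "v \<in> V" if "set is \<subseteq> {1..<k}" "v \<in> carrier A" "mprod A (map (gs e') is) \<otimes> v \<in> V" for v "is"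
    using that
  proof (induction "is")
    case (Cons i "is")
    have cl: "mprod A (map (gs e') is) \<in> carrier A" by (intro mprod_closed) auto
    have "gs e' i \<otimes> (mprod A (map (gs e') is) \<otimes> v) \<in> V"
      using Cons.prems cl by (simp add: m_assoc)
    then have "mprod A (map (gs e') is) \<otimes> v \<in> V"
      by (rule gs_cancel_mem[rotated 3]) (use Cons.prems cl in auto)
    then show ?case using Cons by simp
  qed simp
  moreover have "W e e' k 0 0 0 \<otimes> \<one> \<in> V" using k d_pos by (intro W_mem assms) auto
  then have "Rw e' k \<otimes> \<one> \<in> V" by (simp add: W_def)
  ultimately show ?thesis unfolding Rw_def by (metis one_closed order_refl set_upt)
qed

text \<open>All factors of the word except \<open>gs e 1\<close> have index at least 2 and commute
  with \<open>x\<close>; they are collected in \<open>u\<close>. Dually, \<open>Rw_decompose\<close>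
  collects those of the right word in \<open>r\<close>.\<close>

lemma Lw_decompose:
  assumes "1 \<le> J" "J < k" and y: "y = (if f then x else inv x)"
  shows "\<exists>u. u \<in> stab V \<and> Lw e J = u \<otimes> gs e 1 \<and> y \<otimes> u = u \<otimes> y"
  using assms(1,2)
proof (induction J rule: nat_induct_at_least)
  case base
  show ?case
    using stab_one[OF V] by (intro exI[of _ \<one>]) (auto simp: Lw_Suc y)
next
  case (Suc J)
  then obtain u where u: "u \<in> stab V" "Lw e J = u \<otimes> gs e 1" "y \<otimes> u = u \<otimes> y" by auto
  have ucl: "u \<in> carrier A" by (rule stab_closed[OF u(1)])
  have "x \<otimes> gs e (Suc J) = gs e (Suc J) \<otimes> x" using Suc by (intro x_gs) auto
  then have "y \<otimes> gs e (Suc J) = gs e (Suc J) \<otimes> y"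
    unfolding y by (auto intro: commute_inv[symmetric])
  then have "y \<otimes> (gs e (Suc J) \<otimes> u) = gs e (Suc J) \<otimes> u \<otimes> y"
    using u ucl by (intro commute_mult) (auto simp: y)
  then show ?case
    using Suc u ucl stab_mult[OF V gs_stab u(1)]
    by (intro exI[of _ "gs e (Suc J) \<otimes> u"]) (simp add: Lw_Suc m_assoc)
qed

lemma Rw_decompose:
  assumes "2 \<le> k"
  shows "\<exists>r. r \<in> carrier A \<and> Rw e' k = gs e' 1 \<otimes> r \<and> x \<otimes> r = r \<otimes> x"
proof -
  have l: "[1..<k] = 1 # [Suc 1..<k]" using assms by (simp add: upt_conv_Cons)
  show ?thesis
  proof (intro exI conjI)
    show "mprod A (map (gs e') [Suc 1..<k]) \<in> carrier A" by (intro mprod_closed) auto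
    show "Rw e' k = gs e' 1 \<otimes> mprod A (map (gs e') [Suc 1..<k])" unfolding Rw_def l by simp
    show "x \<otimes> mprod A (map (gs e') [Suc 1..<k]) = mprod A (map (gs e') [Suc 1..<k]) \<otimes> x"
      by (rule commute_mprod) (auto intro!: x_gs)
  qed
qed

text \<open>For \<open>J = 0\<close> the power of \<open>x\<close> absorbs \<open>y\<close>.
  Otherwise \<open>y\<close> passes \<open>u\<close> and meets \<open>gs e 1\<close>. Once the signs
  around the power of \<open>x\<close> are adapted to \<open>f\<close>,
  \<open>commute_JM2_variant\<close> carries \<open>y\<close> to the right, where it passes
  \<open>r\<close> and acts on \<open>s\<close>.\<close>

lemma x_stab_aux:
  assumes y: "y = (if f then x else inv x)"
  shows "y \<in> stab V"
proof (rule stab_lin_spanI[OF G_closed])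
  have ycl [simp]: "y \<in> carrier A" by (simp add: y)
  have y_pow: "\<exists>a'. y \<otimes> x [^] a = x [^] (a'::int)" "y \<otimes> x [^] a = x [^] a \<otimes> y" for a :: int
    unfolding y using Units_int_pow_Suc[of x a]
    by (auto intro: exI[of _ "a + 1"] exI[of _ "a - 1"] commute_int_pow)
  show "y \<in> carrier A" by simp
  fix v assume "v \<in> G"
  then obtain J a b s where v: "v = W e e' k J a b \<otimes> s" "J < k" "a \<in> E" "b \<in> {0..int d - 1}" "s \<in> P"
    by (rule G_cases)
  have s: "s \<in> carrier A" by (rule P_closed[OF v(5)])
  show "y \<otimes> v \<in> V"
  proof (cases "J = 0")
    case True
    obtain a' :: int where "y \<otimes> x [^] a = x [^] a'" using y_pow(1)[of a] by blast
    then have "y \<otimes> v = W e e' k 0 a' b \<otimes> s"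
      unfolding v(1) W_def True using s by (simp add: m_assoc[symmetric])
    then show ?thesis using W_mem v True by simp
  next
    case False
    then have k2: "2 \<le> k" and k1: "1 \<in> {1..<n}" using v(2) k by auto
    obtain u where u: "u \<in> stab V" "Lw e J = u \<otimes> gs e 1" "y \<otimes> u = u \<otimes> y"
      using Lw_decompose[of J y f] False v(2) y by auto
    have ucl: "u \<in> carrier A" by (rule stab_closed[OF u(1)])
    obtain r where r: "r \<in> carrier A" "Rw e' k = gs e' 1 \<otimes> r" "x \<otimes> r = r \<otimes> x"
      using Rw_decompose[OF k2] by blast
    have yr: "y \<otimes> r = r \<otimes> y" using r by (auto simp: y intro: commute_inv[symmetric])
    have xr: "x [^] a \<otimes> r = r \<otimes> x [^] a" for a :: int
      using r by (intro commute_int_pow[symmetric]) auto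
    have xP': "x [^] a \<in> stab P" for a :: int using stab_int_pow[OF P _ xP[OF k2]] by simp
    have yP: "y \<in> stab P" using xP[OF k2] by (simp add: y)
    \<comment> \<open>These corrections are built from \<open>t 1\<close> and \<open>t 2\<close>, so
      they commute with \<open>x\<close>, and with \<open>g 1\<close> by \<open>g_c_same\<close>.
      They can therefore be drawn to the front, where \<open>V\<close> is stable under them.\<close>
    have cs1: "\<delta> \<in> stab V" "\<delta> \<in> carrier A" "x \<otimes> \<delta> = \<delta> \<otimes> x" "y \<otimes> \<delta> = \<delta> \<otimes> y"
      "x [^] a \<otimes> \<delta> = \<delta> \<otimes> x [^] a" "gs h 1 \<otimes> \<delta> = \<delta> \<otimes> gs h 1"
      if "\<delta> \<in> cs 1" for \<delta> h and a :: int
    proof -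
      show \<delta>: "\<delta> \<in> stab V" "\<delta> \<in> carrier A" using cs_stab_V[OF _ _ that] cs_closed[OF that] k2 by auto
      show x\<delta>: "x \<otimes> \<delta> = \<delta> \<otimes> x" by (intro commute_cs[OF _ _ that] commute_c) (auto simp: x_t)
      then show "y \<otimes> \<delta> = \<delta> \<otimes> y" using \<delta> by (auto simp: y intro: commute_inv[symmetric])
      show "x [^] a \<otimes> \<delta> = \<delta> \<otimes> x [^] a" using \<delta> x\<delta> by (intro commute_int_pow[symmetric]) auto
      have "g 1 \<otimes> \<delta> = \<delta> \<otimes> g 1" by (intro commute_cs[OF _ _ that] g_c_same k1) auto
      then show "gs h 1 \<otimes> \<delta> = \<delta> \<otimes> gs h 1" using \<delta> by (intro commute_gs[symmetric]) auto
    qed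
    have xRw: "x [^] a \<otimes> gs e' 1 \<otimes> r \<otimes> p \<in> V" if "p \<in> P" for a :: int and p
    proof -
      have "W e e' k 0 a 0 \<otimes> p \<in> V" using W_mem[of 0 0 p a] k d_pos that by auto
      then show ?thesis unfolding W_def using r P_closed[OF that] by (simp add: m_assoc)
    qed
    \<comment> \<open>The word with \<open>J\<close>, \<open>a\<close> and \<open>b\<close> zero,
      from which the leading factor \<open>gs e' 1\<close> is cancelled.\<close>
    have rP: "r \<otimes> p \<in> V" if "p \<in> P" for p
      using xRw[OF that, of 0] r P_closed[OF that] k2
      by (intro gs_cancel_mem[of 1 "r \<otimes> p" e']) (auto simp: m_assoc)
    \<comment> \<open>Three changes of sign: the first adapts the left factor to \<open>f\<close>,
      the second the right factor to the opposite of \<open>f\<close>, and the third returns from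
      \<open>f\<close> to the sign \<open>e'\<close> of the given words.\<close>
    obtain \<delta> where \<delta>: "\<delta> \<in> cs 1" "gs e 1 = gs f 1 \<oplus> \<delta>" using gs_change_sign[OF k1] .
    obtain \<delta>' where \<delta>': "\<delta>' \<in> cs 1" "gs e' 1 = gs (\<not> f) 1 \<oplus> \<delta>'" using gs_change_sign[OF k1] .
    obtain \<delta>'' where \<delta>'': "\<delta>'' \<in> cs 1" "gs f 1 = gs e' 1 \<oplus> \<delta>''" using gs_change_sign[OF k1] .
    note cl = cs1(2)[OF \<delta>(1)] cs1(2)[OF \<delta>'(1)] cs1(2)[OF \<delta>''(1)] r(1) s
    have ys: "y \<otimes> s \<in> P" "x [^] a \<otimes> s \<in> P" for a :: int
      using stabD[OF yP v(5)] stabD[OF xP' v(5)] by auto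
    have fr: "x [^] a \<otimes> gs f 1 \<otimes> r \<otimes> p \<in> V" if p: "p \<in> P" for a :: int and p
    proof -
      note pc = P_closed[OF p]
      have "x [^] a \<otimes> gs f 1 \<otimes> r \<otimes> p = x [^] a \<otimes> gs e' 1 \<otimes> r \<otimes> p \<oplus> (x [^] a \<otimes> \<delta>'') \<otimes> r \<otimes> p"
        unfolding \<delta>''(2) using cl pc by (simp add: m_assoc r_distr l_distr)
      also have "(x [^] a \<otimes> \<delta>'') \<otimes> r \<otimes> p = \<delta>'' \<otimes> (x [^] a \<otimes> r) \<otimes> p"
        unfolding cs1(5)[OF \<delta>''(1)] using cl pc by (simp add: m_assoc)
      also have "\<dots> = \<delta>'' \<otimes> (r \<otimes> (x [^] a \<otimes> p))"
        unfolding xr using cl pc by (simp add: m_assoc)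
      finally show ?thesis
        using xRw[OF p] stabD[OF cs1(1)[OF \<delta>''(1)] rP[OF stabD[OF xP' p]]]
        by (simp add: submodD(3)[OF V])
    qed
    \<comment> \<open>Three summands result: the transported term, in which \<open>y\<close> acts on
      \<open>s\<close>, and one correction for each of the two adapted signs.\<close>
    have main: "y \<otimes> gs e 1 \<otimes> x [^] a \<otimes> gs e' 1 \<otimes> r \<otimes> s \<in> V"
    proof -
      obtain a' :: int where a': "y \<otimes> x [^] a = x [^] a'" using y_pow(1)[of a] by blast
      have "y \<otimes> gs e 1 \<otimes> x [^] a \<otimes> gs e' 1 \<otimes> r \<otimes> s =
          y \<otimes> gs f 1 \<otimes> x [^] a \<otimes> gs e' 1 \<otimes> r \<otimes> s \<oplus> (y \<otimes> \<delta>) \<otimes> x [^] a \<otimes> gs e' 1 \<otimes> r \<otimes> s"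
        unfolding \<delta>(2) using cl by (simp add: m_assoc r_distr l_distr)
      also have "(y \<otimes> \<delta>) \<otimes> x [^] a \<otimes> gs e' 1 \<otimes> r \<otimes> s = \<delta> \<otimes> ((y \<otimes> x [^] a) \<otimes> gs e' 1 \<otimes> r \<otimes> s)"
        unfolding cs1(4)[OF \<delta>(1)] using cl by (simp add: m_assoc)
      also have "y \<otimes> gs f 1 \<otimes> x [^] a \<otimes> gs e' 1 \<otimes> r \<otimes> s =
          (y \<otimes> gs f 1 \<otimes> x [^] a \<otimes> gs (\<not> f) 1) \<otimes> r \<otimes> s \<oplus> y \<otimes> gs f 1 \<otimes> (x [^] a \<otimes> \<delta>') \<otimes> r \<otimes> s"
        unfolding \<delta>'(2) using cl by (simp add: m_assoc r_distr l_distr)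
      also have "(y \<otimes> gs f 1 \<otimes> x [^] a \<otimes> gs (\<not> f) 1) \<otimes> r \<otimes> s =
          gs (\<not> f) 1 \<otimes> x [^] a \<otimes> gs f 1 \<otimes> (y \<otimes> r) \<otimes> s"
        using commute_JM2_variant[OF _ y] k1 cl by (simp add: m_assoc)
      also have "\<dots> = gs (\<not> f) 1 \<otimes> (x [^] a \<otimes> gs f 1 \<otimes> r \<otimes> (y \<otimes> s))"
        unfolding yr using cl by (simp add: m_assoc)
      also have "y \<otimes> gs f 1 \<otimes> (x [^] a \<otimes> \<delta>') \<otimes> r \<otimes> s = y \<otimes> (gs f 1 \<otimes> \<delta>') \<otimes> (x [^] a \<otimes> r) \<otimes> s"
        unfolding cs1(5)[OF \<delta>'(1)] using cl by (simp add: m_assoc)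
      also have "\<dots> = (y \<otimes> \<delta>') \<otimes> gs f 1 \<otimes> r \<otimes> (x [^] a \<otimes> s)"
        unfolding cs1(6)[OF \<delta>'(1)] xr using cl by (simp add: m_assoc)
      also have "\<dots> = \<delta>' \<otimes> (y \<otimes> gs f 1 \<otimes> r \<otimes> (x [^] a \<otimes> s))"
        unfolding cs1(4)[OF \<delta>'(1)] using cl by (simp add: m_assoc)
      finally have eq: "y \<otimes> gs e 1 \<otimes> x [^] a \<otimes> gs e' 1 \<otimes> r \<otimes> s =
          gs (\<not> f) 1 \<otimes> (x [^] a \<otimes> gs f 1 \<otimes> r \<otimes> (y \<otimes> s)) \<oplus>
          \<delta>' \<otimes> (y \<otimes> gs f 1 \<otimes> r \<otimes> (x [^] a \<otimes> s)) \<oplus>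
          \<delta> \<otimes> ((y \<otimes> x [^] a) \<otimes> gs e' 1 \<otimes> r \<otimes> s)" .
      have yx: "y = x [^] (if f then 1 else - 1 :: int)" by (simp add: y Units_int_pow)
      have "gs (\<not> f) 1 \<otimes> (x [^] a \<otimes> gs f 1 \<otimes> r \<otimes> (y \<otimes> s)) \<in> V"
        using k2 by (intro stabD[OF gs_stab] fr ys) auto
      moreover have "\<delta>' \<otimes> (y \<otimes> gs f 1 \<otimes> r \<otimes> (x [^] a \<otimes> s)) \<in> V"
        unfolding yx by (intro stabD[OF cs1(1)[OF \<delta>'(1)]] fr ys)
      moreover have "\<delta> \<otimes> ((y \<otimes> x [^] a) \<otimes> gs e' 1 \<otimes> r \<otimes> s) \<in> V"
        unfolding a' by (intro stabD[OF cs1(1)[OF \<delta>(1)]] xRw v(5))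
      ultimately show ?thesis unfolding eq by (intro submodD(3)[OF V])
    qed
    \<comment> \<open>Moved to the left across \<open>gs e 1\<close>, the power of
      \<open>t 1\<close> becomes one of \<open>t 2\<close>. It then also passes \<open>y\<close> and
      acts on \<open>V\<close> from the left, which leaves the expression of
      \<open>main\<close>.\<close>
    have tb: "t 2 [^] b \<in> stab V"
      using v(4) stab_nat_pow[OF V t_stab[of 2], of "nat b"] k2 by (simp add: pow_nat)
    have gt: "gs e 1 \<otimes> t 1 [^] b = t 2 [^] b \<otimes> gs e 1"
    proof -
      have "gs e 1 \<otimes> t 1 = t 2 \<otimes> gs e 1" using t_gs[OF k1, of 2 e] by (simp add: numeral_2_eq_2)
      then have "gs e 1 \<otimes> t 1 [^] nat b = t 2 [^] nat b \<otimes> gs e 1"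
        by (intro intertwine_nat_pow) auto
      then show ?thesis using v(4) by (simp add: pow_nat)
    qed
    have yt: "y \<otimes> t 2 [^] b = t 2 [^] b \<otimes> y"
      by (rule commute_int_pow) (auto simp: y x_t intro: commute_inv[symmetric])
    have "y \<otimes> v = (y \<otimes> u) \<otimes> gs e 1 \<otimes> (x [^] a \<otimes> t 1 [^] b) \<otimes> gs e' 1 \<otimes> r \<otimes> s"
      unfolding v(1) W_def u(2) r(2) using cl ucl by (simp add: m_assoc)
    also have "\<dots> = u \<otimes> (y \<otimes> (gs e 1 \<otimes> t 1 [^] b) \<otimes> x [^] a \<otimes> gs e' 1 \<otimes> r \<otimes> s)"
      unfolding u(3) x_pow_t using cl ucl by (simp add: m_assoc)
    also have "\<dots> = u \<otimes> ((y \<otimes> t 2 [^] b) \<otimes> gs e 1 \<otimes> x [^] a \<otimes> gs e' 1 \<otimes> r \<otimes> s)"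
      unfolding gt using cl ucl by (simp add: m_assoc)
    also have "\<dots> = u \<otimes> (t 2 [^] b \<otimes> (y \<otimes> gs e 1 \<otimes> x [^] a \<otimes> gs e' 1 \<otimes> r \<otimes> s))"
      unfolding yt using cl ucl by (simp add: m_assoc)
    also have "\<dots> \<in> V" by (intro stabD[OF u(1)] stabD[OF tb] main)
    finally show ?thesis .
  qed
qed

lemma x_stab: "x \<in> stab V" "inv x \<in> stab V"
  using x_stab_aux[of x True] x_stab_aux[of "inv x" False] by simp_all

end

section \<open>Iterating the induction step\<close>

context affine_yokonuma
begin

fun Ind :: "bool \<Rightarrow> bool \<Rightarrow> nat \<Rightarrow> 'b set" where
  "Ind e e' 0 = {\<one>}"
| "Ind e e' (Suc k) = {W e e' (Suc k) J a b \<otimes> s | J a b s.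
     J < Suc k \<and> a \<in> E \<and> b \<in> {0..int d - 1} \<and> s \<in> Ind e e' k}"

lemma Ind_closed: "Ind e e' k \<subseteq> carrier A"
  by (induction k) auto

lemma Ind_stab:
  assumes "k \<le> n"
  shows "\<one> \<in> sp (Ind e e' k) \<and> (\<forall>j. 1 \<le> j \<and> j \<le> k \<longrightarrow> t j \<in> stab (sp (Ind e e' k))) \<and>
    (\<forall>i. 1 \<le> i \<and> i < k \<longrightarrow> g i \<in> stab (sp (Ind e e' k))) \<and>
    (1 \<le> k \<longrightarrow> x \<in> stab (sp (Ind e e' k)) \<and> inv x \<in> stab (sp (Ind e e' k)))"
  using assms
proof (induction k)
  case 0
  then show ?case using lin_span_base[of \<one> "{\<one>}"] by auto
next
  case (Suc k)
  \<comment> \<open>For \<open>k = 0\<close> the preceding span is that of the unit alone; stability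
    under \<open>x\<close> is demanded only from the next stage on.\<close>
  interpret I: induction_step A R d n t g x z E e e' "Suc k" "sp (Ind e e' k)"
    by unfold_locales (use Suc submod_lin_span[OF Ind_closed] in auto)
  \<comment> \<open>The right factor in \<open>I.G\<close> comes from the span of the preceding set
    and not from the set itself; by linearity the spans agree.\<close>
  have "sp (Ind e e' (Suc k)) = I.V"
  proof
    have "Ind e e' (Suc k) \<subseteq> I.G"
      unfolding I.G_def Ind.simps using lin_span_base[OF _ Ind_closed] by blast
    then show "sp (Ind e e' (Suc k)) \<subseteq> I.V"
      using lin_span_base[OF _ I.G_closed] by (intro lin_span_mono I.G_closed) blast
    have "v \<in> sp (Ind e e' (Suc k))" if vG: "v \<in> I.G" for v
    proof -
      obtain J a b s where v: "v = W e e' (Suc k) J a b \<otimes> s" "J < Suc k" "a \<in> E"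
        "b \<in> {0..int d - 1}" "s \<in> sp (Ind e e' k)"
        using I.G_cases[OF vG] by metis
      show ?thesis
        unfolding v(1)
      proof (rule lin_span_mult_left[OF submod_lin_span[OF Ind_closed] _ Ind_closed _ v(5)])
        fix s assume "s \<in> Ind e e' k"
        then have "W e e' (Suc k) J a b \<otimes> s \<in> Ind e e' (Suc k)" using v by auto
        then show "W e e' (Suc k) J a b \<otimes> s \<in> sp (Ind e e' (Suc k))"
          by (rule lin_span_base[OF _ Ind_closed])
      qed simp
    qed
    then show "I.V \<subseteq> sp (Ind e e' (Suc k))"
      by (intro lin_span_mono Ind_closed) blast
  qed
  then show ?case
    using I.one_mem I.t_stab I.g_stab I.x_stab Suc by simp
qed

lemma lin_span_Ind: "sp (Ind e e' n) = carrier A"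
proof
  note V = submod_lin_span[OF Ind_closed[of e e' n]]
  note s = Ind_stab[of n e e']
  show "sp (Ind e e' n) \<subseteq> carrier A" by (rule lin_span_closed[OF Ind_closed])
  show "carrier A \<subseteq> sp (Ind e e' n)"
  proof (rule generated[OF V])
    show "t j \<in> stab (sp (Ind e e' n))" for j
      using s stab_one[OF V] t_outside[of j] by (cases "j \<in> {1..n}") auto
    show "g i \<in> stab (sp (Ind e e' n))" for i
      using s stab_one[OF V] g_outside[of i] by (cases "i \<in> {1..<n}") auto
  qed (use s n_pos in auto)
qed

lemma Ind_eq_products:
  "Ind e e' k = {mprod A (map (\<lambda>i. W e e' i (J i) (a i) (b i)) (rev [1..<k + 1])) | J a b.
    \<forall>i\<in>{1..k}. J i \<in> {0..i - 1} \<and> a i \<in> E \<and> b i \<in> {0..int d - 1}}" (is "_ = ?Q k")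
proof (induction k)
  case (Suc k)
  let ?m = "\<lambda>k J a b. mprod A (map (\<lambda>i. W e e' i (J i) (a i) (b i)) (rev [1..<k + 1]))"
  have m_Suc: "?m (Suc k) J a b = W e e' (Suc k) (J (Suc k)) (a (Suc k)) (b (Suc k)) \<otimes> ?m k J a b"
    for J a b by simp
  show ?case
  proof (intro equalityI subsetI)
    fix v assume "v \<in> Ind e e' (Suc k)"
    then obtain J0 a0 b0 s where v: "v = W e e' (Suc k) J0 a0 b0 \<otimes> s" "J0 < Suc k" "a0 \<in> E"
      "b0 \<in> {0..int d - 1}" "s \<in> ?Q k"
      unfolding Ind.simps Suc by blast
    then obtain J a b where s: "s = ?m k J a b"
      "\<forall>i\<in>{1..k}. J i \<in> {0..i - 1} \<and> a i \<in> E \<and> b i \<in> {0..int d - 1}"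
      by blast
    let ?J = "J(Suc k := J0)" and ?a = "a(Suc k := a0)" and ?b = "b(Suc k := b0)"
    have "?m k ?J ?a ?b = ?m k J a b"
      by (intro arg_cong[of _ _ "mprod A"] map_cong) auto
    then have "v = ?m (Suc k) ?J ?a ?b" unfolding m_Suc v(1) s(1) by simp
    moreover have "\<forall>i\<in>{1..Suc k}. ?J i \<in> {0..i - 1} \<and> ?a i \<in> E \<and> ?b i \<in> {0..int d - 1}"
      using s(2) v by auto
    ultimately show "v \<in> ?Q (Suc k)" by blast
  next
    fix v assume "v \<in> ?Q (Suc k)"
    then obtain J a b where s: "v = ?m (Suc k) J a b"
      "\<forall>i\<in>{1..Suc k}. J i \<in> {0..i - 1} \<and> a i \<in> E \<and> b i \<in> {0..int d - 1}"
      by blast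
    have "?m k J a b \<in> ?Q k"
      by (intro CollectI exI conjI refl) (use s(2) in auto)
    then have "?m k J a b \<in> Ind e e' k" using Suc by simp
    moreover have "J (Suc k) < Suc k" "a (Suc k) \<in> E" "b (Suc k) \<in> {0..int d - 1}"
      using s(2) by (auto simp: less_Suc_eq_le dest: bspec[of _ _ "Suc k"])
    ultimately show "v \<in> Ind e e' (Suc k)"
      unfolding s(1) m_Suc Ind.simps by blast
  qed
qed simp

end

section \<open>Reducing powers of \<open>x\<close> by a product of linear factors\<close>

context assoc_algebra
begin

abbreviation lowpow :: "'b \<Rightarrow> nat \<Rightarrow> 'b set" where
  "lowpow x j \<equiv> (\<lambda>e::int. x [^] e) ` {0..<int j}"

text \<open>The monic form of the product yields \<open>x\<^sup>k\<close>; the invertibility of its constant term yields \<open>x\<^sup>-\<^sup>1\<close>.\<close>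

lemma cyclotomic_span:
  assumes x: "x \<in> Units A" and vs: "set vs \<subseteq> Units R" "vs \<noteq> []"
    and zero: "mprod A (map (\<lambda>v. x \<ominus> v \<odot> \<one>) vs) = \<zero>"
  shows "x [^] (a::int) \<in> sp (lowpow x (length vs))"
proof -
  have pcl [simp]: "x [^] (e::int) \<in> carrier A" for e by (intro Units_closed Units_int_pow x)
  have xcl [simp]: "x \<in> carrier A" using x by auto
  have lc: "lowpow x j \<subseteq> carrier A" for j by auto
  note sub = submodD[OF submod_lin_span[OF lc]]
  have pow: "x [^] e \<in> sp (lowpow x j)" if "0 \<le> e" "e < int j" for e j
    by (rule lin_span_base[OF _ lc]) (use that in auto)
  have mono: "u \<in> sp (lowpow x (Suc j))" if "u \<in> sp (lowpow x j)" for u j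
  proof -
    have "sp (lowpow x j) \<subseteq> sp (lowpow x (Suc j))"
      by (rule lin_span_mono[OF _ lc]) (auto intro!: pow simp del: of_nat_Suc)
    then show ?thesis using that by blast
  qed
  have shift: "x \<otimes> u \<in> sp (lowpow x (Suc j))" if "u \<in> sp (lowpow x j)" for u j
  proof (rule lin_span_mult_left[OF submod_lin_span[OF lc] xcl lc _ that])
    fix s assume "s \<in> lowpow x j"
    then obtain e where "s = x [^] e" "0 \<le> e" "e < int j" by auto
    then show "x \<otimes> s \<in> sp (lowpow x (Suc j))"
      using pow[of "e + 1" "Suc j"] Units_int_pow_Suc(1)[OF x, of e] by simp
  qed
  let ?P = "\<lambda>vs. mprod A (map (\<lambda>v. x \<ominus> v \<odot> \<one>) vs)"
  \<comment> \<open>Two forms of the product are carried along: leading power plus lower terms, and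
    constant term plus a multiple of \<open>x\<close>. The induction is over arbitrary lists of
    units, because the product vanishes only for the given one.\<close>
  have low: "(\<exists>u\<in>sp (lowpow x (length vs)). ?P vs = x [^] int (length vs) \<oplus> u) \<and>
      (\<exists>w\<in>Units R. \<exists>u\<in>sp (lowpow x (length vs)). ?P vs = w \<odot> \<one> \<oplus> x \<otimes> u)"
    if "set vs \<subseteq> Units R" for vs
    using that
  proof (induction vs)
    case Nil
    show ?case using sub(2)[of 0] by (intro conjI bexI[of _ \<zero>] bexI[of _ "\<one>\<^bsub>R\<^esub>"]) auto
  next
    case (Cons v vs)
    let ?j = "length vs"
    have v: "v \<in> Units R" "v \<in> carrier R" using Cons.prems by auto
    obtain u where u: "u \<in> sp (lowpow x ?j)" "?P vs = x [^] int ?j \<oplus> u" using Cons by auto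
    obtain w u' where u': "w \<in> Units R" "u' \<in> sp (lowpow x ?j)" "?P vs = w \<odot> \<one> \<oplus> x \<otimes> u'"
      using Cons by auto
    note cl = sub(1)[OF u(1)] sub(1)[OF u'(2)] v(2) R.Units_closed[OF u'(1)]
    have "?P (v # vs) = (x \<ominus> v \<odot> \<one>) \<otimes> (x [^] int ?j \<oplus> u)" by (simp add: u)
    also have "\<dots> = x [^] int (length (v # vs)) \<oplus>
        (x \<otimes> u \<oplus> (\<ominus> (v \<odot> x [^] int ?j) \<oplus> \<ominus> (v \<odot> u)))"
      using cl Units_int_pow_Suc(1)[OF x, of "int ?j"]
      by (simp add: a_minus_def l_distr r_distr l_minus smult_mult_left a_ac add.commute)
    finally have 1: "?P (v # vs) = x [^] int (length (v # vs)) \<oplus>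
        (x \<otimes> u \<oplus> (\<ominus> (v \<odot> x [^] int ?j) \<oplus> \<ominus> (v \<odot> u)))" .
    have 2: "x \<otimes> u \<oplus> (\<ominus> (v \<odot> x [^] int ?j) \<oplus> \<ominus> (v \<odot> u)) \<in> sp (lowpow x (length (v # vs)))"
      unfolding list.size add_0_right add_Suc_right
      by (intro sub(3,6,5) shift mono pow u v) auto
    have vw: "v \<odot> (w \<odot> \<one>) = w \<odot> (v \<odot> \<one>)"
      using cl by (simp add: smult_assoc1[symmetric] R.m_comm)
    have "?P (v # vs) = (x \<ominus> v \<odot> \<one>) \<otimes> (w \<odot> \<one> \<oplus> x \<otimes> u')" by (simp add: u')
    also have "\<dots> = (\<ominus>\<^bsub>R\<^esub> (v \<otimes>\<^bsub>R\<^esub> w)) \<odot> \<one> \<oplus>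
        x \<otimes> (w \<odot> \<one> \<oplus> (x \<otimes> u' \<oplus> \<ominus> (v \<odot> u')))"
      using cl by (simp add: a_minus_def l_distr r_distr l_minus r_minus smult_mult_left
          smult_mult_right smult_l_minus smult_r_minus smult_r_distr smult_assoc1 a_ac vw)
    finally have 3: "?P (v # vs) = (\<ominus>\<^bsub>R\<^esub> (v \<otimes>\<^bsub>R\<^esub> w)) \<odot> \<one> \<oplus>
        x \<otimes> (w \<odot> \<one> \<oplus> (x \<otimes> u' \<oplus> \<ominus> (v \<odot> u')))" .
    have one: "\<one> \<in> sp (lowpow x (Suc ?j))" using pow[of 0 "Suc ?j"] by simp
    have 4: "w \<odot> \<one> \<oplus> (x \<otimes> u' \<oplus> \<ominus> (v \<odot> u')) \<in> sp (lowpow x (length (v # vs)))"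
      unfolding list.size add_0_right add_Suc_right using cl
      by (intro one sub(3,6,5) shift mono[OF u'(2)] u'(2) v) auto
    \<comment> \<open>Each factor multiplies the constant term by \<open>-v\<close>, so it remains a
      unit.\<close>
    have 5: "\<ominus>\<^bsub>R\<^esub> (v \<otimes>\<^bsub>R\<^esub> w) \<in> Units R"
    proof -
      have "v \<otimes>\<^bsub>R\<^esub> w \<in> Units R" using v u' by auto
      moreover have "(\<ominus>\<^bsub>R\<^esub> a) \<otimes>\<^bsub>R\<^esub> (\<ominus>\<^bsub>R\<^esub> b) = a \<otimes>\<^bsub>R\<^esub> b" if "a \<in> carrier R" "b \<in> carrier R" for a b
        using that by (simp add: R.l_minus R.r_minus)
      ultimately show ?thesis
        unfolding Units_def[of R] by (smt (verit) R.add.inv_closed mem_Collect_eq)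
    qed
    show ?case using 1 2 3 4 5 by blast
  qed
  define k where "k = length vs"
  have k: "0 < k" using vs by (simp add: k_def)
  let ?U = "sp (lowpow x k)"
  note U = submod_lin_span[OF lc[of k]]
  have one: "\<one> \<in> ?U" using pow[of 0 k] k by simp
  obtain u where u: "u \<in> ?U" "\<zero> = x [^] int k \<oplus> u" using low[OF vs(1)] zero by (auto simp: k_def)
  have "x [^] int k = \<ominus> u"
    using u sub(1)[OF u(1)] by (metis minus_equality pcl)
  then have xk: "x [^] int k \<in> ?U" using sub(6)[OF u(1)] by simp
  obtain w u' where u': "w \<in> Units R" "u' \<in> ?U" "\<zero> = w \<odot> \<one> \<oplus> x \<otimes> u'"
    using low[OF vs(1)] zero by (auto simp: k_def)
  note cl = sub(1)[OF u'(2)] R.Units_closed[OF u'(1)] R.Units_inv_closed[OF u'(1)]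
  have "\<zero> = inv x \<otimes> (w \<odot> \<one> \<oplus> x \<otimes> u')" unfolding u'(3)[symmetric] using x by simp
  also have "\<dots> = w \<odot> inv x \<oplus> u'"
    using x cl by (simp add: r_distr smult_mult_right Units_cancel_left)
  finally have "w \<odot> inv x = \<ominus> u'" using cl x by (metis Units_inv_closed minus_equality smult_closed)
  then have "inv\<^bsub>R\<^esub> w \<odot> (w \<odot> inv x) \<in> ?U" using sub(5,6) u' cl by auto
  then have invx: "inv x \<in> ?U" using u' x cl by (simp add: smult_assoc1[symmetric])
  \<comment> \<open>A shift leaves the range of exponents only at its ends, where \<open>xk\<close>
    and \<open>invx\<close> apply.\<close>
  have st: "x \<in> stab ?U" "inv x \<in> stab ?U"
  proof -
    show "x \<in> stab ?U"
    proof (rule stab_lin_spanI[OF lc xcl])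
      fix s assume "s \<in> lowpow x k"
      then obtain e where e: "s = x [^] e" "0 \<le> e" "e < int k" by auto
      then show "x \<otimes> s \<in> ?U"
        using pow[of "e + 1" k] xk Units_int_pow_Suc(1)[OF x, of e] by (cases "e + 1 = int k") auto
    qed
    show "inv x \<in> stab ?U"
    proof (rule stab_lin_spanI[OF lc])
      fix s assume "s \<in> lowpow x k"
      then obtain e where e: "s = x [^] e" "0 \<le> e" "e < int k" by auto
      then show "inv x \<otimes> s \<in> ?U"
        using pow[of "e - 1" k] invx Units_int_pow_Suc(2)[OF x, of e] x by (cases "e = 0") auto
    qed (use x in auto)
  qed
  from stabD[OF stab_int_pow[OF U x st] one] show ?thesis by (simp add: k_def)
qed

end

section \<open>The algebra \<open>Y(d, m, n)\<close>\<close>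

lemma poly_mapping_eq_sum_single:
  "f = (\<Sum>w\<in>Poly_Mapping.keys f. Poly_Mapping.single w (Poly_Mapping.lookup f w))"
  by (rule poly_mapping_eqI)
    (simp add: lookup_sum lookup_single when_def in_keys_iff sum.delta)

lemma indet_pow_mult: "indet_pow v a * indet_pow v b = indet_pow v (a + b)"
  by (simp add: indet_pow_def mult_single single_add)

lemma indet_pow_Units:
  assumes "v \<in> indets m"
  shows "indet_pow v a \<in> Units (coeff_ring m)"
proof -
  have "indet_pow v 0 = 1" by (simp add: indet_pow_def)
  then have "indet_pow v a * indet_pow v (- a) = 1" "indet_pow v (- a) * indet_pow v a = 1"
    by (simp_all add: indet_pow_mult)
  then show ?thesis using indet_pow_closed[OF assms] unfolding Units_def by auto
qed

text \<open>Scalars sit on the neutral word and the coefficients commute, so scalars are central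
  although words do not commute.\<close>

lemma single_0_mult_commute:
  fixes c :: "'a :: comm_semiring_0" and f :: "'b :: monoid_add \<Rightarrow>\<^sub>0 'a"
  shows "Poly_Mapping.single 0 c * f = f * Poly_Mapping.single 0 c"
proof -
  let ?s = "\<lambda>w. Poly_Mapping.single w (Poly_Mapping.lookup f w)"
  have "Poly_Mapping.single 0 c * (\<Sum>w\<in>Poly_Mapping.keys f. ?s w) = (\<Sum>w\<in>Poly_Mapping.keys f. ?s w) * Poly_Mapping.single 0 c"
    by (simp add: sum_distrib_left sum_distrib_right mult_single mult.commute)
  then show ?thesis by (simp only: poly_mapping_eq_sum_single[symmetric])
qed

section \<open>The quotient map and the relations in the presented algebra\<close>

locale yokonuma_parameters =
  fixes d n :: nat and m :: enat
  assumes d_pos: "0 < d" and n_pos: "0 < n" and m_pos: "0 < m"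
begin

abbreviation "F \<equiv> free_algebra m (gens n)"
lemmas F_closed = free_algebra_closed(1-8)
abbreviation "Y \<equiv> Yalg d m n"
abbreviation "q \<equiv> cls d m n"

lemma q_hom: "q \<in> ring_hom F Y"
proof -
  interpret I: ideal "rel_ideal d m n" F by (rule rel_ideal_ideal)
  have "q = (+>\<^bsub>F\<^esub>) (rel_ideal d m n)" by (auto simp: cls_def)
  then show ?thesis using I.rcos_ring_hom by (simp add: ring_hom_def Yalg_def Let_def)
qed

lemma q_surj: "carrier Y = q ` carrier F"
  by (auto simp: Yalg_def Let_def FactRing_def A_RCOSETS_def' cls_def)

lemma q_closed [simp, intro]: "f \<in> carrier F \<Longrightarrow> q f \<in> carrier Y"
  using q_surj by auto

lemma q_add: "f \<in> carrier F \<Longrightarrow> h \<in> carrier F \<Longrightarrow> q (f + h) = q f \<oplus>\<^bsub>Y\<^esub> q h"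
  using ring_hom_add[OF q_hom] by simp

lemma q_mult: "f \<in> carrier F \<Longrightarrow> h \<in> carrier F \<Longrightarrow> q (f * h) = q f \<otimes>\<^bsub>Y\<^esub> q h"
  using ring_hom_mult[OF q_hom] by simp

lemma q_one: "q 1 = \<one>\<^bsub>Y\<^esub>"
  using ring_hom_one[OF q_hom] by simp

lemma q_scal_mult: "c \<in> carrier (coeff_ring m) \<Longrightarrow> f \<in> carrier F \<Longrightarrow> q (scal c * f) = c \<odot>\<^bsub>Y\<^esub> q f"
proof -
  assume "c \<in> carrier (coeff_ring m)" "f \<in> carrier F"
  then have "q (scal c * f) = q (scal c) \<otimes>\<^bsub>Y\<^esub> q f" by (intro q_mult) auto
  then show ?thesis by (simp add: Yalg_def Let_def)
qed

sublocale Y: assoc_algebra Y "coeff_ring m"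
proof -
  interpret Y: Ring.ring Y by (rule Yalg_ring)
  interpret M: module "coeff_ring m" Y by (rule Yalg_module)
  show "assoc_algebra Y (coeff_ring m)"
  proof unfold_locales
    fix r u v assume r: "r \<in> carrier (coeff_ring m)" and uv: "u \<in> carrier Y" "v \<in> carrier Y"
    obtain f h where f: "u = q f" "f \<in> carrier F" and h: "v = q h" "h \<in> carrier F"
      using uv q_surj by auto
    show "(r \<odot>\<^bsub>Y\<^esub> u) \<otimes>\<^bsub>Y\<^esub> v = r \<odot>\<^bsub>Y\<^esub> (u \<otimes>\<^bsub>Y\<^esub> v)"
      using r f h by (simp add: q_scal_mult[symmetric] q_mult[symmetric] mult.assoc)
    have "f * (scal r * h) = (f * scal r) * h" by (simp only: mult.assoc)
    also have "f * scal r = scal r * f" unfolding scal_def by (rule single_0_mult_commute[symmetric])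
    finally have "f * (scal r * h) = scal r * (f * h)" by (simp only: mult.assoc)
    then show "u \<otimes>\<^bsub>Y\<^esub> (r \<odot>\<^bsub>Y\<^esub> v) = r \<odot>\<^bsub>Y\<^esub> (u \<otimes>\<^bsub>Y\<^esub> v)"
      using r f h by (simp add: q_scal_mult[symmetric] q_mult[symmetric])
  qed
qed

lemma q_zero: "q 0 = \<zero>\<^bsub>Y\<^esub>"
  using q_add[of 0 0] Y.add.l_cancel_one'[of "q 0" "q 0"] by simp

lemma q_minus: "f \<in> carrier F \<Longrightarrow> q (- f) = \<ominus>\<^bsub>Y\<^esub> q f"
  using q_add[of "- f" f] by (simp add: q_zero Y.minus_equality)

lemma q_diff: "f \<in> carrier F \<Longrightarrow> h \<in> carrier F \<Longrightarrow> q (f - h) = q f \<ominus>\<^bsub>Y\<^esub> q h"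
  using q_add[of f "- h"] by (simp add: q_minus a_minus_def)

lemma q_pow: "f \<in> carrier F \<Longrightarrow> q (f ^ k) = q f [^]\<^bsub>Y\<^esub> k"
  by (induction k) (auto simp: q_one q_mult power_commutes[symmetric] simp del: power.simps(2) simp: power_Suc2)

lemma F_sum_closed: "(\<And>s. s \<in> S \<Longrightarrow> f s \<in> carrier F) \<Longrightarrow> sum f S \<in> carrier F"
  by (induction S rule: infinite_finite_induct) auto

lemma q_sum: "finite S \<Longrightarrow> (\<And>s. s \<in> S \<Longrightarrow> f s \<in> carrier F) \<Longrightarrow>
    q (sum f S) = (\<Oplus>\<^bsub>Y\<^esub>s\<in>S. q (f s))"
  by (induction S rule: finite_induct) (auto simp: q_zero q_add F_sum_closed Pi_def)

lemma q_scal: "c \<in> carrier (coeff_ring m) \<Longrightarrow> q (scal c) = c \<odot>\<^bsub>Y\<^esub> \<one>\<^bsub>Y\<^esub>"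
  using q_scal_mult[of c 1] by (simp add: q_one)

lemma q_relator: "r \<in> relators d m n \<Longrightarrow> q r = \<zero>\<^bsub>Y\<^esub>"
proof -
  assume r: "r \<in> relators d m n"
  interpret F: Ring.ring F by (rule free_algebra_ring)
  interpret I: ideal "rel_ideal d m n" F by (rule rel_ideal_ideal)
  have "r \<in> rel_ideal d m n"
    using r F.genideal_self[OF relators_closed] by (auto simp: rel_ideal_def)
  then have "q r = rel_ideal d m n" by (simp add: cls_def I.a_rcos_const)
  then show ?thesis by (simp add: Yalg_def Let_def FactRing_def)
qed

lemma q_eqI:
  assumes "f - h \<in> relators d m n" "f \<in> carrier F" "h \<in> carrier F"
  shows "q f = q h"
proof -
  have "q f = q ((f - h) + h)" by simp
  also have "\<dots> = q (f - h) \<oplus>\<^bsub>Y\<^esub> q h" using assms by (intro q_add) auto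
  finally show ?thesis using q_relator[OF assms(1)] assms by simp
qed

abbreviation "qX \<equiv> q (letter Gen_X)"
abbreviation "qXi \<equiv> q (letter Gen_X_inv)"
abbreviation "qt j \<equiv> q (letter (Gen_t j))"
abbreviation "qg i \<equiv> q (letter (Gen_g i))"

lemma letter_closed [simp]:
  "letter Gen_X \<in> carrier F" "letter Gen_X_inv \<in> carrier F"
  "j \<in> {1..n} \<Longrightarrow> letter (Gen_t j) \<in> carrier F" "i \<in> {1..<n} \<Longrightarrow> letter (Gen_g i) \<in> carrier F"
  by (auto intro!: free_algebra_closed(9) simp: gens_def)

lemma qX_inverse: "qX \<otimes>\<^bsub>Y\<^esub> qXi = \<one>\<^bsub>Y\<^esub>" "qXi \<otimes>\<^bsub>Y\<^esub> qX = \<one>\<^bsub>Y\<^esub>"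
  using q_eqI[OF relators.X_inv_right] q_eqI[OF relators.X_inv_left]
  by (simp_all add: q_mult q_one F_closed)

lemma qX_Units: "qX \<in> Units Y"
  unfolding Units_def using qX_inverse q_closed[OF letter_closed(1)] q_closed[OF letter_closed(2)] by blast

lemma inv_qX: "inv\<^bsub>Y\<^esub> qX = qXi"
  using Y.inv_unique[OF Y.Units_l_inv[OF qX_Units] qX_inverse(1)] qX_Units by auto

definition tt :: "nat \<Rightarrow> gen free_alg set" where
  "tt j = (if j \<in> {1..n} then qt j else \<one>\<^bsub>Y\<^esub>)"

definition gg :: "nat \<Rightarrow> gen free_alg set" where
  "gg i = (if i \<in> {1..<n} then qg i else \<one>\<^bsub>Y\<^esub>)"

definition zz :: laurent where
  "zz = (indet_pow Ind_q 1 - indet_pow Ind_q (- 1)) * Poly_Mapping.single 0 (1 / of_nat d)"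

lemma q_diff_indet_closed: "indet_pow Ind_q 1 - indet_pow Ind_q (- 1) \<in> carrier (coeff_ring m)"
proof -
  have "Ind_q \<in> indets m" by (simp add: indets_def split: enat.split)
  then show ?thesis
    using coeff_ring_closed(3,4) indet_pow_closed by (metis diff_conv_add_uminus)
qed

lemma zz_closed: "zz \<in> carrier (coeff_ring m)"
  unfolding zz_def by (intro coeff_ring_closed q_diff_indet_closed coeff_ring_single_const)

lemma q_e:
  assumes i: "i \<in> {1..<n}"
  shows "q (scal (indet_pow Ind_q 1 - indet_pow Ind_q (- 1)) * e_elt d i) =
    zz \<odot>\<^bsub>Y\<^esub> (\<Oplus>\<^bsub>Y\<^esub>s\<in>{0..<d}. tt i [^]\<^bsub>Y\<^esub> s \<otimes>\<^bsub>Y\<^esub> tt (Suc i) [^]\<^bsub>Y\<^esub> (d - s))"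
proof -
  let ?f = "\<lambda>s. letter (Gen_t i) ^ s * letter (Gen_t (i + 1)) ^ (d - s)"
  have cl: "letter (Gen_t i) \<in> carrier F" "letter (Gen_t (i + 1)) \<in> carrier F" using i by auto
  have fcl: "?f s \<in> carrier F" for s using cl by (intro F_closed)
  have "scal (indet_pow Ind_q 1 - indet_pow Ind_q (- 1)) * e_elt d i = scal zz * (\<Sum>s\<in>{0..<d}. ?f s)"
  proof -
    have "{0..d - 1} = {0..<d}" using d_pos by auto
    then show ?thesis unfolding e_elt_def zz_def scal_simps(2) by (simp add: mult.assoc)
  qed
  then have "q (scal (indet_pow Ind_q 1 - indet_pow Ind_q (- 1)) * e_elt d i) =
      zz \<odot>\<^bsub>Y\<^esub> (\<Oplus>\<^bsub>Y\<^esub>s\<in>{0..<d}. q (?f s))"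
    using zz_closed fcl by (simp add: q_scal_mult F_sum_closed q_sum)
  also have "(\<Oplus>\<^bsub>Y\<^esub>s\<in>{0..<d}. q (?f s)) =
      (\<Oplus>\<^bsub>Y\<^esub>s\<in>{0..<d}. tt i [^]\<^bsub>Y\<^esub> s \<otimes>\<^bsub>Y\<^esub> tt (Suc i) [^]\<^bsub>Y\<^esub> (d - s))"
  proof (rule Y.finsum_cong')
    show "q (?f s) = tt i [^]\<^bsub>Y\<^esub> s \<otimes>\<^bsub>Y\<^esub> tt (Suc i) [^]\<^bsub>Y\<^esub> (d - s)" for s
      using i cl by (simp add: q_mult q_pow free_algebra_closed tt_def)
  qed (use i in \<open>auto simp: tt_def\<close>)
  finally show ?thesis .
qed

text \<open>The stabiliser of \<open>V\<close> is a subalgebra containing the images of all letters,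
  hence everything. Applied to the unit, which lies in \<open>V\<close>, this gives the
  claim.\<close>

lemma q_generated:
  assumes V: "Y.submod V" and one: "\<one>\<^bsub>Y\<^esub> \<in> V"
    and t: "\<And>j. tt j \<in> Y.stab V" and g: "\<And>i. gg i \<in> Y.stab V"
    and x: "qX \<in> Y.stab V" "inv\<^bsub>Y\<^esub> qX \<in> Y.stab V"
  shows "carrier Y \<subseteq> V"
proof -
  note S = Y.submod_stab[OF V]
  have letter_stab: "q (letter a) \<in> Y.stab V" if aG: "a \<in> gens n" for a
  proof -
    consider j where "a = Gen_t j" "j \<in> {1..n}" | i where "a = Gen_g i" "i \<in> {1..<n}"
      | "a = Gen_X" | "a = Gen_X_inv"
      using aG unfolding gens_def by blast
    then show ?thesis
    proof cases
      case 1 then show ?thesis using t[of j] by (simp add: tt_def)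
    next
      case 2 then show ?thesis using g[of i] by (simp add: gg_def)
    qed (use x inv_qX in auto)
  qed
  have word: "q (Poly_Mapping.single (Word ws) c) \<in> Y.stab V"
    if "set ws \<subseteq> gens n" "c \<in> carrier (coeff_ring m)" for ws c
    using that(1)
  proof (induction ws)
    case Nil
    have "(Poly_Mapping.single (Word []) c :: gen free_alg) = scal c" by (simp add: scal_def zero_free_word_def)
    then show ?case using that(2) Y.submodD(5)[OF S that(2) Y.stab_one[OF V]] by (simp add: q_scal)
  next
    case (Cons a ws)
    have "Poly_Mapping.single (Word (a # ws)) c = letter a * Poly_Mapping.single (Word ws) c"
      by (simp add: letter_def mult_single plus_free_word_def)
    moreover have "letter a \<in> carrier F" using Cons by (intro free_algebra_closed(9)) auto
    moreover have "Poly_Mapping.single (Word ws) c \<in> carrier F"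
      using Cons that(2) by (auto simp: free_algebra_carrier_iff lookup_single when_def)
    ultimately show ?case
      using Cons letter_stab by (simp add: q_mult Y.stab_mult[OF V])
  qed
  show ?thesis
  proof
    fix y assume "y \<in> carrier Y"
    then obtain f where f: "f \<in> carrier F" "y = q f" using q_surj by auto
    let ?s = "\<lambda>w. Poly_Mapping.single w (Poly_Mapping.lookup f w)"
    have cl: "?s w \<in> carrier F" if "w \<in> Poly_Mapping.keys f" for w
      using f(1) that by (auto simp: free_algebra_carrier_iff lookup_single when_def)
    have st: "q (?s w) \<in> Y.stab V" if "w \<in> Poly_Mapping.keys f" for w
      using word[of "letters w" "Poly_Mapping.lookup f w"] f(1) that
      by (simp add: free_algebra_carrier_iff)
    have "y = q (\<Sum>w\<in>Poly_Mapping.keys f. ?s w)"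
      unfolding f(2) using poly_mapping_eq_sum_single[of f] by simp
    also have "\<dots> = (\<Oplus>\<^bsub>Y\<^esub>w\<in>Poly_Mapping.keys f. q (?s w))" using cl by (intro q_sum) auto
    also have "\<dots> \<in> Y.stab V" using st by (intro Y.submod_finsum[OF S])
    finally have "y \<in> Y.stab V" .
    then show "y \<in> V" using Y.stabD[of y V "\<one>\<^bsub>Y\<^esub>"] Y.stab_closed[of y V] one by simp
  qed
qed

text \<open>For infinite \<open>m\<close> all exponents are admissible. For finite \<open>m\<close>
  the roots are the indeterminates, which are units of the coefficient ring, so
  \<open>cyclotomic_span\<close> applies.\<close>

lemma q_cyclotomic: "qX [^]\<^bsub>Y\<^esub> (a::int) \<in> Y.sp ((\<lambda>e. qX [^]\<^bsub>Y\<^esub> e) ` E_set m)"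
proof (cases m)
  case infinity
  have "qX [^]\<^bsub>Y\<^esub> e \<in> carrier Y" for e :: int
    using Y.Units_int_pow(1)[OF qX_Units] by auto
  then show ?thesis using infinity by (intro Y.lin_span_base) (auto simp: E_set_def)
next
  case (enat k)
  then have k: "0 < k" using m_pos by (simp add: zero_enat_def)
  let ?v = "\<lambda>i. indet_pow (Ind_v i) 1"
  have v: "?v i \<in> Units (coeff_ring m)" if "i \<in> {1..k}" for i
    using that enat by (intro indet_pow_Units) (auto simp: indets_def)
  have prod: "q (prod_list (map (\<lambda>i. letter Gen_X - scal (?v i)) is)) =
      mprod Y (map (\<lambda>v. qX \<ominus>\<^bsub>Y\<^esub> v \<odot>\<^bsub>Y\<^esub> \<one>\<^bsub>Y\<^esub>) (map ?v is)) \<and>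
      prod_list (map (\<lambda>i. letter Gen_X - scal (?v i)) is) \<in> carrier F"
    if "set is \<subseteq> {1..k}" for "is"
    using that
  proof (induction "is")
    case (Cons i "is")
    have vi: "?v i \<in> carrier (coeff_ring m)" using v Cons.prems by auto
    then have cl: "letter Gen_X - scal (?v i) \<in> carrier F" by (intro free_algebra_closed(5,8)) auto
    show ?case using Cons vi cl by (simp add: q_mult q_diff q_scal F_closed)
  qed (simp add: q_one)
  have "q (prod_list (map (\<lambda>i. letter Gen_X - scal (?v i)) [1..<k + 1])) = \<zero>\<^bsub>Y\<^esub>"
    by (rule q_relator[OF relators.X_cyclotomic[OF enat]])
  then have "mprod Y (map (\<lambda>v. qX \<ominus>\<^bsub>Y\<^esub> v \<odot>\<^bsub>Y\<^esub> \<one>\<^bsub>Y\<^esub>) (map ?v [1..<k + 1])) = \<zero>\<^bsub>Y\<^esub>"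
    using prod[of "[1..<k + 1]"] by (simp add: subset_eq del: upt_Suc)
  then have "qX [^]\<^bsub>Y\<^esub> a \<in> Y.sp (Y.lowpow qX (length (map ?v [1..<k + 1])))"
    by (intro Y.cyclotomic_span qX_Units) (use v k in \<open>auto simp del: upt_Suc\<close>)
  moreover have "length (map ?v [1..<k + 1]) = k" by simp
  ultimately show ?thesis using enat by (simp only: E_set_def enat.case)
qed

sublocale Y: affine_yokonuma Y "coeff_ring m" d n tt gg qX zz "E_set m"
proof unfold_locales
  show "0 < d" "0 < n" by (rule d_pos n_pos)+
  show "tt j \<in> carrier Y" for j by (simp add: tt_def)
  show "gg i \<in> carrier Y" for i by (simp add: gg_def)
  show "qX \<in> Units Y" by (rule qX_Units)
  show "zz \<in> carrier (coeff_ring m)" by (rule zz_closed)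
  show "j \<notin> {1..n} \<Longrightarrow> tt j = \<one>\<^bsub>Y\<^esub>" for j by (auto simp: tt_def)
  show "i \<notin> {1..<n} \<Longrightarrow> gg i = \<one>\<^bsub>Y\<^esub>" for i by (auto simp: gg_def)
  show "gg i \<otimes>\<^bsub>Y\<^esub> gg j = gg j \<otimes>\<^bsub>Y\<^esub> gg i" if "Suc i < j" for i j
  proof (cases "i \<in> {1..<n} \<and> j \<in> {1..<n}")
    case True
    then have "letter (Gen_g i) * letter (Gen_g j) - letter (Gen_g j) * letter (Gen_g i) \<in> relators d m n"
      using that by (intro relators.g_commute) auto
    then show ?thesis using True q_eqI by (simp add: gg_def q_mult[symmetric] F_closed)
  qed (auto simp: gg_def)
  show "gg i \<otimes>\<^bsub>Y\<^esub> gg (Suc i) \<otimes>\<^bsub>Y\<^esub> gg i = gg (Suc i) \<otimes>\<^bsub>Y\<^esub> gg i \<otimes>\<^bsub>Y\<^esub> gg (Suc i)"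
    if "1 \<le> i" "Suc i < n" for i
    using that q_eqI[OF relators.g_braid[of i n d m]]
    by (simp add: gg_def q_mult[symmetric] F_closed)
  show "tt i \<otimes>\<^bsub>Y\<^esub> tt j = tt j \<otimes>\<^bsub>Y\<^esub> tt i" for i j
    using q_eqI[OF relators.t_commute[of i n j d m]]
    by (auto simp: tt_def q_mult[symmetric] F_closed)
  show "tt j \<otimes>\<^bsub>Y\<^esub> gg i = gg i \<otimes>\<^bsub>Y\<^esub> tt (Transposition.transpose i (Suc i) j)" if i: "i \<in> {1..<n}" for i j
  proof (cases "j \<in> {1..n}")
    case True
    then have tr: "Transposition.transpose i (Suc i) j \<in> {1..n}"
      using i by (auto simp: Transposition.transpose_def)
    show ?thesis
      using q_eqI[OF relators.t_g[OF True i, of d m]] True tr i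
      by (simp add: tt_def gg_def q_mult[symmetric] F_closed)
  next
    case False
    then have "Transposition.transpose i (Suc i) j = j" using i by (auto simp: Transposition.transpose_def)
    then show ?thesis using False i by (auto simp: tt_def gg_def)
  qed
  show "tt j [^]\<^bsub>Y\<^esub> d = \<one>\<^bsub>Y\<^esub>" for j
    using q_eqI[OF relators.t_order[of j n d m]] Y.nat_pow_one
    by (auto simp: tt_def q_pow q_one F_closed)
  show "gg i \<otimes>\<^bsub>Y\<^esub> gg i = \<one>\<^bsub>Y\<^esub> \<oplus>\<^bsub>Y\<^esub>
      (zz \<odot>\<^bsub>Y\<^esub> (\<Oplus>\<^bsub>Y\<^esub>s\<in>{0..<d}. tt i [^]\<^bsub>Y\<^esub> s \<otimes>\<^bsub>Y\<^esub> tt (Suc i) [^]\<^bsub>Y\<^esub> (d - s))) \<otimes>\<^bsub>Y\<^esub> gg i"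
    if i: "i \<in> {1..<n}" for i
  proof -
    let ?c = "scal (indet_pow Ind_q 1 - indet_pow Ind_q (- 1)) * e_elt d i"
    have cl: "letter (Gen_g i) \<in> carrier F" "?c \<in> carrier F"
      using i e_elt_closed[OF i] q_diff_indet_closed by (auto intro: F_closed)
    then have "q (letter (Gen_g i) ^ 2) = q (1 + ?c * letter (Gen_g i))"
      by (intro q_eqI relators.g_quadratic[OF i]) (simp_all add: F_closed)
    then have "qg i \<otimes>\<^bsub>Y\<^esub> qg i = \<one>\<^bsub>Y\<^esub> \<oplus>\<^bsub>Y\<^esub> q ?c \<otimes>\<^bsub>Y\<^esub> qg i"
      using cl by (simp add: q_add q_mult q_one power2_eq_square F_closed)
    then show ?thesis unfolding q_e[OF i] using i by (simp add: gg_def)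
  qed
  show "qX \<otimes>\<^bsub>Y\<^esub> gg 1 \<otimes>\<^bsub>Y\<^esub> qX \<otimes>\<^bsub>Y\<^esub> gg 1 = gg 1 \<otimes>\<^bsub>Y\<^esub> qX \<otimes>\<^bsub>Y\<^esub> gg 1 \<otimes>\<^bsub>Y\<^esub> qX" if "1 < n"
    using that q_eqI[OF relators.X_g1[of n d m]]
    by (simp add: gg_def q_mult[symmetric] F_closed)
  show "qX \<otimes>\<^bsub>Y\<^esub> gg i = gg i \<otimes>\<^bsub>Y\<^esub> qX" if "2 \<le> i" for i
    using that q_eqI[OF relators.X_g[of i n d m]]
    by (auto simp: gg_def q_mult[symmetric] F_closed)
  show "qX \<otimes>\<^bsub>Y\<^esub> tt j = tt j \<otimes>\<^bsub>Y\<^esub> qX" for j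
    using q_eqI[OF relators.X_t[of j n d m]]
    by (auto simp: tt_def q_mult[symmetric] F_closed)
  show "0 \<in> E_set m" using m_pos by (auto simp: E_set_def zero_enat_def split: enat.split)
  show "k \<in> E_set m" if "a \<in> E_set m" "b \<in> E_set m" "a \<le> k" "k \<le> b" for a b k
    using that by (auto simp: E_set_def split: enat.splits)
  show "qX [^]\<^bsub>Y\<^esub> a \<in> Y.sp ((\<lambda>e. qX [^]\<^bsub>Y\<^esub> e) ` E_set m)" for a :: int by (rule q_cyclotomic)
  show "carrier Y \<subseteq> V" if "Y.submod V" "\<one>\<^bsub>Y\<^esub> \<in> V" "\<And>j. tt j \<in> Y.stab V" "\<And>i. gg i \<in> Y.stab V"
    "qX \<in> Y.stab V" "inv\<^bsub>Y\<^esub> qX \<in> Y.stab V" for V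
    using that by (rule q_generated)
qed

section \<open>Comparison with the generating sets of the theorem\<close>

lemma X_el_eq_JM: "i \<le> n \<Longrightarrow> X_el d m n i = Y.JM i"
  by (induction i rule: Y.JM.induct) (simp_all add: gg_def g_el_def)

lemma gs_eq:
  assumes "i \<in> {1..<n}"
  shows "Y.gs True i = g_el d m n i" "Y.gs False i = g_inv d m n i"
  using assms by (auto simp: Y.gs_def gg_def g_el_def g_inv_def)

text \<open>The bounds keep all indices in \<open>{1..<n}\<close>; outside, \<open>gg\<close> is the
  unit by convention while \<open>g_el\<close> is not.\<close>

lemma W_word_eq:
  assumes "k \<le> n" "J < k" and "\<And>i. i \<in> {1..<n} \<Longrightarrow> l i = Y.gs e i" "\<And>i. i \<in> {1..<n} \<Longrightarrow> r i = Y.gs e' i"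
  shows "W_word d m n l r k J a b = Y.W e e' k J a b"
proof -
  have maps: "map l (rev [1..<J + 1]) = map (Y.gs e) (rev [1..<J + 1])"
    "map r [1..<k] = map (Y.gs e') [1..<k]"
    using assms by (auto intro!: map_cong)
  have t1: "t_el d m n 1 = tt 1" using n_pos by (simp add: t_el_def tt_def)
  show ?thesis
    unfolding W_word_def Y.W_def Y.Lw_def Y.Rw_def maps t1 by simp
qed

lemma ind_products_eq_Ind:
  assumes "\<And>i. i \<in> {1..<n} \<Longrightarrow> l i = Y.gs e i" "\<And>i. i \<in> {1..<n} \<Longrightarrow> r i = Y.gs e' i"
  shows "ind_products d m n (W_word d m n l r) = Y.Ind e e' n"
proof -
  let ?p = "\<lambda>w J a b. mprod Y (map (\<lambda>k. w k (J k) (a k) (b k)) (rev [1..<n + 1]))"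
  let ?C = "\<lambda>J a b. \<forall>k\<in>{1..n}. J k \<in> {0..k - 1} \<and> a k \<in> E_set m \<and> b k \<in> {0..int d - 1}"
  have eq: "?p (W_word d m n l r) J a b = ?p (Y.W e e') J a b" if C: "?C J a b" for J a b
  proof (intro arg_cong[of _ _ "mprod Y"] map_cong refl)
    fix k assume "k \<in> set (rev [1..<n + 1])"
    then have k: "k \<in> {1..n}" by auto
    then have "J k \<in> {0..k - 1}" using C by blast
    then have "J k < k" using k by auto
    then show "W_word d m n l r k (J k) (a k) (b k) = Y.W e e' k (J k) (a k) (b k)"
      using k by (intro W_word_eq assms) auto
  qed
  \<comment> \<open>The words agree only for admissible indices, so the condition \<open>?C\<close>
    is kept beside the equation while rewriting.\<close>
  have "(v = ?p (W_word d m n l r) J a b \<and> ?C J a b) = (v = ?p (Y.W e e') J a b \<and> ?C J a b)" for v J a b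
    by (rule rev_conj_cong) (simp_all only: eq)
  then show ?thesis
    unfolding ind_products_def Y.Ind_eq_products by (simp only:)
qed

lemma B_AK_eq_AK: "B_AK d m n B = Y.AK B"
proof -
  have "mprod Y (map (\<lambda>i. X_el d m n i [^]\<^bsub>Y\<^esub> a i) [1..<n + 1]) = Y.monoJM a" for a :: "nat \<Rightarrow> int"
    unfolding Y.monoJM_def by (intro arg_cong[of _ _ "mprod Y"] map_cong) (auto simp: X_el_eq_JM)
  then show ?thesis unfolding B_AK_def Y.AK_def by simp
qed

lemma YH_generators_closed:
  "(\<lambda>c. c \<odot>\<^bsub>Y\<^esub> \<one>\<^bsub>Y\<^esub>) ` carrier (coeff_ring m) \<union> t_el d m n ` {1..n} \<union> g_el d m n ` {1..<n} \<subseteq> carrier Y"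
  by (auto simp: t_el_def g_el_def)

lemma YH_closed: "YH d m n \<subseteq> carrier Y"
  unfolding YH_def by (rule Y.generate_ring_incl[OF YH_generators_closed])

lemma stab_YH:
  assumes "y \<in> YH d m n" shows "y \<in> Y.stab (YH d m n)"
  using assms YH_closed generate_ring.eng_mult[of _ Y] unfolding Y.stab_def YH_def by blast

lemma tt_in_YH: "tt j \<in> YH d m n"
  unfolding YH_def tt_def by (auto intro!: generate_ring.one generate_ring.incl simp: t_el_def)

lemma gg_in_YH: "gg i \<in> YH d m n"
  unfolding YH_def gg_def by (auto intro!: generate_ring.one generate_ring.incl simp: g_el_def)

lemma lin_generates_B_AK:
  assumes "lin_generates (coeff_ring m) Y B (YH d m n)"
  shows "lin_generates (coeff_ring m) Y (B_AK d m n B) (carrier Y)"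
proof -
  have B: "B \<subseteq> YH d m n" "Y.sp B = YH d m n" using assms by (auto simp: lin_generates_def)
  have cl: "B \<subseteq> carrier Y" using B YH_closed by blast
  have one: "\<one>\<^bsub>Y\<^esub> \<in> YH d m n" unfolding YH_def by (rule generate_ring.one)
  have "Y.sp (Y.AK B) = carrier Y"
    by (rule Y.lin_span_AK[OF cl]; unfold B(2); intro one stab_YH tt_in_YH gg_in_YH)
  moreover have "Y.AK B \<subseteq> carrier Y" using cl by (auto simp: Y.AK_def)
  ultimately show ?thesis by (simp add: lin_generates_def B_AK_eq_AK)
qed

lemma lin_generates_ind_products:
  assumes "\<And>i. i \<in> {1..<n} \<Longrightarrow> l i = Y.gs e i" "\<And>i. i \<in> {1..<n} \<Longrightarrow> r i = Y.gs e' i"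
  shows "lin_generates (coeff_ring m) Y (ind_products d m n (W_word d m n l r)) (carrier Y)"
proof -
  have eq: "ind_products d m n (W_word d m n l r) = Y.Ind e e' n"
    by (intro ind_products_eq_Ind assms)
  show ?thesis
    unfolding lin_generates_def eq using Y.lin_span_Ind[of e e'] Y.Ind_closed[of e e' n] by simp
qed

end

theorem proposition4p2:
  fixes d n :: nat and m :: enat and B :: "gen free_alg set set"
  assumes "0 < d" and "0 < n" and "0 < m"
    and "basis_of (coeff_ring m) (Yalg d m n) B (YH d m n)"
  shows "lin_generates (coeff_ring m) (Yalg d m n) (B_AK d m n B) (carrier (Yalg d m n)) \<and>
     lin_generates (coeff_ring m) (Yalg d m n) (B_Ind d m n) (carrier (Yalg d m n)) \<and>
     lin_generates (coeff_ring m) (Yalg d m n) (B_Ind_minus d m n) (carrier (Yalg d m n)) \<and>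
     lin_generates (coeff_ring m) (Yalg d m n) (Bt_Ind d m n) (carrier (Yalg d m n)) \<and>
     lin_generates (coeff_ring m) (Yalg d m n) (Bt_Ind_minus d m n) (carrier (Yalg d m n))"
proof -
  interpret yokonuma_parameters d n m by unfold_locales (rule assms)+
  show ?thesis
    unfolding B_Ind_def W_el_def B_Ind_minus_def W_el_minus_def Bt_Ind_def Wt_el_def
      Bt_Ind_minus_def Wt_el_minus_def
  proof (intro conjI)
    show "lin_generates (coeff_ring m) (Yalg d m n) (B_AK d m n B) (carrier (Yalg d m n))"
      using assms(4) by (intro lin_generates_B_AK) (simp add: basis_of_def)
  \<comment> \<open>Unification with the two equations of \<open>gs_eq\<close> selects the pair of
    signs for each of the four families.\<close>
  qed (rule lin_generates_ind_products; rule gs_eq[symmetric]; assumption)+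
qed

end
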